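(* Let $1<p<\infty$, let $\theta$ be an inner function, and let $\phi_+$ be a function. Then $K_\theta=\mathcal{K}_{\min}(\phi_+)$ if and only if $\phi_+\in H_p^+$ and $\phi_+=\theta\phi_-$ with $\phi_-$ outer in $H_p^-$. (Here $K_\theta=\mathcal{K}_{\min}(\phi_+)$ is understood to include that $\phi_+\in H_p^+\setminus\{0\}$, so that $\mathcal{K}_{\min}(\phi_+)$ is defined.)
   Context: $H_p^\pm=H^p(\mathbb{C}^\pm)$ are the Hardy spaces of the upper/lower half-plane, identified via boundary values with closed subspaces of $L_p=L^p(\mathbb{R})$; $L_\infty=L^\infty(\mathbb{R})$. $P^+:L_p\to H_p^+$ is the projection with kernel $H_p^-$; for $g\in L_\infty$ the Toeplitz operator is $T_gf_+=P^+(gf_+)$ on $H_p^+$, so $\ker T_g=\{f_+\in H_p^+: gf_+\in H_p^-\}$. A T-kernel is a set of the form $\ker T_g$ with $g\in L_\infty$. An inner function is a $\theta\in H_\infty^+$ with $|\theta|=1$ a.e. on $\mathbb{R}$; a function in $H_p^-$ is outer if its complex conjugate (on $\mathbb{R}$) is outer in $H_p^+$. The model space is $K_\theta:=H_p^+\cap\theta H_p^-=\ker T_{\overline\theta}$. For $\phi_+\in H_p^+\setminus\{0\}$, $\mathcal{K}_{\min}(\phi_+)$ denotes the smallest T-kernel containing $\phi_+$ (the minimal kernel for $\phi_+$): it is a T-kernel containing $\phi_+$, and for any $g\in L_\infty$, $\phi_+\in\ker T_g$ implies $\mathcal{K}_{\min}(\phi_+)\subset\ker T_g$. It is known to exist,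 and if $\phi_+=I_+O_+$ is an inner-outer factorisation then $\mathcal{K}_{\min}(\phi_+)=\ker T_{\overline{I}_+\overline{O}_+/O_+}$. *)

theory Defs
  imports "HOL-Complex_Analysis.Complex_Analysis"
begin

text \<open>
  Elements of \<open>L_p\<close> and of the Hardy spaces are represented by Borel functions on the real line.
  All function sets below are closed under almost-everywhere equality of Borel functions,
  so equality and inclusion of such sets are equality and inclusion of sets of classes.
\<close>

definition Lp :: "real \<Rightarrow> (real \<Rightarrow> complex) set" where
  "Lp p = {f. f \<in> borel_measurable lborel \<and> integrable lborel (\<lambda>x. cmod (f x) powr p)}"

definition Linf :: "(real \<Rightarrow> complex) set" where
  "Linf = {f. f \<in> borel_measurable lborel \<and> (\<exists>C. AE x in lborel. cmod (f x) \<le> C)}"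

definition hardy_upper :: "real \<Rightarrow> (complex \<Rightarrow> complex) set" where
  "hardy_upper p = {F. F holomorphic_on {z. Im z > 0} \<and>
     (SUP y\<in>{0<..}. \<integral>\<^sup>+x. ennreal (cmod (F (Complex x y)) powr p) \<partial>lborel) < \<infinity>}"

definition hardy_lower :: "real \<Rightarrow> (complex \<Rightarrow> complex) set" where
  "hardy_lower p = {F. F holomorphic_on {z. Im z < 0} \<and>
     (SUP y\<in>{..<0}. \<integral>\<^sup>+x. ennreal (cmod (F (Complex x y)) powr p) \<partial>lborel) < \<infinity>}"

definition hardy_upper_inf :: "(complex \<Rightarrow> complex) set" where
  "hardy_upper_inf = {F. F holomorphic_on {z. Im z > 0} \<and> bounded (F ` {z. Im z > 0})}"

definition boundary_upper :: "(complex \<Rightarrow> complex) \<Rightarrow> (real \<Rightarrow> complex) \<Rightarrow> bool" where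
  "boundary_upper F f \<longleftrightarrow> (AE x in lborel. ((\<lambda>y. F (Complex x y)) \<longlongrightarrow> f x) (at_right 0))"

definition boundary_lower :: "(complex \<Rightarrow> complex) \<Rightarrow> (real \<Rightarrow> complex) \<Rightarrow> bool" where
  "boundary_lower F f \<longleftrightarrow> (AE x in lborel. ((\<lambda>y. F (Complex x y)) \<longlongrightarrow> f x) (at_left 0))"

definition Hp_plus :: "real \<Rightarrow> (real \<Rightarrow> complex) set" where
  "Hp_plus p = {f \<in> Lp p. \<exists>F\<in>hardy_upper p. boundary_upper F f}"

definition Hp_minus :: "real \<Rightarrow> (real \<Rightarrow> complex) set" where
  "Hp_minus p = {f \<in> Lp p. \<exists>F\<in>hardy_lower p. boundary_lower F f}"

definition Hinf_plus :: "(real \<Rightarrow> complex) set" where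
  "Hinf_plus = {f \<in> Linf. \<exists>F\<in>hardy_upper_inf. boundary_upper F f}"

definition inner_fun :: "(real \<Rightarrow> complex) \<Rightarrow> bool" where
  "inner_fun \<theta> \<longleftrightarrow> \<theta> \<in> Hinf_plus \<and> (AE x in lborel. cmod (\<theta> x) = 1)"

text \<open>
  In the classical formula \<open>u = log k\<close> for a positive weight \<open>k\<close>, and \<open>k = |F|\<close> a.e. on the real line.
\<close>

definition outer_formula :: "(complex \<Rightarrow> complex) \<Rightarrow> bool" where
  "outer_formula F \<longleftrightarrow>
     (\<exists>(c::complex) (u::real \<Rightarrow> real).
        cmod c = 1 \<and>
        integrable lborel (\<lambda>t. u t / (1 + t\<^sup>2)) \<and>
        (\<forall>z. Im z > 0 \<longrightarrow>
           F z = c * exp (1 / (complex_of_real pi * \<i>) *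
             (\<integral>t. (1 + complex_of_real t * z) / (complex_of_real t - z)
                  * complex_of_real (u t / (1 + t\<^sup>2)) \<partial>lborel))))"

definition outer_plus :: "real \<Rightarrow> (real \<Rightarrow> complex) \<Rightarrow> bool" where
  "outer_plus p f \<longleftrightarrow>
     f \<in> Lp p \<and> (\<exists>F\<in>hardy_upper p. boundary_upper F f \<and> outer_formula F)"

definition outer_minus :: "real \<Rightarrow> (real \<Rightarrow> complex) \<Rightarrow> bool" where
  "outer_minus p f \<longleftrightarrow> f \<in> Hp_minus p \<and> outer_plus p (\<lambda>x. cnj (f x))"

text \<open>
  \<open>riesz_projection p f h\<close> says that \<open>h\<close> is (a representative of) \<open>P\<^sup>+ f\<close>, the projection onto
  \<open>H_p\<^sup>+\<close> with kernel \<open>H_p\<^sup>-\<close>. It is given as a relation because its value is only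
  determined almost everywhere and its totality on \<open>L_p\<close> for \<open>1 < p < \<infinity>\<close> is a theorem (M. Riesz).
  Likewise \<open>toeplitz p g f h\<close> says that \<open>T_g f = h\<close>.
\<close>

definition riesz_projection :: "real \<Rightarrow> (real \<Rightarrow> complex) \<Rightarrow> (real \<Rightarrow> complex) \<Rightarrow> bool" where
  "riesz_projection p f h \<longleftrightarrow> h \<in> Hp_plus p \<and> (\<lambda>x. f x - h x) \<in> Hp_minus p"

definition toeplitz ::
  "real \<Rightarrow> (real \<Rightarrow> complex) \<Rightarrow> (real \<Rightarrow> complex) \<Rightarrow> (real \<Rightarrow> complex) \<Rightarrow> bool" where
  "toeplitz p g f h \<longleftrightarrow> f \<in> Hp_plus p \<and> riesz_projection p (\<lambda>x. g x * f x) h"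

definition toeplitz_kernel :: "real \<Rightarrow> (real \<Rightarrow> complex) \<Rightarrow> (real \<Rightarrow> complex) set" where
  "toeplitz_kernel p g = {f. toeplitz p g f (\<lambda>_. 0)}"

lemma zero_in_Hp_plus: "(\<lambda>_. 0) \<in> Hp_plus p"
proof -
  have "(\<lambda>_. 0) \<in> hardy_upper p"
    by (simp add: hardy_upper_def)
  moreover have "boundary_upper (\<lambda>_. 0) (\<lambda>_. 0)"
    by (simp add: boundary_upper_def)
  ultimately show ?thesis
    by (auto simp: Hp_plus_def Lp_def)
qed

lemma toeplitz_kernel_eq:
  "toeplitz_kernel p g = {f \<in> Hp_plus p. (\<lambda>x. g x * f x) \<in> Hp_minus p}"
  by (auto simp: toeplitz_kernel_def toeplitz_def riesz_projection_def zero_in_Hp_plus)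

definition T_kernel :: "real \<Rightarrow> (real \<Rightarrow> complex) set \<Rightarrow> bool" where
  "T_kernel p K \<longleftrightarrow> (\<exists>g\<in>Linf. K = toeplitz_kernel p g)"

definition model_space :: "real \<Rightarrow> (real \<Rightarrow> complex) \<Rightarrow> (real \<Rightarrow> complex) set" where
  "model_space p \<theta> = {f \<in> Hp_plus p. \<exists>h\<in>Hp_minus p. AE x in lborel. f x = \<theta> x * h x}"

text \<open>The smallest T-kernel containing \<open>\<phi>\<close>; the order on sets is inclusion.\<close>

definition min_kernel :: "real \<Rightarrow> (real \<Rightarrow> complex) \<Rightarrow> (real \<Rightarrow> complex) set" where
  "min_kernel p \<phi> = (LEAST K. T_kernel p K \<and> \<phi> \<in> K)"

end

theory Submission imports Defs begin

text \<open>
  On the line an outer function \<open>O\<close> with \<open>|O| = |\<phi>|\<close> makes the symbol \<open>g = cnj \<phi> / O\<close> unimodular, and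
  \<open>g * \<phi> = cnj O\<close> lies in \<open>H_p\<^sup>-\<close>. The kernel of this symbol is the least T-kernel containing
  \<open>\<phi>\<close>. Indeed, if \<open>k * \<phi>\<close> and \<open>g * f\<close> lie in \<open>H_p\<^sup>-\<close>, then
  \<open>cnj (k * f) = cnj (k * \<phi>) * cnj (g * f) / O\<close> is a product of two \<open>H_p\<^sup>+\<close> functions divided by an outer
  one. Its modulus is in \<open>L_p\<close>, so it belongs to \<open>H_p\<^sup>+\<close> by Smirnov's theorem (\<open>Hp_plus_smirnov\<close>), that is,
  \<open>k * f\<close> belongs to \<open>H_p\<^sup>-\<close>. This is \<open>min_kernel_eq_toeplitz_kernel\<close>.

  If \<open>\<phi> = \<theta> * h\<close> with \<open>cnj h\<close> outer, then \<open>O = cnj h\<close> and \<open>g = cnj \<theta>\<close> serve here, and the kernel of the symbol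
  \<open>cnj \<theta>\<close> is the model space.

  Conversely, suppose that the model space is the minimal kernel of \<open>\<phi>\<close>. Then \<open>\<phi> = \<theta> * h\<close> for some \<open>h\<close> in \<open>H_p\<^sup>-\<close>.
  Put \<open>b = cnj h\<close> and let \<open>I\<close> be the quotient of \<open>b\<close> by the outer function of modulus \<open>|b|\<close>. The function
  \<open>\<phi>\<close> is in the kernel of the symbol \<open>cnj \<theta> * I\<close>, so by minimality the whole model space is, which means that the
  model space is invariant under multiplication by \<open>I\<close>. Hence \<open>I^n * \<phi>\<close> is in the model space for every \<open>n\<close>,
  and \<open>b = I^n * b_n\<close> with \<open>b_n\<close> in \<open>H_p\<^sup>+\<close> and \<open>|b_n| = |b|\<close> on the line. At each point of the half-plane
  \<open>|b|\<close> is then at most \<open>|I|^n\<close> times the Poisson integral of its boundary modulus. Letting \<open>n\<close> grow,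
  \<open>|I| = 1\<close> wherever \<open>b\<close> does not vanish, so \<open>I\<close> is constant by the maximum modulus principle and \<open>b\<close> is
  outer (\<open>outer_if_multiplier_invariant\<close>).

  The Hardy space theory behind this rests on Poisson integrals. Those of functions integrable against
  \<open>1 / (1 + t\<^sup>2)\<close> have radial limits almost everywhere (\<open>poisson_radial_limit\<close>), and holomorphic functions with
  uniformly integrable slices are dominated by the Poisson integral of their boundary modulus
  (\<open>modulus_le_poisson_boundary\<close>). Multiplying by suitable outer functions upgrades this to Smirnov's
  inequality (\<open>smirnov_inequality\<close>) and to the integrability of the logarithm of the boundary modulus
  (\<open>log_modulus_poisson_integrable\<close>). Radial limits of the outer functions themselves
  come from an \<open>L\<^sup>2\<close> argument (\<open>bounded_radial_limit\<close>).
\<close>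

section \<open>The Poisson kernel of the upper half-plane\<close>

definition poisson_kernel :: "complex \<Rightarrow> real \<Rightarrow> real" where
  "poisson_kernel z t = Im z / (pi * ((t - Re z)\<^sup>2 + (Im z)\<^sup>2))"

definition poisson :: "(real \<Rightarrow> real) \<Rightarrow> complex \<Rightarrow> real" where
  "poisson u z = (\<integral>t. poisson_kernel z t * u t \<partial>lborel)"

text \<open>
  The integral in \<open>ennreal\<close> carries estimates for boundary moduli whose integrability is not known in advance.
\<close>

abbreviation nn_poisson :: "(real \<Rightarrow> real) \<Rightarrow> complex \<Rightarrow> ennreal" where
  "nn_poisson k z \<equiv> \<integral>\<^sup>+t. ennreal (poisson_kernel z t) * ennreal (k t) \<partial>lborel"

definition poisson_integrable :: "(real \<Rightarrow> real) \<Rightarrow> bool" where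
  "poisson_integrable u \<longleftrightarrow> integrable lborel (\<lambda>t. u t / (1 + t\<^sup>2))"

lemma poisson_kernel_measurable [measurable]: "poisson_kernel z \<in> borel_measurable borel"
  unfolding poisson_kernel_def by measurable

lemma poisson_kernel_denom_pos: "Im z \<noteq> 0 \<Longrightarrow> (t - Re z)\<^sup>2 + (Im z)\<^sup>2 > 0"
  by (simp add: add_nonneg_pos)

lemma poisson_kernel_pos: "Im z > 0 \<Longrightarrow> poisson_kernel z t > 0"
  by (simp add: poisson_kernel_def poisson_kernel_denom_pos)

lemma poisson_kernel_le:
  assumes "Im z > 0"
  shows "poisson_kernel z t \<le> 1 / (pi * Im z)"
proof -
  have "poisson_kernel z t \<le> Im z / (pi * (Im z)\<^sup>2)"
    unfolding poisson_kernel_def using assms by (intro divide_left_mono mult_left_mono) (auto intro!: mult_pos_pos poisson_kernel_denom_pos)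
  then show ?thesis using assms by (simp add: power2_eq_square)
qed

lemma one_plus_square_pos: "1 + t\<^sup>2 > (0::real)"
  by (simp add: add_pos_nonneg)

text \<open>
  The kernel at any point of the half-plane is comparable to \<open>1 / (1 + t\<^sup>2)\<close>, from above here and from below in the
  next lemma. So \<open>poisson_integrable\<close> can be tested with the kernel at whichever point is convenient, and the
  integrability condition in the outer formula is exactly convergence of the Poisson integral.
\<close>

lemma poisson_kernel_upper:
  assumes "Im z > 0"
  obtains c where "c > 0" "\<And>t. poisson_kernel z t \<le> c / (1 + t\<^sup>2)"
proof
  define x y where "x = Re z" and "y = Im z"
  have y: "y > 0" using assms y_def by simp
  \<comment> \<open>From t^2 \<le> 2 (t - x)^2 + 2 x^2: the summand 2 absorbs the square of t - x, the quotient by y^2 the rest.\<close>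
  define k where "k = 2 + (1 + 2 * x\<^sup>2) / y\<^sup>2"
  have k: "k > 0" unfolding k_def by (simp add: add_pos_nonneg)
  show "k * y / pi > 0" using k y by simp
  fix t
  have "(t - x)\<^sup>2 * k + y\<^sup>2 * k \<ge> (t - x)\<^sup>2 * 2 + (2 * y\<^sup>2 + 1 + 2 * x\<^sup>2)"
  proof (rule add_mono)
    show "(t - x)\<^sup>2 * 2 \<le> (t - x)\<^sup>2 * k" unfolding k_def by (intro mult_left_mono) auto
    show "2 * y\<^sup>2 + 1 + 2 * x\<^sup>2 \<le> y\<^sup>2 * k" unfolding k_def using y by (simp add: field_simps)
  qed
  moreover have "1 + t\<^sup>2 \<le> 1 + 2 * (t - x)\<^sup>2 + 2 * x\<^sup>2"
    using sum_squares_ge_zero[of "t - 2 * x" 0] by (simp add: power2_eq_square algebra_simps)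
  ultimately have *: "1 + t\<^sup>2 \<le> k * ((t - x)\<^sup>2 + y\<^sup>2)" by (simp add: algebra_simps) (smt (verit) zero_le_power2)
  have d: "(t - x)\<^sup>2 + y\<^sup>2 > 0" using y by (simp add: add_nonneg_pos)
  have "1 / ((t - x)\<^sup>2 + y\<^sup>2) \<le> k / (1 + t\<^sup>2)"
    using * d one_plus_square_pos[of t] by (simp add: field_simps)
  then have "y / pi * (1 / ((t - x)\<^sup>2 + y\<^sup>2)) \<le> y / pi * (k / (1 + t\<^sup>2))"
    using y by (intro mult_left_mono) auto
  then show "poisson_kernel z t \<le> k * y / pi / (1 + t\<^sup>2)"
    unfolding poisson_kernel_def x_def[symmetric] y_def[symmetric] by (simp add: mult_ac)
qed

lemma poisson_kernel_lower:
  assumes "Im z > 0"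
  obtains c where "c > 0" "\<And>t. 1 / (1 + t\<^sup>2) \<le> c * poisson_kernel z t"
proof
  define x y where "x = Re z" and "y = Im z"
  have y: "y > 0" using assms y_def by simp
  define k where "k = 2 + 2 * x\<^sup>2 + y\<^sup>2"
  have k: "k > 0" unfolding k_def by (simp add: add_pos_nonneg)
  show "k * pi / y > 0" using k y by simp
  fix t
  have "(t - x)\<^sup>2 \<le> 2 * t\<^sup>2 + 2 * x\<^sup>2"
    using sum_squares_ge_zero[of "t + x" 0] by (simp add: power2_eq_square algebra_simps)
  moreover have "k * (1 + t\<^sup>2) = 2 + 2 * x\<^sup>2 + y\<^sup>2 + 2 * t\<^sup>2 + (2 * x\<^sup>2 + y\<^sup>2) * t\<^sup>2"
    by (simp add: k_def algebra_simps)
  moreover have "(2 * x\<^sup>2 + y\<^sup>2) * t\<^sup>2 \<ge> 0" by simp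
  ultimately have *: "(t - x)\<^sup>2 + y\<^sup>2 \<le> k * (1 + t\<^sup>2)" by linarith
  have d: "(t - x)\<^sup>2 + y\<^sup>2 > 0" using y by (simp add: add_nonneg_pos)
  have "1 / (1 + t\<^sup>2) \<le> k / ((t - x)\<^sup>2 + y\<^sup>2)"
    using * d one_plus_square_pos[of t] by (simp add: field_simps)
  then show "1 / (1 + t\<^sup>2) \<le> k * pi / y * poisson_kernel z t"
    unfolding poisson_kernel_def x_def[symmetric] y_def[symmetric] using y by simp
qed

lemma has_bochner_integral_poisson_kernel:
  assumes "Im z > 0"
  shows "has_bochner_integral lborel (poisson_kernel z) 1"
proof -
  define x y where "x = Re z" and "y = Im z"
  have y: "y > 0" using assms y_def by simp
  let ?F = "\<lambda>t. arctan ((t - x) / y) / pi"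
  have der: "DERIV ?F t :> poisson_kernel z t" for t
  proof -
    have "DERIV ?F t :> inverse (1 + ((t - x) / y)\<^sup>2) * (1 / y) / pi"
      by (rule derivative_eq_intros refl | simp add: y less_imp_neq[OF y, symmetric])+
    also have "inverse (1 + ((t - x) / y)\<^sup>2) * (1 / y) / pi = poisson_kernel z t"
      unfolding poisson_kernel_def x_def[symmetric] y_def[symmetric]
      using y poisson_kernel_denom_pos[of z t]
      by (simp add: divide_simps power2_eq_square x_def y_def)
    finally show ?thesis .
  qed
  have cont: "isCont (poisson_kernel z) t" for t
    unfolding poisson_kernel_def using poisson_kernel_denom_pos[of z t] assms
    by (intro continuous_intros) auto
  have l1: "((?F \<circ> real_of_ereal) \<longlongrightarrow> (-(pi/2)) / pi) (at_right (-\<infinity>))"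
    unfolding ereal_tendsto_simps1(4)
  proof (intro tendsto_divide tendsto_const filterlim_compose[OF tendsto_arctan_at_bot])
    show "filterlim (\<lambda>t. (t - x) / y) at_bot at_bot" using y
      by (simp add: filterlim_at_bot eventually_at_bot_linorder) (metis diff_le_eq divide_le_eq order_trans)
  qed auto
  have l2: "((?F \<circ> real_of_ereal) \<longlongrightarrow> (pi/2) / pi) (at_left \<infinity>)"
    unfolding ereal_tendsto_simps1(3)
  proof (intro tendsto_divide tendsto_const filterlim_compose[OF tendsto_arctan_at_top])
    show "filterlim (\<lambda>t. (t - x) / y) at_top at_top" using y
      by (simp add: filterlim_at_top eventually_at_top_linorder) (metis le_diff_eq le_divide_eq order_trans)
  qed auto
  have ae: "AE t in lborel. -\<infinity> < ereal t \<longrightarrow> ereal t < \<infinity> \<longrightarrow> 0 \<le> poisson_kernel z t"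
    using poisson_kernel_pos[OF assms] by (intro AE_I2) (auto intro: less_imp_le)
  have "set_integrable lborel (einterval (-\<infinity>) \<infinity>) (poisson_kernel z)"
       "(LBINT t=-\<infinity>..\<infinity>. poisson_kernel z t) = (pi/2)/pi - (-(pi/2))/pi"
    using interval_integral_FTC_nonneg[where F="?F" and f="poisson_kernel z" and a="-\<infinity>" and b="\<infinity>"
         and A="(-(pi/2)) / pi" and B="(pi/2)/pi"] der cont l1 l2
         ae by auto
  then show ?thesis
    by (simp add: has_bochner_integral_iff interval_integral_to_infinity_eq interval_lebesgue_integral_def
         set_integrable_def set_lebesgue_integral_def einterval_def add_divide_distrib[symmetric])
qed

lemma poisson_kernel_sym: "poisson_kernel (Complex x y) t = poisson_kernel (Complex t y) x"
  by (simp add: poisson_kernel_def power2_commute)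


lemma poisson_kernel_nonneg: "Im z > 0 \<Longrightarrow> poisson_kernel z t \<ge> 0"
  using poisson_kernel_pos less_imp_le by blast

lemma integrable_poisson_kernel: "Im z > 0 \<Longrightarrow> integrable lborel (poisson_kernel z)"
  and integral_poisson_kernel: "Im z > 0 \<Longrightarrow> (\<integral>t. poisson_kernel z t \<partial>lborel) = 1"
  using has_bochner_integral_poisson_kernel by (auto simp: has_bochner_integral_iff)

lemma nn_integral_poisson_kernel:
  "Im z > 0 \<Longrightarrow> (\<integral>\<^sup>+t. ennreal (poisson_kernel z t) \<partial>lborel) = 1"
  by (subst nn_integral_eq_integral) (auto simp: integrable_poisson_kernel integral_poisson_kernel poisson_kernel_nonneg)

lemma poisson_integrable_measurable:
  assumes "poisson_integrable u" shows "u \<in> borel_measurable borel"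
proof -
  have "(\<lambda>t. u t / (1 + t\<^sup>2)) \<in> borel_measurable borel"
    using assms unfolding poisson_integrable_def by (auto dest: borel_measurable_integrable)
  then have "(\<lambda>t. u t / (1 + t\<^sup>2) * (1 + t\<^sup>2)) \<in> borel_measurable borel" by measurable
  moreover have "(\<lambda>t. u t / (1 + t\<^sup>2) * (1 + t\<^sup>2)) = u"
    using one_plus_square_pos by (auto simp: fun_eq_iff) (metis less_irrefl)
  ultimately show ?thesis by simp
qed

lemma poisson_integrable_iff:
  assumes z: "Im z > 0"
  shows "poisson_integrable u \<longleftrightarrow> integrable lborel (\<lambda>t. poisson_kernel z t * u t)"
proof
  assume u: "poisson_integrable u"
  note [measurable] = poisson_integrable_measurable[OF u]
  obtain c where c: "c > 0" "\<And>t. poisson_kernel z t \<le> c / (1 + t\<^sup>2)" using poisson_kernel_upper[OF z] by metis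
  have i: "integrable lborel (\<lambda>t. c * (u t / (1 + t\<^sup>2)))"
    using u unfolding poisson_integrable_def by (rule integrable_mult_right)
  show "integrable lborel (\<lambda>t. poisson_kernel z t * u t)"
  proof (rule Bochner_Integration.integrable_bound[OF i])
    show "AE t in lborel. norm (poisson_kernel z t * u t) \<le> norm (c * (u t / (1 + t\<^sup>2)))"
    proof (rule AE_I2)
      fix t
      have "norm (poisson_kernel z t * u t) \<le> c / (1 + t\<^sup>2) * \<bar>u t\<bar>"
        using mult_right_mono[OF c(2)[of t], of "\<bar>u t\<bar>"] poisson_kernel_nonneg[OF z, of t] by (simp add: abs_mult)
      then show "norm (poisson_kernel z t * u t) \<le> norm (c * (u t / (1 + t\<^sup>2)))"
        using c(1) one_plus_square_pos[of t] by (simp add: abs_mult)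
    qed
  qed measurable
next
  assume u: "integrable lborel (\<lambda>t. poisson_kernel z t * u t)"
  have m: "(\<lambda>t. poisson_kernel z t * u t) \<in> borel_measurable borel" using u by (auto dest: borel_measurable_integrable)
  have "(\<lambda>t. poisson_kernel z t * u t / poisson_kernel z t) \<in> borel_measurable borel" using m by measurable
  moreover have "(\<lambda>t. poisson_kernel z t * u t / poisson_kernel z t) = u"
    using poisson_kernel_pos[OF z] by (auto simp: fun_eq_iff) (metis less_irrefl)
  ultimately have [measurable]: "u \<in> borel_measurable borel" by simp
  obtain c where c: "c > 0" "\<And>t. 1 / (1 + t\<^sup>2) \<le> c * poisson_kernel z t" using poisson_kernel_lower[OF z] by metis
  have i: "integrable lborel (\<lambda>t. c * (poisson_kernel z t * u t))" using u by simp
  show "poisson_integrable u" unfolding poisson_integrable_def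
  proof (rule Bochner_Integration.integrable_bound[OF i])
    show "AE t in lborel. norm (u t / (1 + t\<^sup>2)) \<le> norm (c * (poisson_kernel z t * u t))"
    proof (rule AE_I2)
      fix t
      have "norm (u t / (1 + t\<^sup>2)) = 1 / (1 + t\<^sup>2) * \<bar>u t\<bar>" using one_plus_square_pos[of t] by simp
      also have "\<dots> \<le> c * poisson_kernel z t * \<bar>u t\<bar>" using c(2)[of t] by (rule mult_right_mono) simp
      finally show "norm (u t / (1 + t\<^sup>2)) \<le> norm (c * (poisson_kernel z t * u t))"
        using c(1) poisson_kernel_nonneg[OF z, of t] by (simp add: abs_mult)
    qed
  qed measurable
qed

lemma poisson_integrableI_nn:
  assumes [measurable]: "u \<in> borel_measurable borel" and z: "Im z > 0"
    and fin: "(\<integral>\<^sup>+t. ennreal (poisson_kernel z t * \<bar>u t\<bar>) \<partial>lborel) < \<infinity>"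
  shows "poisson_integrable u"
  unfolding poisson_integrable_iff[OF z]
  by (rule integrableI_bounded) (use fin poisson_kernel_nonneg[OF z] in \<open>simp_all add: abs_mult\<close>)

lemma poisson_integrable_bound:
  assumes "poisson_integrable v" "u \<in> borel_measurable borel" "\<And>t. \<bar>u t\<bar> \<le> v t"
  shows "poisson_integrable u"
proof -
  note [measurable] = assms(2)
  have i: "integrable lborel (\<lambda>t. v t / (1 + t\<^sup>2))" using assms by (simp add: poisson_integrable_def)
  show ?thesis unfolding poisson_integrable_def
  proof (rule Bochner_Integration.integrable_bound[OF i])
    show "AE t in lborel. norm (u t / (1 + t\<^sup>2)) \<le> norm (v t / (1 + t\<^sup>2))"
    proof (rule AE_I2)
      fix t show "norm (u t / (1 + t\<^sup>2)) \<le> norm (v t / (1 + t\<^sup>2))"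
        using assms(3)[of t] one_plus_square_pos[of t] by (simp add: divide_right_mono)
    qed
  qed measurable
qed

lemma poisson_integrable_const: "poisson_integrable (\<lambda>_. c)"
  using integrable_poisson_kernel[of \<i>] by (simp add: poisson_integrable_iff[of \<i>])

lemma poisson_integrable_add: "poisson_integrable u \<Longrightarrow> poisson_integrable v \<Longrightarrow> poisson_integrable (\<lambda>t. u t + v t)"
  by (simp add: poisson_integrable_iff[of \<i>] distrib_left)

lemma poisson_integrable_diff: "poisson_integrable u \<Longrightarrow> poisson_integrable v \<Longrightarrow> poisson_integrable (\<lambda>t. u t - v t)"
  by (simp add: poisson_integrable_iff[of \<i>] right_diff_distrib)

lemma poisson_integrable_uminus: "poisson_integrable u \<Longrightarrow> poisson_integrable (\<lambda>t. - u t)"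
  by (simp add: poisson_integrable_iff[of \<i>])

lemma poisson_integrable_cmult: "poisson_integrable u \<Longrightarrow> poisson_integrable (\<lambda>t. c * u t)"
  by (simp add: poisson_integrable_iff[of \<i>] mult.left_commute[of _ c])

lemma poisson_integrable_abs: "poisson_integrable u \<Longrightarrow> poisson_integrable (\<lambda>t. \<bar>u t\<bar>)"
  using poisson_integrable_measurable[of u] integrable_norm[of lborel "\<lambda>t. poisson_kernel \<i> t * u t"]
  by (simp add: poisson_integrable_iff[of \<i>] abs_mult poisson_kernel_nonneg)

lemma poisson_const: "Im z > 0 \<Longrightarrow> poisson (\<lambda>_. c) z = c"
  by (simp add: poisson_def integral_poisson_kernel)

lemma poisson_add: "poisson_integrable u \<Longrightarrow> poisson_integrable v \<Longrightarrow> Im z > 0 \<Longrightarrow>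
    poisson (\<lambda>t. u t + v t) z = poisson u z + poisson v z"
  by (simp add: poisson_def distrib_left poisson_integrable_iff)

lemma poisson_uminus: "poisson (\<lambda>t. - u t) z = - poisson u z"
  by (simp add: poisson_def)

lemma poisson_cmult: "poisson (\<lambda>t. c * u t) z = c * poisson u z"
  by (simp add: poisson_def mult.left_commute[of _ c])

lemma poisson_mono:
  assumes "poisson_integrable u" "poisson_integrable v" "Im z > 0" "\<And>t. u t \<le> v t"
  shows "poisson u z \<le> poisson v z"
  unfolding poisson_def using assms
  by (intro integral_mono mult_left_mono) (auto simp: poisson_integrable_iff poisson_kernel_nonneg)

text \<open>
  The kernel is symmetric in the horizontal variables, so it also has total mass 1 in \<open>x\<close>. This makes Poisson
  averaging along a horizontal line preserve integrals, which is how \<open>L_p\<close> bounds pass to the half-plane.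
\<close>

lemma nn_integral_poisson_Fubini:
  assumes [measurable]: "k \<in> borel_measurable borel" and y: "y > 0"
  shows "(\<integral>\<^sup>+x. (\<integral>\<^sup>+t. ennreal (poisson_kernel (Complex x y) t) * k t \<partial>lborel) \<partial>lborel) = (\<integral>\<^sup>+t. k t \<partial>lborel)"
proof -
  have m[measurable]: "(\<lambda>(x,t). poisson_kernel (Complex x y) t) \<in> borel_measurable (borel \<Otimes>\<^sub>M borel)"
    unfolding poisson_kernel_def by simp
  have "(\<integral>\<^sup>+x. (\<integral>\<^sup>+t. ennreal (poisson_kernel (Complex x y) t) * k t \<partial>lborel) \<partial>lborel)
     = (\<integral>\<^sup>+t. (\<integral>\<^sup>+x. ennreal (poisson_kernel (Complex x y) t) * k t \<partial>lborel) \<partial>lborel)"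
    by (rule lborel_pair.Fubini') (use m in simp)
  also have "\<dots> = (\<integral>\<^sup>+t. (\<integral>\<^sup>+x. ennreal (poisson_kernel (Complex t y) x) \<partial>lborel) * k t \<partial>lborel)"
    by (intro nn_integral_cong, subst poisson_kernel_sym, rule nn_integral_multc) measurable
  also have "\<dots> = (\<integral>\<^sup>+t. k t \<partial>lborel)" using y by (simp add: nn_integral_poisson_kernel)
  finally show ?thesis .
qed

section \<open>Radial limits of Poisson integrals\<close>

text \<open>
  This is Lebesgue's differentiation theorem in gauge form. By Henstock's lemma the deviations over any disjoint
  family of intervals fine for a suitable gauge add up to less than any prescribed bound, so intervals on which the
  deviation exceeds \<open>\<epsilon>\<close> times the radius have small total length. The bad points admit arbitrarily short such
  intervals, and Vitali's theorem selects a disjoint family covering almost all of them.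
\<close>

lemma negligible_symmetric_deviation:
  fixes f :: "real \<Rightarrow> real"
  assumes f: "f integrable_on cbox a b" and \<epsilon>: "\<epsilon> > 0"
  shows "negligible {x. \<forall>d>0. \<exists>r>0. r < d \<and> cball x r \<subseteq> cbox a b \<and>
            \<bar>2 * r * f x - integral (cball x r) f\<bar> \<ge> \<epsilon> * r}" (is "negligible ?B")
  unfolding negligible_outer_le
proof (intro allI impI)
  fix e :: real assume e: "e > 0"
  \<comment> \<open>Total deviation below \<epsilon> * e / 2 forces the sum of the radii below e / 2, hence total length below e.\<close>
  have pos: "\<epsilon> * e / 2 > 0" using \<epsilon> e by simp
  obtain \<gamma> where g: "gauge \<gamma>"
    and H: "\<And>p. \<lbrakk>p tagged_partial_division_of (cbox a b); \<gamma> fine p\<rbrakk> \<Longrightarrow>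
             sum (\<lambda>(x,k). norm(measure lborel k *\<^sub>R f x - integral k f)) p < \<epsilon> * e / 2"
    by (rule Henstock_lemma[OF f pos]) blast
  define K where "K = {(x, r). 0 < r \<and> cball x r \<subseteq> \<gamma> x \<and> cball x r \<subseteq> cbox a b \<and>
      \<bar>2 * r * f x - integral (cball x r) f\<bar> \<ge> \<epsilon> * r}"
  have 1: "\<And>i. i \<in> K \<Longrightarrow> 0 < snd i" by (auto simp: K_def)
  have 2: "\<exists>i. i \<in> K \<and> x \<in> cball (fst i) (snd i) \<and> snd i < d" if x: "x \<in> ?B" and d: "0 < d" for x d
  proof -
    have "open (\<gamma> x)" "x \<in> \<gamma> x" using g by (auto simp: gauge_def)
    \<comment> \<open>Shrinking the radius below d' makes the tagged ball fine for the gauge.\<close>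
    then obtain d' where d': "d' > 0" "cball x d' \<subseteq> \<gamma> x" using open_contains_cball by metis
    from x d d'(1) obtain r where r: "r > 0" "r < min d d'" "cball x r \<subseteq> cbox a b"
            "\<bar>2 * r * f x - integral (cball x r) f\<bar> \<ge> \<epsilon> * r" by (auto dest: spec[of _ "min d d'"])
    have "cball x r \<subseteq> \<gamma> x" using d' r by (auto simp: subset_iff)
    then show ?thesis using r by (intro exI[of _ "(x,r)"]) (auto simp: K_def)
  qed
  obtain C where C: "countable C" "C \<subseteq> K"
     "pairwise (\<lambda>i j. disjnt (cball (fst i) (snd i)) (cball (fst j) (snd j))) C"
     "negligible (?B - (\<Union>i \<in> C. cball (fst i) (snd i)))"
    by (rule Vitali_covering_theorem_cballs[of K snd ?B fst, OF 1 2]) blast+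
  have fin: "measure lebesgue (\<Union>i\<in>D. cball (fst i) (snd i)) \<le> e" if D: "D \<subseteq> C" "finite D" for D
  proof -
    let ?h = "\<lambda>i::real \<times> real. (fst i, cball (fst i) (snd i))"
    have DK: "D \<subseteq> K" using D C by auto
    have pos: "\<And>i. i \<in> D \<Longrightarrow> snd i > 0" using DK 1 by auto
    have dj: "cball (fst i) (snd i) \<inter> cball (fst j) (snd j) = {}" if "i \<in> D" "j \<in> D" "i \<noteq> j" for i j
      using C(3) D that unfolding pairwise_def disjnt_def by blast
    have inj: "inj_on ?h D"
    proof (rule inj_onI, rule ccontr)
      fix i j assume "i \<in> D" "j \<in> D" "?h i = ?h j" "i \<noteq> j"
      with dj[of i j] pos[of i] show False by auto
    qed
    have tp: "?h ` D tagged_partial_division_of cbox a b"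
      unfolding tagged_partial_division_of_def
    proof (intro conjI allI impI)
      show "finite (?h ` D)" using D by simp
      fix x k assume xk: "(x,k) \<in> ?h ` D"
      then obtain i where i: "i \<in> D" "x = fst i" "k = cball (fst i) (snd i)" by auto
      show "x \<in> k" using i pos[of i] by auto
      show "k \<subseteq> cbox a b" using subsetD[OF DK i(1)] i(3) by (simp add: K_def case_prod_unfold)
      show "\<exists>a b. k = cbox a b" using i by (metis cball_eq_atLeastAtMost box_real(2))
    next
      fix x k x' k' assume xk': "(x,k) \<in> ?h ` D \<and> (x',k') \<in> ?h ` D \<and> (x,k) \<noteq> (x',k')"
      then obtain i j where i: "i \<in> D" "x = fst i" "k = cball (fst i) (snd i)"
        and j: "j \<in> D" "x' = fst j" "k' = cball (fst j) (snd j)" by auto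
      have "i \<noteq> j" using i j xk' by auto
      then have "k \<inter> k' = {}" using dj i j by auto
      then show "interior k \<inter> interior k' = {}" using interior_subset by blast
    qed
    have "cball (fst i) (snd i) \<subseteq> \<gamma> (fst i)" if "i \<in> D" for i
      using subsetD[OF DK that] by (simp add: K_def case_prod_unfold)
    then have fine: "\<gamma> fine ?h ` D" unfolding fine_def by blast
    have "(\<Sum>i\<in>D. \<epsilon> * snd i) \<le> (\<Sum>i\<in>D. norm (measure lborel (cball (fst i) (snd i)) *\<^sub>R f (fst i) - integral (cball (fst i) (snd i)) f))"
    proof (rule sum_mono)
      fix i assume i: "i \<in> D"
      have "measure lborel (cball (fst i) (snd i)) = 2 * snd i" using pos[OF i] by (simp add: cball_eq_atLeastAtMost)
      then show "\<epsilon> * snd i \<le> norm (measure lborel (cball (fst i) (snd i)) *\<^sub>R f (fst i) - integral (cball (fst i) (snd i)) f)"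
        using i DK by (auto simp: K_def)
    qed
    also have "\<dots> = sum (\<lambda>(x,k). norm(measure lborel k *\<^sub>R f x - integral k f)) (?h ` D)"
      using inj by (simp add: sum.reindex o_def)
    also have "\<dots> < \<epsilon> * e / 2" by (rule H[OF tp fine])
    finally have "(\<Sum>i\<in>D. \<epsilon> * snd i) < \<epsilon> * e / 2" .
    then have "\<epsilon> * (2 * (\<Sum>i\<in>D. snd i)) < \<epsilon> * e" by (simp add: sum_distrib_left[symmetric])
    then have s: "2 * (\<Sum>i\<in>D. snd i) < e" using \<epsilon> by (simp add: mult_less_cancel_left)
    have "measure lebesgue (\<Union>i\<in>D. cball (fst i) (snd i)) \<le> (\<Sum>i\<in>D. measure lebesgue (cball (fst i) (snd i)))"
      using D by (intro measure_UNION_le) auto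
    also have "\<dots> = (\<Sum>i\<in>D. 2 * snd i)" using pos by (intro sum.cong) (auto simp: cball_eq_atLeastAtMost less_imp_le)
    also have "\<dots> \<le> e" using s by (simp add: sum_distrib_left)
    finally show ?thesis .
  qed
  let ?U = "\<Union>i\<in>C. cball (fst i) (snd i)"
  have U: "?U \<in> lmeasurable" "measure lebesgue ?U \<le> e"
    using fmeasurable_UN_bound[of C "\<lambda>i. cball (fst i) (snd i)" lebesgue e]
          measure_UN_bound[of C "\<lambda>i. cball (fst i) (snd i)" lebesgue e] C(1) fin by auto
  show "\<exists>T. ?B \<subseteq> T \<and> T \<in> lmeasurable \<and> measure lebesgue T \<le> e"
  proof (intro exI conjI)
    show "?B \<subseteq> ?U \<union> (?B - ?U)" by auto
    show "?U \<union> (?B - ?U) \<in> lmeasurable" using fmeasurable.Un[OF U(1) negligible_imp_measurable[OF C(4)]] .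
    show "measure lebesgue (?U \<union> (?B - ?U)) \<le> e"
      using measure_Un_le[of ?U lebesgue "?B - ?U"] fmeasurableD[OF U(1)] U(2)
        negligible_imp_measure0[OF C(4)] fmeasurableD[OF negligible_imp_measurable[OF C(4)]] by linarith
  qed
qed

lemma AE_symmetric_derivative:
  fixes u :: "real \<Rightarrow> real"
  assumes u: "poisson_integrable u"
  shows "AE x in lborel. ((\<lambda>r. (\<integral>t. indicator {x-r..x+r} t * (u t - u x) \<partial>lborel) / r) \<longlongrightarrow> 0) (at_right 0)"
proof -
  note [measurable] = poisson_integrable_measurable[OF u]
  \<comment> \<open>The index n localises to a bounded interval, where u is integrable; m gives the precision.\<close>
  define B where "B n m = {x. \<forall>d>0. \<exists>r>0. r < d \<and> cball x r \<subseteq> cbox (- real n) (real n) \<and>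
            \<bar>2 * r * u x - integral (cball x r) u\<bar> \<ge> (1 / real (Suc m)) * r}" for n m
  have si: "set_integrable lborel {a..b} u" for a b
  proof -
    have i: "integrable lborel (\<lambda>t. (1 + (max \<bar>a\<bar> \<bar>b\<bar>)\<^sup>2) * (u t / (1 + t\<^sup>2)))"
      using u unfolding poisson_integrable_def by (rule integrable_mult_right)
    show ?thesis unfolding set_integrable_def
    proof (rule Bochner_Integration.integrable_bound[OF i])
      show "AE t in lborel. norm (indicat_real {a..b} t *\<^sub>R u t) \<le> norm ((1 + (max \<bar>a\<bar> \<bar>b\<bar>)\<^sup>2) * (u t / (1 + t\<^sup>2)))"
      proof (rule AE_I2)
        fix t
        show "norm (indicat_real {a..b} t *\<^sub>R u t) \<le> norm ((1 + (max \<bar>a\<bar> \<bar>b\<bar>)\<^sup>2) * (u t / (1 + t\<^sup>2)))"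
        proof (cases "t \<in> {a..b}")
          case True
          then have "t\<^sup>2 \<le> (max \<bar>a\<bar> \<bar>b\<bar>)\<^sup>2" by (intro power2_le_iff_abs_le[THEN iffD2]) auto
          then have "1 \<le> (1 + (max \<bar>a\<bar> \<bar>b\<bar>)\<^sup>2) / (1 + t\<^sup>2)" using one_plus_square_pos[of t] by simp
          then have "1 * \<bar>u t\<bar> \<le> (1 + (max \<bar>a\<bar> \<bar>b\<bar>)\<^sup>2) / (1 + t\<^sup>2) * \<bar>u t\<bar>" by (rule mult_right_mono) simp
          then show ?thesis using True one_plus_square_pos[of t] one_plus_square_pos[of "max \<bar>a\<bar> \<bar>b\<bar>"] by (simp add: abs_mult)
        qed auto
      qed
    qed measurable
  qed
  have "negligible (B n m)" for n m
    unfolding B_def using set_borel_integral_eq_integral(1)[OF si[of "- real n" "real n"]]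
    by (intro negligible_symmetric_deviation) auto
  then have "AE x in lborel. x \<notin> B n m" for n m
    by (subst AE_completion_iff[symmetric]) (auto simp: eventually_ae_filter_negligible)
  then have "AE x in lborel. \<forall>n m. x \<notin> B n m" by (simp add: AE_all_countable)
  moreover have "((\<lambda>r. (\<integral>t. indicator {x-r..x+r} t * (u t - u x) \<partial>lborel) / r) \<longlongrightarrow> 0) (at_right 0)"
    if x: "\<forall>n m. x \<notin> B n m" for x
  proof (rule tendstoI)
    fix e :: real assume e: "e > 0"
    obtain n :: nat where n: "\<bar>x\<bar> + 1 < real n" using reals_Archimedean2 by blast
    obtain m where m: "1 / real (Suc m) < e" using e by (metis reals_Archimedean inverse_eq_divide)
    have "x \<notin> B n m" using x by auto
    then obtain d where d: "d > 0" "\<And>r. r > 0 \<Longrightarrow> r < d \<Longrightarrow> cball x r \<subseteq> cbox (- real n) (real n) \<Longrightarrow>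
            \<bar>2 * r * u x - integral (cball x r) u\<bar> < (1 / real (Suc m)) * r"
      unfolding B_def by (auto simp: not_le)
    have "dist ((\<integral>t. indicator {x-r..x+r} t * (u t - u x) \<partial>lborel) / r) 0 < e" if r: "r > 0" "r < min d 1" for r
    proof -
      have eq: "cball x r = {x-r..x+r}" by (simp add: cball_eq_atLeastAtMost)
      have "cball x r \<subseteq> cbox (- real n) (real n)" using n r by (auto simp: eq)
      from d(2)[OF r(1) _ this] r(2) have *: "\<bar>2 * r * u x - integral {x-r..x+r} u\<bar> < (1 / real (Suc m)) * r"
        by (simp add: eq)
      have "(\<integral>t. indicator {x-r..x+r} t * (u t - u x) \<partial>lborel) = integral {x-r..x+r} u - 2 * r * u x"
        using si[of "x-r" "x+r"] set_borel_integral_eq_integral(2)[OF si[of "x-r" "x+r"]] r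
        by (simp add: right_diff_distrib set_integrable_def set_lebesgue_integral_def)
      then have "\<bar>\<integral>t. indicator {x-r..x+r} t * (u t - u x) \<partial>lborel\<bar> < (1 / real (Suc m)) * r" using * by simp
      also have "\<dots> < e * r" using m r by (intro mult_strict_right_mono) auto
      finally show ?thesis using r by (simp add: field_simps abs_divide)
    qed
    then show "\<forall>\<^sub>F r in at_right 0. dist ((\<integral>t. indicator {x-r..x+r} t * (u t - u x) \<partial>lborel) / r) 0 < e"
      using d(1) by (intro eventually_at_rightI[of 0 "min d 1"]) auto
  qed
  ultimately show ?thesis by (rule eventually_mono)
qed


text \<open>
  Up to its value at distance \<open>d\<close>, the kernel centred at the origin is the integral over \<open>r\<close> of its negative
  derivative, that is, a superposition of indicators of symmetric intervals. The next lemma integrates this against a function, so that the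
  Poisson integral is controlled by the symmetric integrals alone.
\<close>

lemma poisson_kernel_layer_cake:
  assumes y: "y > 0" and d: "\<bar>s\<bar> \<le> d"
  shows "has_bochner_integral lborel (\<lambda>r. 2 * y * r / (pi * (r\<^sup>2 + y\<^sup>2)\<^sup>2) * indicator {\<bar>s\<bar>..d} r)
            (y / (pi * (s\<^sup>2 + y\<^sup>2)) - y / (pi * (d\<^sup>2 + y\<^sup>2)))"
proof -
  have pos: "r\<^sup>2 + y\<^sup>2 > 0" for r using y by (simp add: add_nonneg_pos)
  have ne: "r\<^sup>2 + y\<^sup>2 \<noteq> 0" for r using y by simp
  have der: "DERIV (\<lambda>r. - (y / (pi * (r\<^sup>2 + y\<^sup>2)))) r :> 2 * y * r / (pi * (r\<^sup>2 + y\<^sup>2)\<^sup>2)" for r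
    using ne[of r] by (auto intro!: derivative_eq_intros simp: divide_simps power2_eq_square)
  have "has_bochner_integral lborel (\<lambda>r. 2 * y * r / (pi * (r\<^sup>2 + y\<^sup>2)\<^sup>2) * indicator {\<bar>s\<bar>..d} r)
            (- (y / (pi * (d\<^sup>2 + y\<^sup>2))) - - (y / (pi * (\<bar>s\<bar>\<^sup>2 + y\<^sup>2))))"
    by (rule has_bochner_integral_FTC_Icc_real[where F = "\<lambda>r. - (y / (pi * (r\<^sup>2 + y\<^sup>2)))"])
       (use d der ne in \<open>auto intro!: continuous_intros\<close>)
  then show ?thesis by simp
qed

lemma poisson_truncated_layer_cake:
  fixes w :: "real \<Rightarrow> real"
  assumes y: "y > 0" and d: "d > 0" and w[measurable]: "w \<in> borel_measurable borel"
    and wi: "integrable lborel (\<lambda>t. indicator {x-d..x+d} t * w t)"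
  defines "W \<equiv> \<lambda>r. \<integral>t. indicator {x-r..x+r} t * w t \<partial>lborel"
    and "m \<equiv> \<lambda>r. 2 * y * r / (pi * (r\<^sup>2 + y\<^sup>2)\<^sup>2)"
  shows "integrable lborel (\<lambda>r. indicator {0..d} r * m r * W r)"
    and "(\<integral>t. indicator {x-d..x+d} t * (poisson_kernel (Complex x y) t * w t) \<partial>lborel)
      = y / (pi * (d\<^sup>2 + y\<^sup>2)) * W d + (\<integral>r. indicator {0..d} r * m r * W r \<partial>lborel)"
proof -
  let ?k = "\<lambda>t r. (m r * indicator {\<bar>t - x\<bar>..d} r) * (indicator {x-d..x+d} t * w t)"
  have mpos: "m r \<ge> 0" if "r \<ge> 0" for r unfolding m_def using y that by simp
  have lc: "has_bochner_integral lborel (\<lambda>r. m r * indicator {\<bar>t - x\<bar>..d} r)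
            (poisson_kernel (Complex x y) t - y / (pi * (d\<^sup>2 + y\<^sup>2)))" if "t \<in> {x-d..x+d}" for t
    using poisson_kernel_layer_cake[OF y, of "t - x" d] that unfolding m_def poisson_kernel_def by (simp add: abs_le_iff)
  have inner: "(\<integral>r. ?k t r \<partial>lborel) = (poisson_kernel (Complex x y) t - y / (pi * (d\<^sup>2 + y\<^sup>2))) * (indicator {x-d..x+d} t * w t)" for t
    using lc[of t] by (cases "t \<in> {x-d..x+d}") (auto simp: has_bochner_integral_iff)
  have innerabs: "(\<integral>r. norm (?k t r) \<partial>lborel) = (poisson_kernel (Complex x y) t - y / (pi * (d\<^sup>2 + y\<^sup>2))) * (indicator {x-d..x+d} t * \<bar>w t\<bar>)" for t
  proof (cases "t \<in> {x-d..x+d}")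
    case True
    have "(\<integral>r. norm (?k t r) \<partial>lborel) = (\<integral>r. (m r * indicator {\<bar>t - x\<bar>..d} r) * \<bar>w t\<bar> \<partial>lborel)"
      using True mpos by (intro Bochner_Integration.integral_cong) (auto simp: abs_mult indicator_def)
    also have "\<dots> = (poisson_kernel (Complex x y) t - y / (pi * (d\<^sup>2 + y\<^sup>2))) * \<bar>w t\<bar>"
      using lc[OF True] by (auto simp: has_bochner_integral_iff)
    finally show ?thesis using True by simp
  qed auto
  have pkw: "integrable lborel (\<lambda>t. poisson_kernel (Complex x y) t * (indicator {x-d..x+d} t * \<bar>w t\<bar>))"
  proof (rule Bochner_Integration.integrable_bound[OF integrable_mult_right[OF wi, of "1 / (pi * y)"]])
    show "AE t in lborel. norm (poisson_kernel (Complex x y) t * (indicator {x-d..x+d} t * \<bar>w t\<bar>))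
          \<le> norm (1 / (pi * y) * (indicator {x-d..x+d} t * w t))"
    proof (rule AE_I2)
      fix t
      show "norm (poisson_kernel (Complex x y) t * (indicator {x-d..x+d} t * \<bar>w t\<bar>))
          \<le> norm (1 / (pi * y) * (indicator {x-d..x+d} t * w t))"
        using mult_right_mono[OF poisson_kernel_le[of "Complex x y" t], of "\<bar>w t\<bar>"]
          poisson_kernel_nonneg[of "Complex x y" t] y by (simp add: abs_mult split: split_indicator)
    qed
  qed measurable
  have pkw': "integrable lborel (\<lambda>t. poisson_kernel (Complex x y) t * (indicator {x-d..x+d} t * w t))"
    by (rule Bochner_Integration.integrable_bound[OF pkw]) (auto simp: abs_mult)
  have wa: "integrable lborel (\<lambda>t. indicator {x-d..x+d} t * \<bar>w t\<bar>)"
    using integrable_norm[OF wi] by (simp add: abs_mult)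
  have [measurable]: "m \<in> borel_measurable borel" unfolding m_def by measurable
  have meas: "(\<lambda>(t,r). ?k t r) \<in> borel_measurable (lborel \<Otimes>\<^sub>M lborel)"
    by (simp add: indicator_def case_prod_unfold Collect_conj_eq)
  have int: "integrable (lborel \<Otimes>\<^sub>M lborel) (\<lambda>(t,r). ?k t r)"
  proof (rule lborel_pair.Fubini_integrable[OF meas])
    show "integrable lborel (\<lambda>t. \<integral>r. norm (case (t, r) of (t, r) \<Rightarrow> ?k t r) \<partial>lborel)"
      unfolding prod.case innerabs left_diff_distrib using pkw wa by simp
    show "AE t in lborel. integrable lborel (\<lambda>r. case (t, r) of (t, r) \<Rightarrow> ?k t r)"
      unfolding prod.case
    proof (rule AE_I2)
      fix t show "integrable lborel (?k t)"
        using lc[of t] by (cases "t \<in> {x-d..x+d}") (auto simp: has_bochner_integral_iff)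
    qed
  qed
  have swap: "(\<integral>t. ?k t r \<partial>lborel) = indicator {0..d} r * m r * W r" for r
  proof (cases "r \<in> {0..d}")
    case True
    have "(\<integral>t. ?k t r \<partial>lborel) = (\<integral>t. m r * (indicator {x-r..x+r} t * w t) \<partial>lborel)"
      using True by (intro Bochner_Integration.integral_cong) (auto simp: indicator_def abs_le_iff)
    then show ?thesis using True by (simp add: W_def)
  next
    case False
    then have "?k t r = 0" for t by (auto simp: indicator_def)
    then show ?thesis using False by simp
  qed
  show "integrable lborel (\<lambda>r. indicator {0..d} r * m r * W r)"
    using lborel_pair.integrable_snd[OF int] by (simp add: swap)
  have "(\<integral>r. indicator {0..d} r * m r * W r \<partial>lborel) = (\<integral>t. (\<integral>r. ?k t r \<partial>lborel) \<partial>lborel)"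
    using lborel_pair.Fubini_integral[OF int] by (simp add: swap)
  also have "\<dots> = (\<integral>t. indicator {x-d..x+d} t * (poisson_kernel (Complex x y) t * w t) \<partial>lborel) - y / (pi * (d\<^sup>2 + y\<^sup>2)) * W d"
    unfolding inner left_diff_distrib W_def using pkw' wi
    by (simp add: mult.left_commute)
  finally show "(\<integral>t. indicator {x-d..x+d} t * (poisson_kernel (Complex x y) t * w t) \<partial>lborel)
      = y / (pi * (d\<^sup>2 + y\<^sup>2)) * W d + (\<integral>r. indicator {0..d} r * m r * W r \<partial>lborel)" by simp
qed

text \<open>
  Near \<open>x\<close> the layer-cake formula replaces the integral by an average of symmetric integrals, which are at most
  \<open>e * r\<close>; the same formula for the constant function 1 shows that these averages have total weight at most 1.
  Away from \<open>x\<close> the kernel at height \<open>y\<close> is at most \<open>2 * y / d\<close> times the kernel at the fixed height \<open>d\<close>.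
\<close>

lemma poisson_tendsto_zero_at_symmetric_point:
  assumes v: "poisson_integrable v"
    and V: "((\<lambda>r. (\<integral>t. indicator {x-r..x+r} t * v t \<partial>lborel) / r) \<longlongrightarrow> 0) (at_right 0)"
  shows "((\<lambda>y. poisson v (Complex x y)) \<longlongrightarrow> 0) (at_right 0)"
proof (rule tendstoI)
  note [measurable] = poisson_integrable_measurable[OF v]
  fix e :: real assume e: "e > 0"
  define I where "I r = (\<integral>t. indicator {x-r..x+r} t * v t \<partial>lborel)" for r
  from tendstoD[OF V e] obtain b where b: "b > 0" "\<And>r. 0 < r \<Longrightarrow> r < b \<Longrightarrow> \<bar>I r / r\<bar> < e"
    unfolding eventually_at_right_field I_def by auto
  define d where "d = b / 2"
  have d: "d > 0" using b by (simp add: d_def)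
  have I: "\<bar>I r\<bar> \<le> e * r" if "0 \<le> r" "r \<le> d" for r
  proof (cases "r = 0")
    case True
    have "I r = (\<integral>t. indicator {x} t *\<^sub>R v x \<partial>lborel)" unfolding I_def True
      by (intro Bochner_Integration.integral_cong) (auto simp: indicator_def)
    also have "\<dots> = 0" by (subst integral_scaleR_left) auto
    finally show ?thesis using True by simp
  next
    case False
    then show ?thesis using b(2)[of r] that b(1) by (simp add: d_def abs_divide field_simps)
  qed
  define T where "T = (\<integral>t. poisson_kernel (Complex x d) t * \<bar>v t\<bar> \<partial>lborel)"
  have vi: "integrable lborel (\<lambda>t. poisson_kernel (Complex x y) t * v t)" if "y > 0" for y
    using v poisson_integrable_iff[of "Complex x y"] that by simp
  have via: "integrable lborel (\<lambda>t. poisson_kernel (Complex x y) t * \<bar>v t\<bar>)" if "y > 0" for y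
    using poisson_integrable_abs[OF v] poisson_integrable_iff[of "Complex x y"] that by simp
  have loc: "integrable lborel (\<lambda>t. indicator {x-d..x+d} t * v t)"
  proof (rule Bochner_Integration.integrable_bound[OF integrable_mult_right[OF vi[OF d], of "2 * pi * d"]])
    show "AE t in lborel. norm (indicator {x-d..x+d} t * v t) \<le> norm (2 * pi * d * (poisson_kernel (Complex x d) t * v t))"
    proof (rule AE_I2)
      fix t
      show "norm (indicator {x-d..x+d} t * v t) \<le> norm (2 * pi * d * (poisson_kernel (Complex x d) t * v t))"
      proof (cases "t \<in> {x-d..x+d}")
        case True
        then have "\<bar>t - x\<bar> \<le> \<bar>d\<bar>" using d by (simp add: abs_le_iff)
        then have "(t - x)\<^sup>2 \<le> d\<^sup>2" by (simp add: abs_le_square_iff)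
        moreover have "(t - x)\<^sup>2 + d\<^sup>2 > 0" using d by (simp add: add_nonneg_pos)
        ultimately have "1 \<le> 2 * d\<^sup>2 / ((t - x)\<^sup>2 + d\<^sup>2)" by simp
        also have "\<dots> = 2 * pi * d * poisson_kernel (Complex x d) t"
          unfolding poisson_kernel_def by (simp add: power2_eq_square)
        finally have "1 \<le> 2 * pi * d * poisson_kernel (Complex x d) t" .
        then have "1 * \<bar>v t\<bar> \<le> 2 * pi * d * poisson_kernel (Complex x d) t * \<bar>v t\<bar>" by (rule mult_right_mono) simp
        then show ?thesis using True d poisson_kernel_nonneg[of "Complex x d" t] by (simp add: abs_mult)
      qed auto
    qed
  qed measurable
  have bound: "\<bar>poisson v (Complex x y)\<bar> \<le> e / 2 + 2 * y / d * T" if y: "y > 0" for y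
  proof -
    let ?P = "poisson_kernel (Complex x y)" and ?J = "indicator {x-d..x+d} :: real \<Rightarrow> real"
    let ?m = "\<lambda>r. 2 * y * r / (pi * (r\<^sup>2 + y\<^sup>2)\<^sup>2)" and ?q = "y / (pi * (d\<^sup>2 + y\<^sup>2))"
    have q: "?q \<ge> 0" using y by simp
    have m: "?m r \<ge> 0" if "r \<ge> 0" for r using y that by simp
    have i1: "integrable lborel (\<lambda>t. ?J t * (?P t * v t))" using integrable_mult_indicator[OF _ vi[OF y], of "{x-d..x+d}"] by simp
    have i2: "integrable lborel (\<lambda>t. (1 - ?J t) * (?P t * v t))" using vi[OF y] i1 by (simp add: left_diff_distrib)
    have "poisson v (Complex x y) = (\<integral>t. ?J t * (?P t * v t) + (1 - ?J t) * (?P t * v t) \<partial>lborel)"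
      unfolding poisson_def by (simp add: algebra_simps)
    also have "\<dots> = (\<integral>t. ?J t * (?P t * v t) \<partial>lborel) + (\<integral>t. (1 - ?J t) * (?P t * v t) \<partial>lborel)"
      by (rule Bochner_Integration.integral_add[OF i1 i2])
    finally have split: "poisson v (Complex x y) = (\<integral>t. ?J t * (?P t * v t) \<partial>lborel) + (\<integral>t. (1 - ?J t) * (?P t * v t) \<partial>lborel)" .
    have one: "integrable lborel (\<lambda>t. ?J t * (1::real))"
      using integrable_real_indicator[of "{x-d..x+d}" lborel] d by (simp add: emeasure_lborel_Icc_eq)
    have I1: "(\<integral>t. indicator {x-r..x+r} t * (1::real) \<partial>lborel) = 2 * r" if "r \<ge> 0" for r using that by simp
    note Lv = poisson_truncated_layer_cake[OF y d poisson_integrable_measurable[OF v] loc]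
    have main: "\<bar>\<integral>t. ?J t * (?P t * v t) \<partial>lborel\<bar> \<le> e / 2"
    proof -
      have m1: "(\<lambda>_. 1::real) \<in> borel_measurable borel" by simp
      have pe: "indicator {0..d} r * ?m r * (\<integral>t. indicator {x-r..x+r} t * (1::real) \<partial>lborel)
          = indicator {0..d} r * ?m r * (2 * r)" for r
        using I1[of r] by (cases "r \<in> {0..d}") auto
      have e1: "integrable lborel (\<lambda>r. indicator {0..d} r * ?m r * (2 * r))"
        using poisson_truncated_layer_cake(1)[OF y d m1 one] unfolding pe .
      have "(\<integral>t. ?J t * (?P t * 1) \<partial>lborel) = ?q * (2 * d) + (\<integral>r. indicator {0..d} r * ?m r * (2 * r) \<partial>lborel)"
        using poisson_truncated_layer_cake(2)[OF y d m1 one] I1[of d] d unfolding pe by simp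
      moreover have "(\<integral>t. ?J t * (?P t * 1) \<partial>lborel) \<le> (\<integral>t. ?P t \<partial>lborel)"
        using y integrable_poisson_kernel[of "Complex x y"] integrable_mult_indicator[of "{x-d..x+d}" lborel ?P]
        by (intro integral_mono) (auto simp: indicator_def poisson_kernel_nonneg)
      ultimately have le1: "?q * (2 * d) + (\<integral>r. indicator {0..d} r * ?m r * (2 * r) \<partial>lborel) \<le> 1"
        using y integral_poisson_kernel[of "Complex x y"] by simp
      have eq: "(\<integral>t. ?J t * (?P t * v t) \<partial>lborel) = ?q * I d + (\<integral>r. indicator {0..d} r * ?m r * I r \<partial>lborel)"
        using Lv(2) unfolding I_def .
      have "\<bar>\<integral>t. ?J t * (?P t * v t) \<partial>lborel\<bar> \<le> \<bar>?q * I d\<bar> + \<bar>\<integral>r. indicator {0..d} r * ?m r * I r \<partial>lborel\<bar>"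
        unfolding eq by (rule abs_triangle_ineq)
      also have "\<bar>?q * I d\<bar> = ?q * \<bar>I d\<bar>" using q by (simp only: abs_mult abs_of_nonneg)
      also have "\<bar>\<integral>r. indicator {0..d} r * ?m r * I r \<partial>lborel\<bar> \<le> (\<integral>r. \<bar>indicator {0..d} r * ?m r * I r\<bar> \<partial>lborel)"
        by (rule integral_abs_bound)
      also have "\<dots> \<le> (\<integral>r. e / 2 * (indicator {0..d} r * ?m r * (2 * r)) \<partial>lborel)"
      proof (rule integral_mono)
        show "integrable lborel (\<lambda>r. \<bar>indicator {0..d} r * ?m r * I r\<bar>)"
          using integrable_abs[OF Lv(1)] unfolding I_def by simp
        show "integrable lborel (\<lambda>r. e / 2 * (indicator {0..d} r * ?m r * (2 * r)))" using e1 by (rule integrable_mult_right)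
        fix r
        show "\<bar>indicator {0..d} r * ?m r * I r\<bar> \<le> e / 2 * (indicator {0..d} r * ?m r * (2 * r))"
        proof (cases "r \<in> {0..d}")
          case True
          then have mr: "?m r \<ge> 0" using m by auto
          have "\<bar>?m r * I r\<bar> = ?m r * \<bar>I r\<bar>" unfolding abs_mult[of "?m r" "I r"] abs_of_nonneg[OF mr] ..
          also have "\<dots> \<le> ?m r * (e * r)" using True m[of r] I[of r] by (intro mult_left_mono) auto
          finally show ?thesis using True by (simp add: mult_ac)
        qed auto
      qed
      also have "\<dots> = e / 2 * (\<integral>r. indicator {0..d} r * ?m r * (2 * r) \<partial>lborel)" by (rule integral_mult_right_zero)
      also have "?q * \<bar>I d\<bar> \<le> ?q * (e * d)" using I[of d] d q by (intro mult_left_mono) auto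
      finally have "\<bar>\<integral>t. ?J t * (?P t * v t) \<partial>lborel\<bar> \<le> e / 2 * (?q * (2 * d) + (\<integral>r. indicator {0..d} r * ?m r * (2 * r) \<partial>lborel))"
        by (simp add: distrib_left mult_ac)
      also have "\<dots> \<le> e / 2 * 1" using le1 e by (intro mult_left_mono) auto
      finally show ?thesis by simp
    qed
    have tail: "\<bar>\<integral>t. (1 - ?J t) * (?P t * v t) \<partial>lborel\<bar> \<le> 2 * y / d * T"
    proof -
      have "\<bar>\<integral>t. (1 - ?J t) * (?P t * v t) \<partial>lborel\<bar> \<le> (\<integral>t. \<bar>(1 - ?J t) * (?P t * v t)\<bar> \<partial>lborel)" by (rule integral_abs_bound)
      also have "\<dots> \<le> (\<integral>t. 2 * y / d * (poisson_kernel (Complex x d) t * \<bar>v t\<bar>) \<partial>lborel)"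
      proof (rule integral_mono)
        show "integrable lborel (\<lambda>t. \<bar>(1 - ?J t) * (?P t * v t)\<bar>)" using i2 by (rule integrable_abs)
        show "integrable lborel (\<lambda>t. 2 * y / d * (poisson_kernel (Complex x d) t * \<bar>v t\<bar>))"
          using via[OF d] by (rule integrable_mult_right)
        fix t
        show "\<bar>(1 - ?J t) * (?P t * v t)\<bar> \<le> 2 * y / d * (poisson_kernel (Complex x d) t * \<bar>v t\<bar>)"
        proof (cases "t \<in> {x-d..x+d}")
          case True
          then show ?thesis using y d poisson_kernel_nonneg[of "Complex x d" t] by simp
        next
          case False
          then have "\<bar>d\<bar> \<le> \<bar>t - x\<bar>" using d by auto
          then have sq: "d\<^sup>2 \<le> (t - x)\<^sup>2" by (simp add: abs_le_square_iff)
          have dp: "d\<^sup>2 > 0" using d by simp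
          have "?P t \<le> y / (pi * (t - x)\<^sup>2)"
            unfolding poisson_kernel_def complex.sel using y dp sq by (intro divide_left_mono mult_left_mono) (auto intro!: mult_pos_pos add_pos_nonneg)
          also have "\<dots> = y * (2 / (pi * (2 * (t - x)\<^sup>2)))" by simp
          also have "\<dots> \<le> y * (2 / (pi * ((t - x)\<^sup>2 + d\<^sup>2)))"
            using y dp sq by (intro mult_left_mono divide_left_mono mult_pos_pos add_nonneg_pos) auto
          also have "\<dots> = 2 * y / d * poisson_kernel (Complex x d) t"
            unfolding poisson_kernel_def using d by simp
          finally have "?P t * \<bar>v t\<bar> \<le> 2 * y / d * poisson_kernel (Complex x d) t * \<bar>v t\<bar>" by (rule mult_right_mono) simp
          then show ?thesis using False y poisson_kernel_nonneg[of "Complex x y" t] by (simp add: abs_mult)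
        qed
      qed
      also have "\<dots> = 2 * y / d * T" unfolding T_def by (rule integral_mult_right_zero)
      finally show ?thesis .
    qed
    show ?thesis unfolding split using main tail by linarith
  qed
  have "((\<lambda>y. e / 2 + 2 * y / d * T) \<longlongrightarrow> e / 2 + 2 * 0 / d * T) (at_right 0)"
    using d by (intro tendsto_intros) auto
  from order_tendstoD(2)[OF this, of e] have "\<forall>\<^sub>F y in at_right 0. e / 2 + 2 * y / d * T < e"
    using e by simp
  moreover have "\<forall>\<^sub>F y in at_right (0::real). y > 0" by (simp add: eventually_at_right_less)
  ultimately show "\<forall>\<^sub>F y in at_right 0. dist (poisson v (Complex x y)) 0 < e"
  proof eventually_elim
    case (elim y)
    then show ?case using bound[of y] by simp
  qed
qed

text \<open>
  Fatou's theorem for Poisson integrals. At almost every \<open>x\<close> the symmetric derivative of the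
  indefinite integral of \<open>u\<close> is \<open>u x\<close>, and subtracting this constant reduces to a vanishing derivative.
\<close>

theorem poisson_radial_limit:
  assumes u: "poisson_integrable u"
  shows "AE x in lborel. ((\<lambda>y. poisson u (Complex x y)) \<longlongrightarrow> u x) (at_right 0)"
  using AE_symmetric_derivative[OF u]
proof eventually_elim
  case (elim x)
  have v: "poisson_integrable (\<lambda>t. u t - u x)" using u poisson_integrable_const poisson_integrable_diff by blast
  have "((\<lambda>y. poisson (\<lambda>t. u t - u x) (Complex x y) + u x) \<longlongrightarrow> 0 + u x) (at_right 0)"
    by (intro tendsto_add poisson_tendsto_zero_at_symmetric_point v elim tendsto_const)
  moreover have "\<forall>\<^sub>F y in at_right (0::real). poisson (\<lambda>t. u t - u x) (Complex x y) + u x = poisson u (Complex x y)"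
    using eventually_at_right_less
  proof eventually_elim
    case (elim y)
    then show ?case using poisson_add[OF u poisson_integrable_const[of "- u x"], of "Complex x y"]
      by (simp add: poisson_const)
  qed
  ultimately show ?case by (simp add: tendsto_cong)
qed

section \<open>Outer functions\<close>

definition schwarz_integral :: "(real \<Rightarrow> real) \<Rightarrow> complex \<Rightarrow> complex" where
  "schwarz_integral u z = 1 / (complex_of_real pi * \<i>) *
     (\<integral>t. (1 + complex_of_real t * z) / (complex_of_real t - z) * complex_of_real (u t / (1 + t\<^sup>2)) \<partial>lborel)"

text \<open>
  The function in \<open>outer_formula\<close> with the unimodular constant left out.
\<close>

definition outer :: "(real \<Rightarrow> real) \<Rightarrow> complex \<Rightarrow> complex" where
  "outer u z = exp (schwarz_integral u z)"

lemma cmod_of_real_minus_squared: "(cmod (complex_of_real t - z))\<^sup>2 = (t - Re z)\<^sup>2 + (Im z)\<^sup>2"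
  by (simp add: cmod_power2)

lemma of_real_minus_nonzero: "Im z > 0 \<Longrightarrow> complex_of_real t - z \<noteq> 0"
  by (auto simp: complex_eq_iff)

lemma inverse_dist_upper:
  assumes "Im z > 0"
  obtains c where "c > 0" "\<And>t. (1 + t\<^sup>2) / (cmod (complex_of_real t - z))\<^sup>2 \<le> c"
proof -
  obtain c where c: "c > 0" "\<And>t. poisson_kernel z t \<le> c / (1 + t\<^sup>2)" using poisson_kernel_upper[OF assms] by metis
  show ?thesis
  proof (rule that[of "c * pi / Im z"])
    show "c * pi / Im z > 0" using c assms by simp
    fix t
    have "(1 + t\<^sup>2) * poisson_kernel z t \<le> c"
      using c(2)[of t] one_plus_square_pos[of t] by (simp add: field_simps)
    then have "(1 + t\<^sup>2) * poisson_kernel z t * (pi / Im z) \<le> c * (pi / Im z)"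
      by (rule mult_right_mono) (use assms in simp)
    moreover have "(1 + t\<^sup>2) * poisson_kernel z t * (pi / Im z) = (1 + t\<^sup>2) / (cmod (complex_of_real t - z))\<^sup>2"
      unfolding cmod_of_real_minus_squared poisson_kernel_def using assms by simp
    ultimately show "(1 + t\<^sup>2) / (cmod (complex_of_real t - z))\<^sup>2 \<le> c * pi / Im z" by simp
  qed
qed

text \<open>
  The kernel equals \<open>z + (1 + z\<^sup>2) / (t - z)\<close>, and the distance from \<open>z\<close> to the line is positive.
\<close>

lemma schwarz_kernel_bound:
  assumes "Im z > 0"
  obtains c where "c > 0" "\<And>t. cmod ((1 + complex_of_real t * z) / (complex_of_real t - z)) \<le> c"
proof -
  obtain c where c: "c > 0" "\<And>t. (1 + t\<^sup>2) / (cmod (complex_of_real t - z))\<^sup>2 \<le> c"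
    using inverse_dist_upper[OF assms] by metis
  show ?thesis
  proof (rule that[of "cmod z + (1 + (cmod z)\<^sup>2) * (1 + c)"])
    show "cmod z + (1 + (cmod z)\<^sup>2) * (1 + c) > 0" using c by (intro add_nonneg_pos mult_pos_pos add_pos_nonneg) auto
    fix t
    let ?d = "complex_of_real t - z"
    have nz: "?d \<noteq> 0" using of_real_minus_nonzero[OF assms] .
    have "(1 + complex_of_real t * z) / ?d = z + (1 + z\<^sup>2) / ?d"
      using nz by (simp add: field_simps power2_eq_square)
    then have "cmod ((1 + complex_of_real t * z) / ?d) \<le> cmod z + cmod (1 + z\<^sup>2) / cmod ?d"
      by (metis norm_divide norm_triangle_ineq)
    also have "cmod (1 + z\<^sup>2) \<le> 1 + (cmod z)\<^sup>2" by (metis norm_one norm_power norm_triangle_ineq)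
    also have "(1 + (cmod z)\<^sup>2) / cmod ?d \<le> (1 + (cmod z)\<^sup>2) * (1 + c)"
    proof -
      have "(1 / cmod ?d)\<^sup>2 \<le> c"
      proof -
        have "(1 / cmod ?d)\<^sup>2 \<le> (1 + t\<^sup>2) / (cmod ?d)\<^sup>2" by (simp add: power_divide divide_right_mono)
        then show ?thesis using c(2)[of t] by linarith
      qed
      moreover have "1 / cmod ?d \<le> 1 + (1 / cmod ?d)\<^sup>2"
        using zero_le_power2[of "1 / cmod ?d - 1 / 2"] by (simp add: power2_diff power_divide[of 1 "2::real"])
      ultimately have "1 / cmod ?d \<le> 1 + c" by linarith
      then have "(1 + (cmod z)\<^sup>2) * (1 / cmod ?d) \<le> (1 + (cmod z)\<^sup>2) * (1 + c)" by (intro mult_left_mono) auto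
      then show ?thesis by simp
    qed
    finally show "cmod ((1 + complex_of_real t * z) / ?d) \<le> cmod z + (1 + (cmod z)\<^sup>2) * (1 + c)"
      by (simp add: divide_right_mono)
  qed
qed

lemma integrable_schwarz:
  assumes u: "poisson_integrable u" and z: "Im z > 0"
  shows "integrable lborel (\<lambda>t. (1 + complex_of_real t * z) / (complex_of_real t - z) * complex_of_real (u t / (1 + t\<^sup>2)))"
proof -
  note [measurable] = poisson_integrable_measurable[OF u]
  obtain c where c: "c > 0" "\<And>t. cmod ((1 + complex_of_real t * z) / (complex_of_real t - z)) \<le> c"
    using schwarz_kernel_bound[OF z] by metis
  have i: "integrable lborel (\<lambda>t. c * (u t / (1 + t\<^sup>2)))"
    using u unfolding poisson_integrable_def by (rule integrable_mult_right)
  show ?thesis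
  proof (rule Bochner_Integration.integrable_bound[OF i])
    show "AE t in lborel. norm ((1 + complex_of_real t * z) / (complex_of_real t - z) * complex_of_real (u t / (1 + t\<^sup>2)))
        \<le> norm (c * (u t / (1 + t\<^sup>2)))"
    proof (rule AE_I2)
      fix t
      have "norm ((1 + complex_of_real t * z) / (complex_of_real t - z) * complex_of_real (u t / (1 + t\<^sup>2)))
         = cmod ((1 + complex_of_real t * z) / (complex_of_real t - z)) * \<bar>u t / (1 + t\<^sup>2)\<bar>"
        by (simp only: norm_mult norm_of_real)
      also have "\<dots> \<le> c * \<bar>u t / (1 + t\<^sup>2)\<bar>" by (rule mult_right_mono[OF c(2)]) simp
      also have "\<dots> = norm (c * (u t / (1 + t\<^sup>2)))" using c(1) by (simp only: abs_mult real_norm_def)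
      finally show "norm ((1 + complex_of_real t * z) / (complex_of_real t - z) * complex_of_real (u t / (1 + t\<^sup>2)))
        \<le> norm (c * (u t / (1 + t\<^sup>2)))" .
    qed
  qed measurable
qed

text \<open>
  The imaginary part of \<open>(1 + t * z) / (t - z)\<close> is \<open>(1 + t\<^sup>2) * Im z / |t - z|\<^sup>2\<close>, and the factor \<open>1 + t\<^sup>2\<close>
  cancels against the weight.
\<close>

lemma Re_schwarz_integral:
  assumes u: "poisson_integrable u" and z: "Im z > 0"
  shows "Re (schwarz_integral u z) = poisson u z"
proof -
  let ?k = "\<lambda>t. (1 + complex_of_real t * z) / (complex_of_real t - z) * complex_of_real (u t / (1 + t\<^sup>2))"
  have pt: "Im (?k t) / pi = poisson_kernel z t * u t" for t
  proof -
    have d: "(t - Re z)\<^sup>2 + (Im z)\<^sup>2 > 0" using poisson_kernel_denom_pos z by simp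
    have "Im ((1 + complex_of_real t * z) / (complex_of_real t - z)) = (1 + t\<^sup>2) * Im z / ((t - Re z)\<^sup>2 + (Im z)\<^sup>2)"
      by (simp add: Im_divide power2_eq_square algebra_simps)
    then have "Im (?k t) = (1 + t\<^sup>2) * Im z / ((t - Re z)\<^sup>2 + (Im z)\<^sup>2) * (u t / (1 + t\<^sup>2))"
      by (metis Im_complex_of_real Re_complex_of_real add.right_neutral add.commute mult_zero_right times_complex.sel(2))
    also have "\<dots> = Im z / ((t - Re z)\<^sup>2 + (Im z)\<^sup>2) * u t"
      using one_plus_square_pos[of t] by simp
    finally show ?thesis unfolding poisson_kernel_def by simp
  qed
  have "Re (schwarz_integral u z) = Im (integral\<^sup>L lborel ?k) / pi"
    unfolding schwarz_integral_def by (simp add: Re_divide Re_complex_div_gt_0 complex_eq_iff power2_eq_square)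
  also have "\<dots> = (\<integral>t. Im (?k t) \<partial>lborel) / pi" using integrable_schwarz[OF u z] by simp
  also have "\<dots> = (\<integral>t. Im (?k t) / pi \<partial>lborel)" by simp
  also have "\<dots> = poisson u z" unfolding pt poisson_def ..
  finally show ?thesis .
qed

lemma norm_outer: "poisson_integrable u \<Longrightarrow> Im z > 0 \<Longrightarrow> cmod (outer u z) = exp (poisson u z)"
  by (simp add: outer_def norm_exp_eq_Re Re_schwarz_integral)

lemma outer_nonzero [simp]: "outer u z \<noteq> 0"
  by (simp add: outer_def)

lemma outer_add:
  assumes "poisson_integrable u" "poisson_integrable v" "Im z > 0"
  shows "outer (\<lambda>t. u t + v t) z = outer u z * outer v z"
proof -
  let ?k = "\<lambda>t. (1 + complex_of_real t * z) / (complex_of_real t - z)"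
  have "(\<integral>t. ?k t * complex_of_real ((u t + v t) / (1 + t\<^sup>2)) \<partial>lborel)
      = (\<integral>t. ?k t * complex_of_real (u t / (1 + t\<^sup>2)) + ?k t * complex_of_real (v t / (1 + t\<^sup>2)) \<partial>lborel)"
    by (simp only: add_divide_distrib of_real_add distrib_left)
  also have "\<dots> = (\<integral>t. ?k t * complex_of_real (u t / (1 + t\<^sup>2)) \<partial>lborel) + (\<integral>t. ?k t * complex_of_real (v t / (1 + t\<^sup>2)) \<partial>lborel)"
    using assms by (intro Bochner_Integration.integral_add integrable_schwarz)
  finally have "schwarz_integral (\<lambda>t. u t + v t) z = schwarz_integral u z + schwarz_integral v z"
    unfolding schwarz_integral_def by (simp only: distrib_left)
  then show ?thesis by (simp add: outer_def exp_add)
qed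

text \<open>
  The difference quotient of the kernel between \<open>z\<close> and \<open>w\<close> is exactly \<open>(1 + t\<^sup>2) / ((t - z) * (t - w))\<close>.
  Against the weight this is dominated as soon as \<open>w\<close> is within \<open>Im z / 2\<close> of \<open>z\<close>, so differentiation under the
  integral sign is dominated convergence.
\<close>

lemma holomorphic_schwarz_integral:
  assumes u: "poisson_integrable u"
  shows "schwarz_integral u holomorphic_on {z. Im z > 0}"
proof -
  note [measurable] = poisson_integrable_measurable[OF u]
  let ?m = "\<lambda>t. complex_of_real (u t / (1 + t\<^sup>2))"
  let ?J = "\<lambda>z. \<integral>t. (1 + complex_of_real t * z) / (complex_of_real t - z) * ?m t \<partial>lborel"
  have "(?J has_field_derivative (\<integral>t. (1 + (complex_of_real t)\<^sup>2) / (complex_of_real t - z)\<^sup>2 * ?m t \<partial>lborel)) (at z)"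
    (is "(_ has_field_derivative ?D) _") if z: "Im z > 0" for z
    unfolding has_field_derivative_iff tendsto_at_iff_sequentially
  proof (intro allI impI)
    fix X :: "nat \<Rightarrow> complex" assume X: "\<forall>i. X i \<in> UNIV - {z}" "X \<longlonglongrightarrow> z"
    define r where "r = Im z / 2"
    have r: "r > 0" using z by (simp add: r_def)
    have "\<forall>\<^sub>F i in sequentially. dist (X i) z < r" using tendstoD[OF X(2) r] .
    then obtain N where N: "\<And>i. i \<ge> N \<Longrightarrow> dist (X i) z < r" unfolding eventually_sequentially by auto
    obtain c where c: "c > 0" "\<And>t. (1 + t\<^sup>2) / (cmod (complex_of_real t - z))\<^sup>2 \<le> c"
      using inverse_dist_upper[OF z] by metis
    let ?q = "\<lambda>i t. (1 + (complex_of_real t)\<^sup>2) / ((complex_of_real t - z) * (complex_of_real t - X (i + N))) * ?m t"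
    \<comment> \<open>X i is closer to z than half the distance from z to the line, so it can replace z at the cost of a factor 2.\<close>
    have half: "cmod (complex_of_real t - X (i + N)) \<ge> cmod (complex_of_real t - z) / 2" for i t
    proof -
      have "cmod (complex_of_real t - z) \<ge> Im z"
        using abs_Im_le_cmod[of "complex_of_real t - z"] z by simp
      moreover have "cmod (X (i + N) - z) < Im z / 2" using N[of "i + N"] by (simp add: dist_norm r_def)
      moreover have "cmod (complex_of_real t - z) \<le> cmod (complex_of_real t - X (i + N)) + cmod (X (i + N) - z)"
        by (metis diff_add_cancel diff_add_eq norm_triangle_ineq add_diff_eq)
      ultimately show ?thesis by linarith
    qed
    have ImX: "Im (X (i + N)) > 0" for i
      using N[of "i + N"] abs_Im_le_cmod[of "X (i + N) - z"] z by (simp add: dist_norm r_def)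
    have quot: "(?J (X (i + N)) - ?J z) / (X (i + N) - z) = (\<integral>t. ?q i t \<partial>lborel)" for i
    proof -
      let ?w = "X (i + N)"
      have ne: "?w - z \<noteq> 0" using X(1) by auto
      have "(?J ?w - ?J z) / (?w - z) = (\<integral>t. ((1 + complex_of_real t * ?w) / (complex_of_real t - ?w) * ?m t
            - (1 + complex_of_real t * z) / (complex_of_real t - z) * ?m t) / (?w - z) \<partial>lborel)"
        using integrable_schwarz[OF u z] integrable_schwarz[OF u ImX[of i]] by simp
      also have "\<dots> = (\<integral>t. ?q i t \<partial>lborel)"
      proof (rule Bochner_Integration.integral_cong[OF refl])
        fix t
        have a: "complex_of_real t - z \<noteq> 0" "complex_of_real t - ?w \<noteq> 0"
          using of_real_minus_nonzero z ImX by auto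
        have "(1 + complex_of_real t * ?w) / (complex_of_real t - ?w) - (1 + complex_of_real t * z) / (complex_of_real t - z)
           = (?w - z) * ((1 + (complex_of_real t)\<^sup>2) / ((complex_of_real t - z) * (complex_of_real t - ?w)))"
          using a by (simp add: divide_simps power2_eq_square algebra_simps)
        then have "((1 + complex_of_real t * ?w) / (complex_of_real t - ?w) - (1 + complex_of_real t * z) / (complex_of_real t - z)) * ?m t / (?w - z)
           = ?q i t" using ne by simp
        then show "((1 + complex_of_real t * ?w) / (complex_of_real t - ?w) * ?m t
            - (1 + complex_of_real t * z) / (complex_of_real t - z) * ?m t) / (?w - z) = ?q i t"
          by (simp only: left_diff_distrib)
      qed
      finally show ?thesis .
    qed
    have "(\<lambda>i. \<integral>t. ?q i t \<partial>lborel) \<longlonglongrightarrow> ?D"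
    proof (rule integral_dominated_convergence[where w = "\<lambda>t. 2 * c * \<bar>u t / (1 + t\<^sup>2)\<bar>"])
      show "integrable lborel (\<lambda>t. 2 * c * \<bar>u t / (1 + t\<^sup>2)\<bar>)"
        using u unfolding poisson_integrable_def by (intro integrable_mult_right integrable_abs)
      show "AE t in lborel. (\<lambda>i. ?q i t) \<longlonglongrightarrow> (1 + (complex_of_real t)\<^sup>2) / (complex_of_real t - z)\<^sup>2 * ?m t"
      proof (rule AE_I2)
        fix t
        have "(\<lambda>i. X (i + N)) \<longlonglongrightarrow> z" using X(2) by (rule LIMSEQ_ignore_initial_segment)
        then show "(\<lambda>i. ?q i t) \<longlonglongrightarrow> (1 + (complex_of_real t)\<^sup>2) / (complex_of_real t - z)\<^sup>2 * ?m t"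
          unfolding power2_eq_square[of "complex_of_real t - z"]
          using of_real_minus_nonzero[OF z, of t] by (intro tendsto_intros) auto
      qed
      fix i
      show "AE t in lborel. norm (?q i t) \<le> 2 * c * \<bar>u t / (1 + t\<^sup>2)\<bar>"
      proof (rule AE_I2)
        fix t
        let ?a = "cmod (complex_of_real t - z)" and ?b = "cmod (complex_of_real t - X (i + N))"
        have a: "?a > 0" using of_real_minus_nonzero[OF z] by simp
        have "cmod (1 + (complex_of_real t)\<^sup>2) = 1 + t\<^sup>2"
        proof -
          have "1 + (complex_of_real t)\<^sup>2 = complex_of_real (1 + t\<^sup>2)" by simp
          then show ?thesis by (metis abs_of_pos norm_of_real one_plus_square_pos)
        qed
        then have n: "norm (?q i t) = (1 + t\<^sup>2) / (?a * ?b) * \<bar>u t / (1 + t\<^sup>2)\<bar>"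
          by (simp only: norm_mult norm_divide norm_of_real)
        have "(1 + t\<^sup>2) / (?a * ?b) \<le> (1 + t\<^sup>2) / (?a * (?a / 2))"
          using a half[of t i] one_plus_square_pos[of t] order_less_le_trans[OF half_gt_zero[OF a] half[of t i]]
          by (intro divide_left_mono mult_left_mono mult_pos_pos) auto
        also have "\<dots> = 2 * ((1 + t\<^sup>2) / ?a\<^sup>2)" by (simp add: power2_eq_square)
        also have "\<dots> \<le> 2 * c" by (intro mult_left_mono c(2)) simp
        finally show "norm (?q i t) \<le> 2 * c * \<bar>u t / (1 + t\<^sup>2)\<bar>" unfolding n by (rule mult_right_mono) simp
      qed
    qed measurable
    then have "(\<lambda>i. (?J (X (i + N)) - ?J z) / (X (i + N) - z)) \<longlonglongrightarrow> ?D" unfolding quot .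
    then show "((\<lambda>y. (?J y - ?J z) / (y - z)) \<circ> X) \<longlonglongrightarrow> ?D"
      unfolding o_def by (rule LIMSEQ_offset)
  qed
  then have "?J holomorphic_on {z. Im z > 0}"
    by (subst holomorphic_on_open) (auto simp: open_halfspace_Im_gt)
  then show ?thesis unfolding schwarz_integral_def by (intro holomorphic_intros)
qed

lemma holomorphic_outer: "poisson_integrable u \<Longrightarrow> outer u holomorphic_on {z. Im z > 0}"
  unfolding outer_def by (intro holomorphic_intros holomorphic_schwarz_integral)

lemma outer_formula_iff:
  "outer_formula F \<longleftrightarrow> (\<exists>c u. cmod c = 1 \<and> poisson_integrable u \<and> (\<forall>z. Im z > 0 \<longrightarrow> F z = c * outer u z))"
  by (simp add: outer_formula_def poisson_integrable_def outer_def schwarz_integral_def)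

section \<open>Poisson representation of holomorphic functions\<close>

lemma contour_integral_linepath_horizontal:
  assumes "a < b"
  shows "contour_integral (linepath (Complex a y) (Complex b y)) f = integral {a..b} (\<lambda>x. f (Complex x y))"
proof -
  let ?c = "\<i> * complex_of_real y"
  have "linepath (Complex a y) (Complex b y) = (+) ?c \<circ> linepath (complex_of_real a) (complex_of_real b)"
    by (auto simp: fun_eq_iff linepath_def complex_eq_iff algebra_simps)
  then have "contour_integral (linepath (Complex a y) (Complex b y)) f
     = contour_integral (linepath (complex_of_real a) (complex_of_real b)) (\<lambda>w. f (w + ?c))"
    by (simp only: contour_integral_translate)
  also have "\<dots> = integral {a..b} (\<lambda>x. f (complex_of_real x + ?c))"
    using assms by (subst contour_integral_linepath_Reals_eq) auto
  also have "(\<lambda>x. f (complex_of_real x + ?c)) = (\<lambda>x. f (Complex x y))"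
    by (simp add: Complex_eq)
  finally show ?thesis .
qed

text \<open>
  Cauchy's formula for the function \<open>G w * (Im z / \<pi>) / (w - cnj z)\<close>, whose pole lies below the line. The
  resulting kernel restricts to the Poisson kernel on the line and decays like the inverse square at infinity, one order
  better than the Cauchy kernel.
\<close>

lemma rectangle_reproduction:
  fixes G :: "complex \<Rightarrow> complex"
  assumes \<eta>: "\<eta> > 0" and G: "G holomorphic_on {w. Im w > - \<eta>}"
    and z: "Im z > 0" "\<bar>Re z\<bar> < R" "Im z < n"
  defines "k \<equiv> \<lambda>w. complex_of_real (Im z / pi) / ((w - z) * (w - cnj z))"
  shows "G z = integral {-R..R} (\<lambda>x. k (Complex x 0) * G (Complex x 0))
     + \<i> * integral {0..n} (\<lambda>y. k (Complex R y) * G (Complex R y))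
     - integral {-R..R} (\<lambda>x. k (Complex x n) * G (Complex x n))
     - \<i> * integral {0..n} (\<lambda>y. k (Complex (-R) y) * G (Complex (-R) y))"
proof -
  have R: "R > 0" using z by linarith
  have n: "n > 0" using z by linarith
  \<comment> \<open>The half-plane above height -m contains the rectangle and avoids the reflected point.\<close>
  define m where "m = min \<eta> (Im z)"
  define S where "S = {w. Im w > - m}"
  have conv: "convex S" and opn: "open S"
    unfolding S_def by (simp_all add: convex_halfspace_Im_gt open_halfspace_Im_gt)
  define h where "h = (\<lambda>w. G w * complex_of_real (Im z / pi) / (w - cnj z))"
  have ne: "w - cnj z \<noteq> 0" if "w \<in> S" for w
    using that z by (auto simp: S_def m_def complex_eq_iff)
  have hh: "h holomorphic_on S" unfolding h_def
    by (intro holomorphic_intros holomorphic_on_subset[OF G] ne) (auto simp: S_def m_def)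
  define f where "f = (\<lambda>w. k w * G w)"
  have f_h: "f w = h w / (w - z)" for w unfolding f_def k_def h_def by (simp add: mult_ac)
  let ?a1 = "Complex (-R) 0" and ?a3 = "Complex R n" and ?a2 = "Complex R 0" and ?a4 = "Complex (-R) n"
  have zbox: "z \<in> box ?a1 ?a3" using z by (auto simp: in_box_complex_iff)
  have mpos: "m > 0" using \<eta> z by (simp add: m_def)
  have cb: "cbox ?a1 ?a3 \<subseteq> S" using mpos by (auto simp: in_cbox_complex_iff S_def)
  have pim: "path_image (rectpath ?a1 ?a3) \<subseteq> S - {z}"
    using path_image_rectpath_cbox_minus_box[of ?a1 ?a3] R n cb zbox by auto
  have wn: "winding_number (rectpath ?a1 ?a3) z = 1"
    by (rule winding_number_rectpath[OF zbox])
  have zS: "z \<in> interior S" using zbox cb opn box_subset_cbox[of ?a1 ?a3] by (auto simp: interior_open)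
  have tot: "(f has_contour_integral (2 * pi * \<i> * h z)) (rectpath ?a1 ?a3)"
    using Cauchy_integral_formula_convex_simple[OF conv hh zS valid_path_rectpath pim] wn
    unfolding fun_eq_iff[THEN iffD2, OF allI, OF f_h] by simp
  have hz: "2 * pi * \<i> * h z = G z"
  proof -
    have "z - cnj z = 2 * \<i> * complex_of_real (Im z)" by (simp add: complex_eq_iff)
    then show ?thesis using z by (simp add: h_def)
  qed
  have segs: "closed_segment ?a1 ?a2 \<subseteq> path_image (rectpath ?a1 ?a3)" "closed_segment ?a2 ?a3 \<subseteq> path_image (rectpath ?a1 ?a3)"
       "closed_segment ?a3 ?a4 \<subseteq> path_image (rectpath ?a1 ?a3)" "closed_segment ?a4 ?a1 \<subseteq> path_image (rectpath ?a1 ?a3)"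
    by (auto simp: rectpath_def Let_def path_image_join)
  have contf: "continuous_on (S - {z}) f" unfolding f_h
    by (intro continuous_intros holomorphic_on_imp_continuous_on holomorphic_on_subset[OF hh]) auto
  have cf: "continuous_on (closed_segment a b) f" if "closed_segment a b \<subseteq> path_image (rectpath ?a1 ?a3)" for a b
    using continuous_on_subset[OF contf] that pim by blast
  have I: "(f has_contour_integral contour_integral (linepath a b) f) (linepath a b)"
    if "closed_segment a b \<subseteq> path_image (rectpath ?a1 ?a3)" for a b
    using contour_integrable_continuous_linepath[OF cf[OF that]] by (rule has_contour_integral_integral)
  have "(f has_contour_integral (contour_integral (linepath ?a1 ?a2) f + (contour_integral (linepath ?a2 ?a3) f
       + (contour_integral (linepath ?a3 ?a4) f + contour_integral (linepath ?a4 ?a1) f)))) (rectpath ?a1 ?a3)"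
    unfolding rectpath_def Let_def complex.sel
    by (intro has_contour_integral_join I segs[simplified complex.sel] valid_path_join valid_path_linepath) auto
  then have "G z = contour_integral (linepath ?a1 ?a2) f + (contour_integral (linepath ?a2 ?a3) f
       + (contour_integral (linepath ?a3 ?a4) f + contour_integral (linepath ?a4 ?a1) f))"
    using contour_integral_unique tot hz by metis
  also have "contour_integral (linepath ?a3 ?a4) f = - contour_integral (linepath ?a4 ?a3) f"
    by (rule contour_integral_reverse_linepath[OF cf[OF segs(3)]])
  also have "contour_integral (linepath ?a4 ?a1) f = - contour_integral (linepath ?a1 ?a4) f"
    by (rule contour_integral_reverse_linepath[OF cf[OF segs(4)]])
  also have "contour_integral (linepath ?a1 ?a2) f = integral {-R..R} (\<lambda>x. f (Complex x 0))"
    using R by (intro contour_integral_linepath_horizontal) auto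
  also have "contour_integral (linepath ?a4 ?a3) f = integral {-R..R} (\<lambda>x. f (Complex x n))"
    using R by (intro contour_integral_linepath_horizontal) auto
  also have "contour_integral (linepath ?a2 ?a3) f = \<i> * integral {0..n} (\<lambda>y. f (Complex R y))"
    using n by (intro contour_integral_linepath_same_Re) auto
  also have "contour_integral (linepath ?a1 ?a4) f = \<i> * integral {0..n} (\<lambda>y. f (Complex (-R) y))"
    using n by (intro contour_integral_linepath_same_Re) auto
  finally show ?thesis by (simp add: f_def)
qed

lemma norm_integral_le_nn_integral:
  fixes f :: "real \<Rightarrow> complex"
  assumes c: "continuous_on {a..b} f"
    and le: "(\<integral>\<^sup>+x. indicator {a..b} x * ennreal (cmod (f x)) \<partial>lborel) \<le> ennreal B" and B: "B \<ge> 0"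
  shows "cmod (integral {a..b} f) \<le> B"
proof -
  have i: "set_integrable lborel {a..b} f" using borel_integrable_atLeastAtMost'[OF c] .
  have "integral {a..b} f = (\<integral>x. indicator {a..b} x *\<^sub>R f x \<partial>lborel)"
    using set_borel_integral_eq_integral(2)[OF i] by (simp add: set_lebesgue_integral_def)
  then have "ennreal (cmod (integral {a..b} f)) \<le> (\<integral>\<^sup>+x. ennreal (cmod (indicator {a..b} x *\<^sub>R f x)) \<partial>lborel)"
    using integral_norm_bound_ennreal[of lborel "\<lambda>x. indicator {a..b} x *\<^sub>R f x"] i by (simp add: set_integrable_def)
  also have "\<dots> = (\<integral>\<^sup>+x. indicator {a..b} x * ennreal (cmod (f x)) \<partial>lborel)"
    by (intro nn_integral_cong) (auto split: split_indicator)
  finally have "ennreal (cmod (integral {a..b} f)) \<le> (\<integral>\<^sup>+x. indicator {a..b} x * ennreal (cmod (f x)) \<partial>lborel)" .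
  from order_trans[OF this le] show ?thesis using B by (simp add: ennreal_le_iff)
qed

lemma continuous_on_upper_line:
  assumes "F holomorphic_on {z. Im z > 0}" "y > 0"
  shows "continuous_on UNIV (\<lambda>x. F (Complex x y))"
proof (rule continuous_on_compose2[OF holomorphic_on_imp_continuous_on[OF assms(1)]])
  show "continuous_on UNIV (\<lambda>x. Complex x y)" unfolding Complex_eq by (intro continuous_intros)
qed (use assms in auto)

lemma measurable_upper_line:
  assumes "F holomorphic_on {z. Im z > 0}" "y > 0"
  shows "(\<lambda>x. F (Complex x y)) \<in> borel_measurable borel"
  using continuous_on_upper_line[OF assms] by (rule borel_measurable_continuous_onI)

lemma poisson_kernel_eq_product:
  "Im z \<noteq> 0 \<Longrightarrow> complex_of_real (Im z / pi) / ((Complex t 0 - z) * (Complex t 0 - cnj z)) = complex_of_real (poisson_kernel z t)"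
proof -
  have "(Complex t 0 - z) * (Complex t 0 - cnj z) = complex_of_real ((t - Re z)\<^sup>2 + (Im z)\<^sup>2)"
    by (simp add: complex_eq_iff power2_eq_square algebra_simps)
  then show ?thesis by (simp add: poisson_kernel_def)
qed

text \<open>
  A bound on the part of \<open>g\<close> above a level \<open>C\<close> controls all integrals over intervals, linearly in the length.
  Both bounded functions and functions with bounded \<open>L_p\<close> norms, \<open>p \<ge> 1\<close>, satisfy such a bound.
\<close>

lemma nn_integral_interval_bound:
  assumes g[measurable]: "g \<in> borel_measurable borel" and C: "C \<ge> 0" and M: "M \<ge> 0" and ab: "a \<le> b"
    and le: "(\<integral>\<^sup>+x. ennreal (g x - C) \<partial>lborel) \<le> ennreal M"
  shows "(\<integral>\<^sup>+x. indicator {a..b} x * ennreal (g x) \<partial>lborel) \<le> ennreal (C * (b - a) + M)"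
proof -
  have "(\<integral>\<^sup>+x. indicator {a..b} x * ennreal (g x) \<partial>lborel) \<le> (\<integral>\<^sup>+x. ennreal C * indicator {a..b} x + ennreal (g x - C) \<partial>lborel)"
  proof (rule nn_integral_mono)
    fix x
    have "ennreal (g x) \<le> ennreal C + ennreal (g x - C)"
      using C by (cases "g x \<ge> C") (auto simp: ennreal_plus[symmetric] ennreal_neg intro!: ennreal_leI simp del: ennreal_plus)
    then show "indicator {a..b} x * ennreal (g x) \<le> ennreal C * indicator {a..b} x + ennreal (g x - C)"
      by (auto split: split_indicator)
  qed
  also have "\<dots> = ennreal C * emeasure lborel {a..b} + (\<integral>\<^sup>+x. ennreal (g x - C) \<partial>lborel)"
    by (subst nn_integral_add) (auto simp: nn_integral_cmult_indicator)
  also have "\<dots> \<le> ennreal C * ennreal (b - a) + ennreal M" using le ab by (intro add_mono) auto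
  also have "\<dots> = ennreal (C * (b - a) + M)" using C M ab by (simp add: ennreal_mult ennreal_plus)
  finally show ?thesis .
qed

text \<open>
  The boundary values on the line of height \<open>\<eta>\<close> reproduce the function above it. In the rectangle formula with corners
  \<open>- R\<close> and \<open>R + \<i> * n\<close> the kernel is of order \<open>1 / n\<^sup>2\<close> on three sides, where \<open>n \<le> R \<le> n + 1\<close>. The integral over
  the top side grows at most linearly. Pointwise bounds on the vertical sides are not available, but averaging over \<open>R\<close>
  turns the two vertical integrals into area integrals of linear growth, so some \<open>R\<close> in the interval is good.
\<close>

theorem poisson_reproduction:
  assumes F: "F holomorphic_on {z. Im z > 0}" and C: "C \<ge> 0" and M: "M \<ge> 0"
    and le: "\<And>y. y > 0 \<Longrightarrow> (\<integral>\<^sup>+x. ennreal (cmod (F (Complex x y)) - C) \<partial>lborel) \<le> ennreal M"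
    and z: "Im z > 0" and \<eta>: "\<eta> > 0"
  shows "integrable lborel (\<lambda>t. complex_of_real (poisson_kernel z t) * F (Complex t \<eta>))"
    and "F (z + \<i> * complex_of_real \<eta>) = (\<integral>t. complex_of_real (poisson_kernel z t) * F (Complex t \<eta>) \<partial>lborel)"
proof -
  define G where "G = (\<lambda>w. F (w + \<i> * complex_of_real \<eta>))"
  have G: "G holomorphic_on {w. Im w > - \<eta>}"
    unfolding G_def by (rule holomorphic_on_compose_gen[OF _ F, unfolded o_def]) (auto intro!: holomorphic_intros)
  have GF: "G (Complex x y) = F (Complex x (y + \<eta>))" for x y
    unfolding G_def by (rule arg_cong[of _ _ F]) (simp add: complex_eq_iff)
  note [measurable] = measurable_upper_line[OF F]
  define k where "k = (\<lambda>w. complex_of_real (Im z / pi) / ((w - z) * (w - cnj z)))"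
  have k0: "k (Complex t 0) = complex_of_real (poisson_kernel z t)" for t
    unfolding k_def using poisson_kernel_eq_product[of z t] z by simp
  show int: "integrable lborel (\<lambda>t. complex_of_real (poisson_kernel z t) * F (Complex t \<eta>))"
  proof (rule integrableI_bounded)
    show "(\<lambda>t. complex_of_real (poisson_kernel z t) * F (Complex t \<eta>)) \<in> borel_measurable lborel" using \<eta> by measurable
    have "(\<integral>\<^sup>+t. ennreal (norm (complex_of_real (poisson_kernel z t) * F (Complex t \<eta>))) \<partial>lborel)
       \<le> (\<integral>\<^sup>+t. ennreal C * ennreal (poisson_kernel z t) + ennreal (1 / (pi * Im z)) * ennreal (cmod (F (Complex t \<eta>)) - C) \<partial>lborel)"
    proof (rule nn_integral_mono)
      fix t
      let ?P = "poisson_kernel z t" and ?f = "cmod (F (Complex t \<eta>))"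
      have P: "0 \<le> ?P" "?P \<le> 1 / (pi * Im z)" using poisson_kernel_nonneg poisson_kernel_le z by auto
      have "?P * ?f \<le> C * ?P + 1 / (pi * Im z) * max 0 (?f - C)"
      proof -
        have "?f \<le> C + max 0 (?f - C)" by simp
        then have "?P * ?f \<le> ?P * (C + max 0 (?f - C))" using P by (intro mult_left_mono) auto
        also have "\<dots> = C * ?P + ?P * max 0 (?f - C)" by (simp add: algebra_simps)
        also have "?P * max 0 (?f - C) \<le> 1 / (pi * Im z) * max 0 (?f - C)" using P by (intro mult_right_mono) auto
        finally show ?thesis by simp
      qed
      then have "ennreal (?P * ?f) \<le> ennreal (C * ?P + 1 / (pi * Im z) * max 0 (?f - C))" by (rule ennreal_leI)
      also have "\<dots> = ennreal C * ennreal ?P + ennreal (1 / (pi * Im z)) * ennreal (max 0 (?f - C))"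
        using C P z by (subst ennreal_plus, simp_all only: ennreal_mult[OF C P(1)] ennreal_mult[of "1 / (pi * Im z)" "max 0 (?f - C)"]) auto
      finally show "ennreal (norm (complex_of_real ?P * F (Complex t \<eta>)))
         \<le> ennreal C * ennreal ?P + ennreal (1 / (pi * Im z)) * ennreal (?f - C)"
        using P by (cases "?f \<ge> C") (simp_all add: norm_mult ennreal_neg)
    qed
    also have "\<dots> = ennreal C * (\<integral>\<^sup>+t. ennreal (poisson_kernel z t) \<partial>lborel) + ennreal (1 / (pi * Im z)) * (\<integral>\<^sup>+t. ennreal (cmod (F (Complex t \<eta>)) - C) \<partial>lborel)"
      using \<eta> by (subst nn_integral_add) (auto simp: nn_integral_cmult)
    also have "\<dots> \<le> ennreal C * 1 + ennreal (1 / (pi * Im z)) * ennreal M"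
      using le[OF \<eta>] z by (intro add_mono mult_left_mono) (auto simp: nn_integral_poisson_kernel)
    also have "\<dots> < \<infinity>" by (simp add: ennreal_mult_less_top)
    finally show "(\<integral>\<^sup>+t. ennreal (norm (complex_of_real (poisson_kernel z t) * F (Complex t \<eta>))) \<partial>lborel) < \<infinity>" .
  qed
  \<comment> \<open>Cutting off at y = 0 makes g continuous on the whole plane, hence jointly measurable.\<close>
  define g where "g = (\<lambda>x y. cmod (F (Complex x (max y 0 + \<eta>))))"
  have gG: "cmod (G (Complex x y)) = g x y" if "y \<ge> 0" for x y using that by (simp add: g_def GF)
  have [measurable]: "(\<lambda>(x,y). g x y) \<in> borel_measurable (borel \<Otimes>\<^sub>M borel)"
  proof -
    have "continuous_on UNIV (\<lambda>w::real \<times> real. F (Complex (fst w) (max (snd w) 0 + \<eta>)))"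
    proof (rule continuous_on_compose2[OF holomorphic_on_imp_continuous_on[OF F]])
      show "continuous_on UNIV (\<lambda>w::real \<times> real. Complex (fst w) (max (snd w) 0 + \<eta>))"
        unfolding Complex_eq by (intro continuous_intros)
    qed (use \<eta> in auto)
    then have "(\<lambda>w::real \<times> real. F (Complex (fst w) (max (snd w) 0 + \<eta>))) \<in> borel_measurable borel"
      by (rule borel_measurable_continuous_onI)
    then show ?thesis unfolding g_def borel_prod[symmetric] case_prod_unfold by measurable
  qed
  have gC: "(\<integral>\<^sup>+x. ennreal (g x y - C) \<partial>lborel) \<le> ennreal M" for y
    unfolding g_def using le[of "max y 0 + \<eta>"] \<eta> by simp
  have strip: "(\<integral>\<^sup>+x. indicator {a..b} x * ennreal (g x y) \<partial>lborel) \<le> ennreal (C * (b - a) + M)" if "a \<le> b" for a b y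
    by (rule nn_integral_interval_bound[OF _ C M that gC]) measurable
  have strip': "(\<integral>\<^sup>+x. indicator {a..b} x * ennreal (g (- x) y) \<partial>lborel) \<le> ennreal (C * (b - a) + M)" if "a \<le> b" for a b y
  proof (rule nn_integral_interval_bound[OF _ C M that])
    show "(\<integral>\<^sup>+x. ennreal (g (- x) y - C) \<partial>lborel) \<le> ennreal M"
      using gC[of y] nn_integral_real_affine[of "\<lambda>x. ennreal (g x y - C)" "-1" 0] by simp
  qed measurable
  \<comment> \<open>The kernel bound times a bound for the integrals over the two vertical sides and over the top side.\<close>
  define E where "E n = 4 * Im z / pi / (real n)\<^sup>2 * (2 * (real n * (2 * C + 2 * M) + 1) + (C * (2 * (real n + 1)) + M))" for n
  have ex: "\<exists>R. real n \<le> R \<and> R \<le> real n + 1 \<and> cmod (G z - integral {-R..R} (\<lambda>x. k (Complex x 0) * G (Complex x 0))) \<le> E n"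
    if n: "real n \<ge> 2 * \<bar>Re z\<bar> + 2 * Im z + 1" for n
  proof -
    let ?W = "\<lambda>R. \<integral>\<^sup>+y. indicator {0..real n} y * (ennreal (g R y) + ennreal (g (-R) y)) \<partial>lborel"
    \<comment> \<open>The added 1 makes the averaged bound strict.\<close>
    let ?K = "real n * (2 * C + 2 * M) + 1"
    have Kpos: "real n * (2 * C + 2 * M) \<ge> 0" using C M by simp
    have "\<exists>R\<in>{real n..real n + 1}. ?W R \<le> ennreal ?K"
    proof (rule ccontr)
      assume "\<not> ?thesis"
      then have big: "ennreal ?K < ?W R" if "R \<in> {real n..real n+1}" for R using that by (auto simp: not_le)
      have "ennreal ?K = (\<integral>\<^sup>+R. ennreal ?K * indicator {real n..real n+1} R \<partial>lborel)"
        by (simp add: nn_integral_cmult_indicator)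
      also have "\<dots> \<le> (\<integral>\<^sup>+R. (\<integral>\<^sup>+y. indicator {real n..real n+1} R * (indicator {0..real n} y * (ennreal (g R y) + ennreal (g (-R) y))) \<partial>lborel) \<partial>lborel)"
        using big by (intro nn_integral_mono) (auto split: split_indicator intro: less_imp_le)
      also have "\<dots> = (\<integral>\<^sup>+y. (\<integral>\<^sup>+R. indicator {real n..real n+1} R * (indicator {0..real n} y * (ennreal (g R y) + ennreal (g (-R) y))) \<partial>lborel) \<partial>lborel)"
        by (rule lborel_pair.Fubini') simp
      also have "\<dots> \<le> (\<integral>\<^sup>+y. ennreal (2 * C + 2 * M) * indicator {0..real n} y \<partial>lborel)"
      proof (rule nn_integral_mono)
        fix y
        have "(\<integral>\<^sup>+R. indicator {real n..real n+1} R * (ennreal (g R y) + ennreal (g (-R) y)) \<partial>lborel)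
          = (\<integral>\<^sup>+R. indicator {real n..real n+1} R * ennreal (g R y) \<partial>lborel) + (\<integral>\<^sup>+R. indicator {real n..real n+1} R * ennreal (g (-R) y) \<partial>lborel)"
          unfolding distrib_left by (rule nn_integral_add) measurable
        also have "\<dots> \<le> ennreal (C * 1 + M) + ennreal (C * 1 + M)"
          using strip[of "real n" "real n + 1" y] strip'[of "real n" "real n + 1" y] by (intro add_mono) simp_all
        also have "\<dots> = ennreal (2 * C + 2 * M)" using C M by (simp add: ennreal_plus[symmetric] del: ennreal_plus)
        finally show "(\<integral>\<^sup>+R. indicator {real n..real n+1} R * (indicator {0..real n} y * (ennreal (g R y) + ennreal (g (-R) y))) \<partial>lborel)
          \<le> ennreal (2 * C + 2 * M) * indicator {0..real n} y" by (auto split: split_indicator)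
      qed
      also have "\<dots> = ennreal (real n * (2 * C + 2 * M))" using C M by (subst nn_integral_cmult_indicator) (simp_all add: ennreal_mult[symmetric] mult.commute del: ennreal_plus)
      finally show False using Kpos by (simp add: ennreal_le_iff)
    qed
    then obtain R where R: "real n \<le> R" "R \<le> real n + 1" and W: "?W R \<le> ennreal ?K" by auto
    have npos: "real n > 0" using n z by linarith
    have kb: "cmod (k w) \<le> 4 * Im z / pi / (real n)\<^sup>2" if w: "\<bar>Re w\<bar> \<ge> real n \<or> Im w \<ge> real n" for w
    proof -
      have a: "cmod (w - z) \<ge> real n / 2"
      proof (cases "\<bar>Re w\<bar> \<ge> real n")
        case True
        then show ?thesis using abs_Re_le_cmod[of "w - z"] n z by simp
      next
        case False
        then show ?thesis using abs_Im_le_cmod[of "w - z"] n z w by simp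
      qed
      have b: "cmod (w - cnj z) \<ge> real n / 2"
      proof (cases "\<bar>Re w\<bar> \<ge> real n")
        case True
        then show ?thesis using abs_Re_le_cmod[of "w - cnj z"] n z by simp
      next
        case False
        then show ?thesis using abs_Im_le_cmod[of "w - cnj z"] n z w by simp
      qed
      have ap: "cmod (w - z) > 0" and bp: "cmod (w - cnj z) > 0" using a b npos by linarith+
      have "real n / 2 * (real n / 2) \<le> cmod (w - z) * cmod (w - cnj z)" using a b npos by (intro mult_mono) auto
      then have "Im z / pi / (cmod (w - z) * cmod (w - cnj z)) \<le> Im z / pi / (real n / 2 * (real n / 2))"
        using z npos by (intro divide_left_mono mult_pos_pos) (use ap bp in auto)
      also have "\<dots> = 4 * Im z / pi / (real n)\<^sup>2" by (simp add: power2_eq_square)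
      finally show ?thesis using z by (simp add: k_def norm_divide norm_mult)
    qed
    define c where "c = 4 * Im z / pi / (real n)\<^sup>2"
    have c: "c \<ge> 0" using z by (simp add: c_def)
    have Rz: "\<bar>Re z\<bar> < R" "Im z < real n" using n R z by linarith+
    have cont: "continuous_on A (\<lambda>s. k (p s) * G (p s))"
      if "continuous_on A p" "\<And>s. s \<in> A \<Longrightarrow> Im (p s) \<ge> 0 \<and> (\<bar>Re (p s)\<bar> \<ge> real n \<or> Im (p s) \<ge> real n)" for p :: "real \<Rightarrow> complex" and A
    proof (intro continuous_on_mult)
      show "continuous_on A (\<lambda>s. G (p s))"
        by (rule continuous_on_compose2[OF holomorphic_on_imp_continuous_on[OF G] that(1)]) (use that(2) \<eta> in force)
      have "p s - z \<noteq> 0" "p s - cnj z \<noteq> 0" if "s \<in> A" for s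
        using \<open>\<And>s. s \<in> A \<Longrightarrow> _\<close>[OF that] n z by (auto simp: complex_eq_iff)
      then show "continuous_on A (\<lambda>s. k (p s))" unfolding k_def
        by (intro continuous_intros that(1)) auto
    qed
    have line: "continuous_on A (\<lambda>y. Complex x y)" "continuous_on A (\<lambda>x. Complex x y)" for A x y
      unfolding Complex_eq by (intro continuous_intros)+
    have edge: "cmod (integral {a..b} (\<lambda>s. k (q s) * G (q s))) \<le> c * D"
      if q: "continuous_on UNIV q" "\<And>s. s \<in> {a..b} \<Longrightarrow> Im (q s) \<ge> 0 \<and> (\<bar>Re (q s)\<bar> \<ge> real n \<or> Im (q s) \<ge> real n)"
        and D: "(\<integral>\<^sup>+s. indicator {a..b} s * ennreal (g (Re (q s)) (Im (q s))) \<partial>lborel) \<le> ennreal D" "D \<ge> 0" for q :: "real \<Rightarrow> complex" and a b D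
    proof (rule norm_integral_le_nn_integral)
      have [measurable]: "q \<in> borel_measurable borel" using q(1) by (rule borel_measurable_continuous_onI)
      show "continuous_on {a..b} (\<lambda>s. k (q s) * G (q s))"
        by (rule cont[OF continuous_on_subset[OF q(1) subset_UNIV] q(2)])
      have "(\<integral>\<^sup>+s. indicator {a..b} s * ennreal (cmod (k (q s) * G (q s))) \<partial>lborel)
          \<le> (\<integral>\<^sup>+s. ennreal c * (indicator {a..b} s * ennreal (g (Re (q s)) (Im (q s)))) \<partial>lborel)"
      proof (rule nn_integral_mono)
        fix s
        have "ennreal (cmod (k (q s) * G (q s))) \<le> ennreal c * ennreal (g (Re (q s)) (Im (q s)))" if s: "s \<in> {a..b}"
        proof -
          have "cmod (G (q s)) = g (Re (q s)) (Im (q s))" using gG[of "Im (q s)" "Re (q s)"] q(2)[OF s] by simp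
          then have "cmod (k (q s) * G (q s)) \<le> c * g (Re (q s)) (Im (q s))"
            unfolding norm_mult c_def using mult_right_mono[OF kb[of "q s"], of "g (Re (q s)) (Im (q s))"] q(2)[OF s]
            by (simp add: g_def)
          then show ?thesis using c by (simp add: ennreal_mult'[symmetric] ennreal_leI)
        qed
        then show "indicator {a..b} s * ennreal (cmod (k (q s) * G (q s)))
            \<le> ennreal c * (indicator {a..b} s * ennreal (g (Re (q s)) (Im (q s))))" by (auto split: split_indicator)
      qed
      also have "\<dots> = ennreal c * (\<integral>\<^sup>+s. indicator {a..b} s * ennreal (g (Re (q s)) (Im (q s))) \<partial>lborel)"
        by (rule nn_integral_cmult) measurable
      also have "\<dots> \<le> ennreal c * ennreal D" using D(1) by (rule mult_left_mono) simp
      finally show "(\<integral>\<^sup>+s. indicator {a..b} s * ennreal (cmod (k (q s) * G (q s))) \<partial>lborel) \<le> ennreal (c * D)"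
        using c D(2) by (simp add: ennreal_mult)
    qed (use c D(2) in simp)
    have side: "cmod (integral {0..real n} (\<lambda>y. k (Complex r y) * G (Complex r y))) \<le> c * ?K" if r: "r = R \<or> r = -R" for r
    proof (rule edge[OF line(1)])
      have "(\<integral>\<^sup>+y. indicator {0..real n} y * ennreal (g r y) \<partial>lborel) \<le> ?W R"
        using r by (intro nn_integral_mono mult_left_mono) auto
      then show "(\<integral>\<^sup>+y. indicator {0..real n} y * ennreal (g (Re (Complex r y)) (Im (Complex r y))) \<partial>lborel) \<le> ennreal ?K"
        using W by simp
    qed (use r R npos Kpos in auto)
    note I1 = side[of R, simplified] and I2 = side[of "-R", simplified]
    have I3: "cmod (integral {-R..R} (\<lambda>x. k (Complex x n) * G (Complex x n))) \<le> c * (C * (2 * (real n + 1)) + M)"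
    proof (rule edge[OF line(2)])
      have "(\<integral>\<^sup>+x. indicator {-R..R} x * ennreal (g x n) \<partial>lborel) \<le> ennreal (C * (R - - R) + M)" using R npos by (intro strip) auto
      also have "\<dots> \<le> ennreal (C * (2 * (real n + 1)) + M)" using R C by (intro ennreal_leI add_right_mono mult_left_mono) auto
      finally show "(\<integral>\<^sup>+x. indicator {-R..R} x * ennreal (g (Re (Complex x n)) (Im (Complex x n))) \<partial>lborel)
          \<le> ennreal (C * (2 * (real n + 1)) + M)" by simp
    qed (use C M in auto)
    let ?A = "integral {0..real n} (\<lambda>y. k (Complex R y) * G (Complex R y))"
    let ?B = "integral {0..real n} (\<lambda>y. k (Complex (-R) y) * G (Complex (-R) y))"
    let ?T = "integral {-R..R} (\<lambda>x. k (Complex x n) * G (Complex x n))"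
    have eq: "G z - integral {-R..R} (\<lambda>x. k (Complex x 0) * G (Complex x 0)) = \<i> * ?A - ?T - \<i> * ?B"
      using rectangle_reproduction[OF \<eta> G z Rz] unfolding k_def by simp
    have "cmod (G z - integral {-R..R} (\<lambda>x. k (Complex x 0) * G (Complex x 0))) \<le> cmod ?A + cmod ?T + cmod ?B"
      unfolding eq using norm_triangle_ineq4[of "\<i> * ?A - ?T" "\<i> * ?B"] norm_triangle_ineq4[of "\<i> * ?A" ?T]
      by (simp add: norm_mult)
    also have "\<dots> \<le> c * ?K + c * (C * (2 * (real n + 1)) + M) + c * ?K" using I1 I2 I3 by linarith
    also have "\<dots> = E n" unfolding E_def c_def[symmetric] by (simp add: algebra_simps)
    finally show ?thesis using R by blast
  qed
  \<comment> \<open>From n0 on, all points of the three outer sides are at distance at least n / 2 from z and its reflection.\<close>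
  obtain n0 :: nat where n0: "real n0 \<ge> 2 * \<bar>Re z\<bar> + 2 * Im z + 1" using real_arch_simple by blast
  have "\<exists>R. \<forall>i. real (i + n0) \<le> R i \<and> R i \<le> real (i + n0) + 1 \<and> cmod (G z - integral {-R i..R i} (\<lambda>x. k (Complex x 0) * G (Complex x 0))) \<le> E (i + n0)"
    by (rule choice, rule allI, rule ex) (use n0 in simp)
  then obtain R where R: "\<And>i. real (i + n0) \<le> R i" "\<And>i. cmod (G z - integral {-R i..R i} (\<lambda>x. k (Complex x 0) * G (Complex x 0))) \<le> E (i + n0)" by blast
  have E0: "E \<longlonglongrightarrow> 0"
  proof -
    have "(\<lambda>n. 4 * Im z / pi * (2 * ((2 * C + 2 * M) * (1 / real n) + 1 / real n * (1 / real n)) + (2 * C * (1 / real n + 1 / real n * (1 / real n)) + M * (1 / real n * (1 / real n)))))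
       \<longlonglongrightarrow> 4 * Im z / pi * (2 * ((2 * C + 2 * M) * 0 + 0 * 0) + (2 * C * (0 + 0 * 0) + M * (0 * 0)))"
      by (intro tendsto_intros lim_1_over_n)
    moreover have "\<forall>\<^sub>F n in sequentially. 4 * Im z / pi * (2 * ((2 * C + 2 * M) * (1 / real n) + 1 / real n * (1 / real n)) + (2 * C * (1 / real n + 1 / real n * (1 / real n)) + M * (1 / real n * (1 / real n)))) = E n"
      using eventually_gt_at_top[of 0]
    proof eventually_elim
      case (elim n)
      then show ?case unfolding E_def by (simp add: field_simps power2_eq_square)
    qed
    ultimately have "E \<longlonglongrightarrow> 4 * Im z / pi * (2 * ((2 * C + 2 * M) * 0 + 0 * 0) + (2 * C * (0 + 0 * 0) + M * (0 * 0)))"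
      by (rule Lim_transform_eventually)
    then show ?thesis by simp
  qed
  have lim1: "(\<lambda>i. integral {-R i..R i} (\<lambda>x. k (Complex x 0) * G (Complex x 0))) \<longlonglongrightarrow> G z"
  proof (rule LIM_zero_cancel, rule Lim_null_comparison)
    show "\<forall>\<^sub>F i in sequentially. norm (integral {-R i..R i} (\<lambda>x. k (Complex x 0) * G (Complex x 0)) - G z) \<le> E (i + n0)"
      using R(2) by (auto simp: norm_minus_commute)
    show "(\<lambda>i. E (i + n0)) \<longlonglongrightarrow> 0" using E0 by (rule LIMSEQ_ignore_initial_segment)
  qed
  let ?f = "\<lambda>t. complex_of_real (poisson_kernel z t) * F (Complex t \<eta>)"
  have kf: "k (Complex x 0) * G (Complex x 0) = ?f x" for x by (simp add: k0 GF)
  have lim2: "(\<lambda>i. \<integral>t. indicator {-R i..R i} t *\<^sub>R ?f t \<partial>lborel) \<longlonglongrightarrow> (\<integral>t. ?f t \<partial>lborel)"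
  proof (rule integral_dominated_convergence[where w = "\<lambda>t. norm (?f t)"])
    show "integrable lborel (\<lambda>t. norm (?f t))" using int by (rule integrable_norm)
    show "AE t in lborel. (\<lambda>i. indicator {-R i..R i} t *\<^sub>R ?f t) \<longlonglongrightarrow> ?f t"
    proof (rule AE_I2)
      fix t :: real
      obtain i0 :: nat where "\<bar>t\<bar> \<le> real i0" using real_arch_simple by blast
      then have "indicator {-R i..R i} t *\<^sub>R ?f t = ?f t" if "i \<ge> i0" for i using R(1)[of i] that by (auto simp: indicator_def abs_le_iff)
      then have "\<forall>\<^sub>F i in sequentially. indicator {-R i..R i} t *\<^sub>R ?f t = ?f t" unfolding eventually_sequentially by blast
      then show "(\<lambda>i. indicator {-R i..R i} t *\<^sub>R ?f t) \<longlonglongrightarrow> ?f t" by (rule tendsto_eventually)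
    qed
    show "AE t in lborel. norm (indicator {-R i..R i} t *\<^sub>R ?f t) \<le> norm (?f t)" for i
      by (rule AE_I2) (auto split: split_indicator)
  qed (use \<eta> in measurable)
  have "(\<integral>t. indicator {-R i..R i} t *\<^sub>R ?f t \<partial>lborel) = integral {-R i..R i} (\<lambda>x. k (Complex x 0) * G (Complex x 0))" for i
    using set_borel_integral_eq_integral(2)[of "{-R i..R i}" ?f] integrable_mult_indicator[OF _ int, of "{-R i..R i}"]
    by (simp add: set_integrable_def set_lebesgue_integral_def kf)
  then have "G z = (\<integral>t. ?f t \<partial>lborel)" using LIMSEQ_unique[OF lim1] lim2 by simp
  then show "F (z + \<i> * complex_of_real \<eta>) = (\<integral>t. ?f t \<partial>lborel)" by (simp add: G_def)
qed

section \<open>Boundary moduli and Smirnov's inequality\<close>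

text \<open>
  Uniform integrability of the slices is the property that lets Poisson integrals pass to the boundary limit. The
  class contains \<open>H^p\<close> for \<open>p > 1\<close> and the bounded functions, and multiplication by bounded functions preserves it, so
  it treats both kinds of factors on the same footing.
\<close>

definition uniformly_integrable_hol :: "(complex \<Rightarrow> complex) \<Rightarrow> bool" where
  "uniformly_integrable_hol F \<longleftrightarrow> F holomorphic_on {z. Im z > 0} \<and>
     (\<forall>e>0. \<exists>N\<ge>0. \<forall>y>0. (\<integral>\<^sup>+x. ennreal (cmod (F (Complex x y)) - N) \<partial>lborel) \<le> ennreal e)"

text \<open>
  Only the modulus is required to have radial limits: for outer functions this is immediate from
  \<open>poisson_radial_limit\<close>, whereas the existence of their own radial limits is a deeper fact.
\<close>

definition radial_modulus :: "(complex \<Rightarrow> complex) \<Rightarrow> (real \<Rightarrow> real) \<Rightarrow> bool" where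
  "radial_modulus F w \<longleftrightarrow> w \<in> borel_measurable borel \<and> (\<forall>t. w t \<ge> 0) \<and>
     (AE x in lborel. ((\<lambda>y. cmod (F (Complex x y))) \<longlongrightarrow> w x) (at_right 0))"

lemma filterlim_at_right_inverse_Suc: "filterlim (\<lambda>n. inverse (real (Suc n))) (at_right 0) sequentially"
  using LIMSEQ_inverse_real_of_nat by (auto simp: filterlim_at)

lemma uniformly_integrable_hol_bounded:
  assumes "F holomorphic_on {z. Im z > 0}" "\<And>z. Im z > 0 \<Longrightarrow> cmod (F z) \<le> c"
  shows "uniformly_integrable_hol F"
  unfolding uniformly_integrable_hol_def
proof (intro conjI allI impI assms(1) exI[of _ "max c 0"])
  fix e y :: real assume "e > 0" "y > 0"
  then have "ennreal (cmod (F (Complex x y)) - max c 0) = 0" for x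
    using assms(2)[of "Complex x y"] by (intro ennreal_neg) simp
  then show "(\<integral>\<^sup>+x. ennreal (cmod (F (Complex x y)) - max c 0) \<partial>lborel) \<le> ennreal e" by simp
qed simp

lemma uniformly_integrable_hol_mult:
  assumes F: "uniformly_integrable_hol F" and E: "E holomorphic_on {z. Im z > 0}"
    and c: "\<And>z. Im z > 0 \<Longrightarrow> cmod (E z) \<le> c"
  shows "uniformly_integrable_hol (\<lambda>z. E z * F z)"
  unfolding uniformly_integrable_hol_def
proof (intro conjI allI impI)
  have Fh: "F holomorphic_on {z. Im z > 0}" using F by (simp add: uniformly_integrable_hol_def)
  show "(\<lambda>z. E z * F z) holomorphic_on {z. Im z > 0}" by (intro holomorphic_intros E Fh)
  fix e :: real assume e: "e > 0"
  define k where "k = max c 1"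
  have k: "k \<ge> 1" "\<And>z. Im z > 0 \<Longrightarrow> cmod (E z) \<le> k" using c by (auto simp: k_def intro: max.coboundedI1)
  have "e / k > 0" using e k by simp
  then obtain N where N: "N \<ge> 0" "\<And>y. y > 0 \<Longrightarrow> (\<integral>\<^sup>+x. ennreal (cmod (F (Complex x y)) - N) \<partial>lborel) \<le> ennreal (e / k)"
    using F unfolding uniformly_integrable_hol_def by metis
  show "\<exists>N\<ge>0. \<forall>y>0. (\<integral>\<^sup>+x. ennreal (cmod (E (Complex x y) * F (Complex x y)) - N) \<partial>lborel) \<le> ennreal e"
  proof (intro exI[of _ "k * N"] conjI allI impI)
    show "0 \<le> k * N" using k N by simp
    fix y :: real assume y: "y > 0"
    note [measurable] = measurable_upper_line[OF Fh y]
    have "(\<integral>\<^sup>+x. ennreal (cmod (E (Complex x y) * F (Complex x y)) - k * N) \<partial>lborel)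
       \<le> (\<integral>\<^sup>+x. ennreal k * ennreal (cmod (F (Complex x y)) - N) \<partial>lborel)"
    proof (rule nn_integral_mono)
      fix x
      have "cmod (E (Complex x y) * F (Complex x y)) \<le> k * cmod (F (Complex x y))"
        unfolding norm_mult using k(2)[of "Complex x y"] y by (intro mult_right_mono) auto
      then have "ennreal (cmod (E (Complex x y) * F (Complex x y)) - k * N) \<le> ennreal (k * (cmod (F (Complex x y)) - N))"
        by (intro ennreal_leI) (simp add: right_diff_distrib)
      also have "\<dots> = ennreal k * ennreal (cmod (F (Complex x y)) - N)" using k by (intro ennreal_mult') simp
      finally show "ennreal (cmod (E (Complex x y) * F (Complex x y)) - k * N) \<le> ennreal k * ennreal (cmod (F (Complex x y)) - N)" .
    qed
    also have "\<dots> = ennreal k * (\<integral>\<^sup>+x. ennreal (cmod (F (Complex x y)) - N) \<partial>lborel)" by (rule nn_integral_cmult) measurable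
    also have "\<dots> \<le> ennreal k * ennreal (e / k)" using N(2)[OF y] by (intro mult_left_mono) auto
    also have "\<dots> = ennreal e" using k e by (subst ennreal_mult'[symmetric]) auto
    finally show "(\<integral>\<^sup>+x. ennreal (cmod (E (Complex x y) * F (Complex x y)) - k * N) \<partial>lborel) \<le> ennreal e" .
  qed
qed

lemma hardy_upper_bound:
  assumes "F \<in> hardy_upper p"
  obtains M where "M \<ge> 0" "\<And>y. y > 0 \<Longrightarrow> (\<integral>\<^sup>+x. ennreal (cmod (F (Complex x y)) powr p) \<partial>lborel) \<le> ennreal M"
proof -
  let ?S = "SUP y\<in>{0<..}. \<integral>\<^sup>+x. ennreal (cmod (F (Complex x y)) powr p) \<partial>lborel"
  have fin: "?S < \<infinity>" using assms by (simp add: hardy_upper_def)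
  show ?thesis
  proof (rule that[of "enn2real ?S"])
    fix y :: real assume "y > 0"
    then have "(\<integral>\<^sup>+x. ennreal (cmod (F (Complex x y)) powr p) \<partial>lborel) \<le> ?S" by (intro SUP_upper) auto
    also have "?S = ennreal (enn2real ?S)" using fin by simp
    finally show "(\<integral>\<^sup>+x. ennreal (cmod (F (Complex x y)) powr p) \<partial>lborel) \<le> ennreal (enn2real ?S)" .
  qed simp
qed

text \<open>
  Above a level \<open>N\<close> the modulus is at most \<open>N powr (1 - p)\<close> times its \<open>p\<close>-th power.
\<close>

lemma hardy_upper_uniformly_integrable:
  assumes p: "p > 1" and F: "F \<in> hardy_upper p"
  shows "uniformly_integrable_hol F"
  unfolding uniformly_integrable_hol_def
proof (intro conjI allI impI)
  show Fh: "F holomorphic_on {z. Im z > 0}" using F by (simp add: hardy_upper_def)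
  obtain M where M: "M \<ge> 0" "\<And>y. y > 0 \<Longrightarrow> (\<integral>\<^sup>+x. ennreal (cmod (F (Complex x y)) powr p) \<partial>lborel) \<le> ennreal M"
    using hardy_upper_bound[OF F] by metis
  fix e :: real assume e: "e > 0"
  have "((\<lambda>N. M * N powr (1 - p)) \<longlongrightarrow> M * 0) at_top"
    using p by (intro tendsto_intros tendsto_neg_powr filterlim_ident) auto
  then have "\<forall>\<^sub>F N in at_top. M * N powr (1 - p) < e" using e by (intro order_tendstoD(2)) auto
  then obtain N where N: "N \<ge> 1" "M * N powr (1 - p) < e"
    by (metis (no_types, lifting) eventually_at_top_linorder linorder_le_cases)
  show "\<exists>N\<ge>0. \<forall>y>0. (\<integral>\<^sup>+x. ennreal (cmod (F (Complex x y)) - N) \<partial>lborel) \<le> ennreal e"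
  proof (intro exI[of _ N] conjI allI impI)
    show "0 \<le> N" using N by simp
    fix y :: real assume y: "y > 0"
    note [measurable] = measurable_upper_line[OF Fh y]
    have "(\<integral>\<^sup>+x. ennreal (cmod (F (Complex x y)) - N) \<partial>lborel)
       \<le> (\<integral>\<^sup>+x. ennreal (N powr (1 - p)) * ennreal (cmod (F (Complex x y)) powr p) \<partial>lborel)"
    proof (rule nn_integral_mono)
      fix x
      let ?f = "cmod (F (Complex x y))"
      have "?f - N \<le> N powr (1 - p) * ?f powr p"
      proof (cases "?f \<ge> N")
        case True
        have "?f = ?f powr (1 - p) * ?f powr p" using True N by (simp add: powr_add[symmetric])
        also have "\<dots> \<le> N powr (1 - p) * ?f powr p" using True N p by (intro mult_right_mono powr_mono2') auto
        finally show ?thesis using N by linarith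
      next
        case False
        then have "?f - N \<le> 0" by simp
        also have "0 \<le> N powr (1 - p) * ?f powr p" by simp
        finally show ?thesis .
      qed
      then show "ennreal (?f - N) \<le> ennreal (N powr (1 - p)) * ennreal (?f powr p)"
        by (simp add: ennreal_mult[symmetric] ennreal_leI)
    qed
    also have "\<dots> = ennreal (N powr (1 - p)) * (\<integral>\<^sup>+x. ennreal (cmod (F (Complex x y)) powr p) \<partial>lborel)" by (rule nn_integral_cmult) measurable
    also have "\<dots> \<le> ennreal (N powr (1 - p)) * ennreal M" using M(2)[OF y] by (intro mult_left_mono) auto
    also have "\<dots> = ennreal (M * N powr (1 - p))" using M by (simp add: ennreal_mult[symmetric] mult.commute)
    also have "\<dots> \<le> ennreal e" using N by (intro ennreal_leI) simp
    finally show "(\<integral>\<^sup>+x. ennreal (cmod (F (Complex x y)) - N) \<partial>lborel) \<le> ennreal e" .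
  qed
qed

lemma uniformly_integrable_poisson:
  assumes F: "uniformly_integrable_hol F" and z: "Im z > 0" and \<eta>: "\<eta> > 0"
  shows "integrable lborel (\<lambda>t. complex_of_real (poisson_kernel z t) * F (Complex t \<eta>))"
    and "F (z + \<i> * complex_of_real \<eta>) = (\<integral>t. complex_of_real (poisson_kernel z t) * F (Complex t \<eta>) \<partial>lborel)"
proof -
  have Fh: "F holomorphic_on {z. Im z > 0}" using F by (simp add: uniformly_integrable_hol_def)
  obtain N where N: "N \<ge> 0" "\<And>y. y > 0 \<Longrightarrow> (\<integral>\<^sup>+x. ennreal (cmod (F (Complex x y)) - N) \<partial>lborel) \<le> ennreal 1"
    using F unfolding uniformly_integrable_hol_def by (metis zero_less_one)
  note * = poisson_reproduction[OF Fh N(1) zero_le_one N(2) z \<eta>]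
  show "integrable lborel (\<lambda>t. complex_of_real (poisson_kernel z t) * F (Complex t \<eta>))"
    and "F (z + \<i> * complex_of_real \<eta>) = (\<integral>t. complex_of_real (poisson_kernel z t) * F (Complex t \<eta>) \<partial>lborel)"
    using * by auto
qed

text \<open>
  In the Poisson formula on the line of height \<open>\<eta>\<close> the modulus is cut off at a level \<open>N\<close>. The excess contributes at
  most \<open>e\<close> for every \<open>\<eta>\<close> by uniform integrability, and the bounded part converges as \<open>\<eta>\<close> tends to 0.
\<close>

theorem modulus_le_poisson_boundary:
  assumes F: "uniformly_integrable_hol F" and w: "radial_modulus F w" and z: "Im z > 0"
  shows "ennreal (cmod (F z)) \<le> nn_poisson w z"
proof -
  have Fh: "F holomorphic_on {z. Im z > 0}" using F by (simp add: uniformly_integrable_hol_def)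
  have [measurable]: "w \<in> borel_measurable borel" and wpos: "\<And>t. w t \<ge> 0" using w by (auto simp: radial_modulus_def)
  define h where "h n = inverse (real (Suc n))" for n
  have h: "h n > 0" for n by (simp add: h_def)
  note [measurable] = measurable_upper_line[OF Fh h]
  \<comment> \<open>The maximum of the Poisson kernel at z.\<close>
  define K where "K = 1 / (pi * Im z)"
  have K: "K > 0" using z by (simp add: K_def)
  show ?thesis
  proof (rule ennreal_le_epsilon)
    fix e :: real assume e: "e > 0"
    have "e / K > 0" using e K by simp
    then obtain N where N: "N \<ge> 0" "\<And>y. y > 0 \<Longrightarrow> (\<integral>\<^sup>+x. ennreal (cmod (F (Complex x y)) - N) \<partial>lborel) \<le> ennreal (e / K)"
      using F unfolding uniformly_integrable_hol_def by metis
    let ?m = "\<lambda>n t. ennreal (poisson_kernel z t) * ennreal (min (cmod (F (Complex t (h n)))) N)"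
    have le: "ennreal (cmod (F (z + \<i> * complex_of_real (h n)))) \<le> (\<integral>\<^sup>+t. ?m n t \<partial>lborel) + ennreal e" for n
    proof -
      have "ennreal (cmod (F (z + \<i> * complex_of_real (h n)))) \<le> (\<integral>\<^sup>+t. ennreal (cmod (complex_of_real (poisson_kernel z t) * F (Complex t (h n)))) \<partial>lborel)"
        unfolding uniformly_integrable_poisson(2)[OF F z h[of n]]
        by (rule integral_norm_bound_ennreal[OF uniformly_integrable_poisson(1)[OF F z h[of n]]])
      also have "\<dots> \<le> (\<integral>\<^sup>+t. ?m n t + ennreal K * ennreal (cmod (F (Complex t (h n))) - N) \<partial>lborel)"
      proof (rule nn_integral_mono)
        fix t
        let ?P = "poisson_kernel z t" and ?f = "cmod (F (Complex t (h n)))"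
        have P: "0 \<le> ?P" "?P \<le> K" using poisson_kernel_nonneg poisson_kernel_le z by (auto simp: K_def)
        have "ennreal (cmod (complex_of_real ?P * F (Complex t (h n)))) = ennreal ?P * ennreal ?f"
          using P by (simp add: norm_mult ennreal_mult)
        also have "ennreal ?f = ennreal (min ?f N) + ennreal (max 0 (?f - N))"
        proof -
          have "?f = min ?f N + max 0 (?f - N)" by simp
          then have "ennreal ?f = ennreal (min ?f N + max 0 (?f - N))" by (rule arg_cong)
          also have "\<dots> = ennreal (min ?f N) + ennreal (max 0 (?f - N))" using N(1) by (intro ennreal_plus) auto
          finally show ?thesis .
        qed
        also have "ennreal (max 0 (?f - N)) = ennreal (?f - N)" by (auto simp: max_def ennreal_neg)
        also have "ennreal ?P * (ennreal (min ?f N) + ennreal (?f - N)) \<le> ?m n t + ennreal K * ennreal (?f - N)"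
          unfolding distrib_left using P by (intro add_mono mult_right_mono ennreal_leI) auto
        finally show "ennreal (cmod (complex_of_real ?P * F (Complex t (h n)))) \<le> ?m n t + ennreal K * ennreal (?f - N)" .
      qed
      also have "\<dots> = (\<integral>\<^sup>+t. ?m n t \<partial>lborel) + ennreal K * (\<integral>\<^sup>+t. ennreal (cmod (F (Complex t (h n))) - N) \<partial>lborel)"
        by (subst nn_integral_add) (auto simp: nn_integral_cmult)
      also have "\<dots> \<le> (\<integral>\<^sup>+t. ?m n t \<partial>lborel) + ennreal K * ennreal (e / K)"
        using N(2)[OF h] by (intro add_left_mono mult_left_mono) auto
      also have "ennreal K * ennreal (e / K) = ennreal e" using K e by (subst ennreal_mult'[symmetric]) auto
      finally show ?thesis .
    qed
    have lim: "(\<lambda>n. \<integral>\<^sup>+t. ?m n t \<partial>lborel) \<longlonglongrightarrow> nn_poisson (\<lambda>t. min (w t) N) z"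
    proof (rule nn_integral_dominated_convergence[where w = "\<lambda>t. ennreal (poisson_kernel z t) * ennreal N"])
      show "AE t in lborel. ?m n t \<le> ennreal (poisson_kernel z t) * ennreal N" for n
        by (intro AE_I2 mult_left_mono ennreal_leI) auto
      show "(\<integral>\<^sup>+t. ennreal (poisson_kernel z t) * ennreal N \<partial>lborel) < \<infinity>"
        by (subst nn_integral_multc) (auto simp: nn_integral_poisson_kernel z)
      have "AE x in lborel. ((\<lambda>y. cmod (F (Complex x y))) \<longlongrightarrow> w x) (at_right 0)" using w by (simp add: radial_modulus_def)
      then show "AE t in lborel. (\<lambda>n. ?m n t) \<longlonglongrightarrow> ennreal (poisson_kernel z t) * ennreal (min (w t) N)"
      proof eventually_elim
        case (elim t)
        have "(\<lambda>n. cmod (F (Complex t (h n)))) \<longlonglongrightarrow> w t"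
          unfolding h_def by (rule filterlim_compose[OF elim filterlim_at_right_inverse_Suc])
        then have "(\<lambda>n. ennreal (poisson_kernel z t * min (cmod (F (Complex t (h n)))) N)) \<longlonglongrightarrow> ennreal (poisson_kernel z t * min (w t) N)"
          by (intro tendsto_intros)
        then show ?case using poisson_kernel_nonneg[OF z, of t] N(1) wpos by (simp add: ennreal_mult)
      qed
    qed measurable
    have "(\<lambda>n. F (z + \<i> * complex_of_real (h n))) \<longlonglongrightarrow> F z"
    proof (rule continuous_on_tendsto_compose[OF holomorphic_on_imp_continuous_on[OF Fh]])
      have "h \<longlonglongrightarrow> 0" unfolding h_def by (rule LIMSEQ_inverse_real_of_nat)
      then have "(\<lambda>n. z + \<i> * complex_of_real (h n)) \<longlonglongrightarrow> z + \<i> * complex_of_real 0" by (intro tendsto_intros)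
      then show "(\<lambda>n. z + \<i> * complex_of_real (h n)) \<longlonglongrightarrow> z" by simp
    qed (use z h in \<open>auto simp: add_pos_pos\<close>)
    then have lhs: "(\<lambda>n. ennreal (cmod (F (z + \<i> * complex_of_real (h n))))) \<longlonglongrightarrow> ennreal (cmod (F z))" by (intro tendsto_intros)
    have "ennreal (cmod (F z)) \<le> nn_poisson (\<lambda>t. min (w t) N) z + ennreal e"
      by (rule LIMSEQ_le[OF lhs tendsto_add[OF lim tendsto_const]]) (use le in auto)
    also have "\<dots> \<le> nn_poisson w z + ennreal e"
      by (intro add_right_mono nn_integral_mono mult_left_mono ennreal_leI) auto
    finally show "ennreal (cmod (F z)) \<le> nn_poisson w z + ennreal e" .
  qed
qed

text \<open>
  By Fatou's lemma the excess of the boundary modulus over some level is integrable, and a constant is integrable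
  against the kernel.
\<close>

lemma poisson_integrable_radial_modulus:
  assumes F: "uniformly_integrable_hol F" and w: "radial_modulus F w"
  shows "poisson_integrable w"
proof -
  have Fh: "F holomorphic_on {z. Im z > 0}" using F by (simp add: uniformly_integrable_hol_def)
  have [measurable]: "w \<in> borel_measurable borel" and wpos: "\<And>t. w t \<ge> 0" using w by (auto simp: radial_modulus_def)
  define h where "h n = inverse (real (Suc n))" for n
  have h: "h n > 0" for n by (simp add: h_def)
  note [measurable] = measurable_upper_line[OF Fh h]
  obtain N where N: "N \<ge> 0" "\<And>y. y > 0 \<Longrightarrow> (\<integral>\<^sup>+x. ennreal (cmod (F (Complex x y)) - N) \<partial>lborel) \<le> ennreal 1"
    using F unfolding uniformly_integrable_hol_def by (metis zero_less_one)
  have "AE x in lborel. ((\<lambda>y. cmod (F (Complex x y))) \<longlongrightarrow> w x) (at_right 0)" using w by (simp add: radial_modulus_def)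
  then have ae: "AE x in lborel. ennreal (w x - N) = liminf (\<lambda>n. ennreal (cmod (F (Complex x (h n))) - N))"
  proof eventually_elim
    case (elim t)
    have "(\<lambda>n. cmod (F (Complex t (h n)))) \<longlonglongrightarrow> w t"
      unfolding h_def by (rule filterlim_compose[OF elim filterlim_at_right_inverse_Suc])
    then have "(\<lambda>n. ennreal (cmod (F (Complex t (h n))) - N)) \<longlonglongrightarrow> ennreal (w t - N)" by (intro tendsto_intros)
    then show ?case by (intro lim_imp_Liminf[symmetric]) auto
  qed
  have "(\<integral>\<^sup>+x. ennreal (w x - N) \<partial>lborel) = (\<integral>\<^sup>+x. liminf (\<lambda>n. ennreal (cmod (F (Complex x (h n))) - N)) \<partial>lborel)"
    using ae by (rule nn_integral_cong_AE)
  also have "\<dots> \<le> liminf (\<lambda>n. \<integral>\<^sup>+x. ennreal (cmod (F (Complex x (h n))) - N) \<partial>lborel)"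
    by (rule nn_integral_liminf) measurable
  also have "\<dots> \<le> limsup (\<lambda>n. \<integral>\<^sup>+x. ennreal (cmod (F (Complex x (h n))) - N) \<partial>lborel)"
    by (rule Liminf_le_Limsup) simp
  also have "\<dots> \<le> 1" using N(2)[OF h] by (intro Limsup_bounded) auto
  finally have fin: "(\<integral>\<^sup>+x. ennreal (w x - N) \<partial>lborel) \<le> 1" .
  show ?thesis
  proof (rule poisson_integrableI_nn[where z = \<i>])
    have "(\<integral>\<^sup>+t. ennreal (poisson_kernel \<i> t * \<bar>w t\<bar>) \<partial>lborel)
      \<le> (\<integral>\<^sup>+t. ennreal N * ennreal (poisson_kernel \<i> t) + ennreal (w t - N) \<partial>lborel)"
    proof (rule nn_integral_mono)
      fix t
      let ?P = "poisson_kernel \<i> t"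
      have a: "1 / pi \<le> (1::real)" using pi_gt3 by simp
      have b: "?P \<le> 1 / pi" using poisson_kernel_le[of \<i> t] by simp
      have P: "0 \<le> ?P" "?P \<le> 1" using poisson_kernel_nonneg[of \<i> t] order_trans[OF b a] by auto
      have "w t \<le> N + max 0 (w t - N)" by simp
      then have "?P * w t \<le> ?P * (N + max 0 (w t - N))" using P by (intro mult_left_mono) auto
      also have "\<dots> \<le> N * ?P + max 0 (w t - N)" using mult_right_mono[OF P(2), of "max 0 (w t - N)"] by (simp add: algebra_simps)
      finally have "ennreal (?P * \<bar>w t\<bar>) \<le> ennreal (N * ?P + max 0 (w t - N))" using wpos by (intro ennreal_leI) simp
      also have "\<dots> = ennreal N * ennreal ?P + ennreal (max 0 (w t - N))" using N P by (simp add: ennreal_mult)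
      also have "ennreal (max 0 (w t - N)) = ennreal (w t - N)" by (auto simp: max_def ennreal_neg)
      finally show "ennreal (?P * \<bar>w t\<bar>) \<le> ennreal N * ennreal ?P + ennreal (w t - N)" .
    qed
    also have "\<dots> = ennreal N * 1 + (\<integral>\<^sup>+x. ennreal (w x - N) \<partial>lborel)"
      by (subst nn_integral_add) (auto simp: nn_integral_cmult nn_integral_poisson_kernel)
    also have "\<dots> \<le> ennreal N * 1 + 1" using fin by (intro add_left_mono)
    also have "\<dots> < \<infinity>" by simp
    finally show "(\<integral>\<^sup>+t. ennreal (poisson_kernel \<i> t * \<bar>w t\<bar>) \<partial>lborel) < \<infinity>" .
  qed auto
qed

lemma radial_modulus_outer:
  assumes u: "poisson_integrable u"
  shows "radial_modulus (outer u) (\<lambda>t. exp (u t))"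
  unfolding radial_modulus_def
proof (intro conjI)
  note [measurable] = poisson_integrable_measurable[OF u]
  show "(\<lambda>t. exp (u t)) \<in> borel_measurable borel" by measurable
  show "AE x in lborel. ((\<lambda>y. cmod (outer u (Complex x y))) \<longlongrightarrow> exp (u x)) (at_right 0)"
    using poisson_radial_limit[OF u]
  proof eventually_elim
    case (elim x)
    then have "((\<lambda>y. exp (poisson u (Complex x y))) \<longlongrightarrow> exp (u x)) (at_right 0)" by (rule tendsto_exp)
    moreover have "\<forall>\<^sub>F y in at_right (0::real). exp (poisson u (Complex x y)) = cmod (outer u (Complex x y))"
      using eventually_at_right_less by eventually_elim (simp add: norm_outer[OF u])
    ultimately show ?case by (rule Lim_transform_eventually)
  qed
qed auto

lemma radial_modulus_mult:
  assumes "radial_modulus F f" "radial_modulus G g"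
  shows "radial_modulus (\<lambda>z. F z * G z) (\<lambda>t. f t * g t)"
proof -
  have "AE x in lborel. ((\<lambda>y. cmod (F (Complex x y))) \<longlongrightarrow> f x) (at_right 0)"
    "AE x in lborel. ((\<lambda>y. cmod (G (Complex x y))) \<longlongrightarrow> g x) (at_right 0)" using assms by (auto simp: radial_modulus_def)
  then have "AE x in lborel. ((\<lambda>y. cmod (F (Complex x y) * G (Complex x y))) \<longlongrightarrow> f x * g x) (at_right 0)"
    unfolding norm_mult by eventually_elim (rule tendsto_mult)
  then show ?thesis using assms by (auto simp: radial_modulus_def)
qed

lemma norm_outer_le:
  assumes "poisson_integrable u" "Im z > 0" "\<And>t. u t \<le> c"
  shows "cmod (outer u z) \<le> exp c"
  using poisson_mono[OF assms(1) poisson_integrable_const assms(2,3)] assms(1,2)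
  by (simp add: norm_outer poisson_const)

lemma outer_uminus:
  assumes "poisson_integrable u" "Im z > 0"
  shows "outer (\<lambda>t. - u t) z = inverse (outer u z)"
proof -
  have "outer (\<lambda>t. - u t) z * outer u z = outer (\<lambda>t. - u t + u t) z"
    using outer_add[OF poisson_integrable_uminus[OF assms(1)] assms(1,2)] by simp
  also have "\<dots> = 1" by (simp add: outer_def schwarz_integral_def)
  finally show ?thesis using inverse_unique[of "outer u z" "outer (\<lambda>t. - u t) z"] by (simp add: mult.commute)
qed

lemma poisson_tendsto_zero:
  assumes g: "poisson_integrable g" and z: "Im z > 0"
    and [measurable]: "\<And>n. v n \<in> borel_measurable borel" and le: "\<And>n t. \<bar>v n t\<bar> \<le> g t"
    and lim: "\<And>t. (\<lambda>n. v n t) \<longlonglongrightarrow> 0"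
  shows "(\<lambda>n. poisson (v n) z) \<longlonglongrightarrow> 0"
proof -
  have "(\<lambda>n. \<integral>t. poisson_kernel z t * v n t \<partial>lborel) \<longlonglongrightarrow> (\<integral>t. poisson_kernel z t * 0 \<partial>lborel)"
  proof (rule integral_dominated_convergence)
    show "integrable lborel (\<lambda>t. poisson_kernel z t * g t)" by (rule iffD1[OF poisson_integrable_iff[OF z] g])
    show "AE t in lborel. norm (poisson_kernel z t * v n t) \<le> poisson_kernel z t * g t" for n
      using le poisson_kernel_nonneg[OF z] by (intro AE_I2) (simp add: abs_mult mult_left_mono)
    show "AE t in lborel. (\<lambda>n. poisson_kernel z t * v n t) \<longlonglongrightarrow> poisson_kernel z t * 0"
      by (intro AE_I2 tendsto_mult tendsto_const lim)
  qed measurable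
  then show ?thesis by (simp add: poisson_def)
qed

text \<open>
  If the quotient were known to be uniformly integrable, this would be \<open>modulus_le_poisson_boundary\<close>. It is made so by
  two outer multipliers of modulus at most 1, with exponents \<open>- v n\<close> and \<open>- w n\<close>. The first lowers the boundary modulus of
  \<open>F\<close> below \<open>n + 1\<close>, which bounds the product throughout the half-plane. The second keeps the quotient by \<open>outer u\<close>
  below \<open>exp n\<close>. What remains is a bounded function times \<open>G\<close>, and both multipliers tend to 1 as \<open>n\<close> grows.
\<close>

theorem smirnov_inequality:
  assumes F: "uniformly_integrable_hol F" and f: "radial_modulus F f"
    and G: "uniformly_integrable_hol G" and g: "radial_modulus G g"
    and u: "poisson_integrable u" and z: "Im z > 0"
  shows "ennreal (cmod (F z * G z / outer u z))
      \<le> nn_poisson (\<lambda>t. f t * g t * exp (- u t)) z" (is "_ \<le> ?R")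
proof -
  have [measurable]: "f \<in> borel_measurable borel" "g \<in> borel_measurable borel" "u \<in> borel_measurable borel"
    and fpos: "\<And>t. f t \<ge> 0" and gpos: "\<And>t. g t \<ge> 0"
    using f g poisson_integrable_measurable[OF u] by (auto simp: radial_modulus_def)
  have fi: "poisson_integrable f" by (rule poisson_integrable_radial_modulus[OF F f])
  define v where "v n t = ln (1 + f t / real (Suc n))" for n t
  define w where "w n t = max 0 (- u t - real n)" for n t
  have vb: "0 \<le> v n t" "v n t \<le> f t" for n t
  proof -
    show "0 \<le> v n t" unfolding v_def using fpos by (intro ln_ge_zero) simp
    have "v n t \<le> f t / real (Suc n)" unfolding v_def using fpos by (intro ln_add_one_self_le_self) simp
    also have "\<dots> \<le> f t / 1" using fpos by (intro divide_left_mono) auto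
    finally show "v n t \<le> f t" by simp
  qed
  have wb: "0 \<le> w n t" "w n t \<le> \<bar>u t\<bar>" for n t by (auto simp: w_def)
  have [measurable]: "v n \<in> borel_measurable borel" "w n \<in> borel_measurable borel" for n
    unfolding v_def w_def by measurable
  have vi: "poisson_integrable (v n)" for n by (rule poisson_integrable_bound[OF fi]) (use vb in auto)
  have wi: "poisson_integrable (w n)" for n by (rule poisson_integrable_bound[OF poisson_integrable_abs[OF u]]) (use wb in auto)
  have wui: "poisson_integrable (\<lambda>t. - w n t + - u t)" for n
    using poisson_integrable_add[OF poisson_integrable_uminus[OF wi] poisson_integrable_uminus[OF u]] .
  define A where "A n = (\<lambda>z. outer (\<lambda>t. - v n t) z * F z)" for n
  have vout: "outer (\<lambda>t. - v n t) holomorphic_on {z. Im z > 0}" for n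
    by (rule holomorphic_outer[OF poisson_integrable_uminus[OF vi]])
  have vle: "cmod (outer (\<lambda>t. - v n t) z) \<le> 1" if "Im z > 0" for n z
    using norm_outer_le[OF poisson_integrable_uminus[OF vi] that, of n 0] vb by simp
  have Au: "uniformly_integrable_hol (A n)" for n
    unfolding A_def by (rule uniformly_integrable_hol_mult[OF F vout vle])
  have Am: "radial_modulus (A n) (\<lambda>t. exp (- v n t) * f t)" for n
    unfolding A_def by (rule radial_modulus_mult[OF radial_modulus_outer[OF poisson_integrable_uminus[OF vi]] f])
  have Ah: "A n holomorphic_on {z. Im z > 0}" for n using Au by (simp add: uniformly_integrable_hol_def)
  have evf: "exp (- v n t) * f t \<le> real (Suc n)" for n t
  proof -
    have "1 + f t / real (Suc n) > 0" using fpos by (intro add_pos_nonneg) auto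
    then have "exp (- v n t) * f t = f t / (1 + f t / real (Suc n))" by (simp add: v_def exp_minus field_simps)
    also have "\<dots> \<le> real (Suc n)" using fpos[of t] by (simp add: divide_simps add_pos_nonneg)
    finally show ?thesis .
  qed
  have Ab: "cmod (A n z) \<le> real (Suc n)" if z: "Im z > 0" for n z
  proof -
    have "ennreal (cmod (A n z)) \<le> nn_poisson (\<lambda>t. exp (- v n t) * f t) z"
      by (rule modulus_le_poisson_boundary[OF Au Am z])
    also have "\<dots> \<le> nn_poisson (\<lambda>_. real (Suc n)) z"
      by (intro nn_integral_mono mult_left_mono ennreal_leI evf) auto
    also have "\<dots> = ennreal (real (Suc n))" by (subst nn_integral_multc) (simp_all add: nn_integral_poisson_kernel z)
    finally show ?thesis by (simp del: of_nat_Suc)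
  qed
  define D where "D n = outer (\<lambda>t. - w n t + - u t)" for n
  have Db: "cmod (D n z) \<le> exp (real n)" if "Im z > 0" for n z
    unfolding D_def by (rule norm_outer_le[OF wui that]) (simp add: w_def)
  have DA: "(\<lambda>z. D n z * A n z) holomorphic_on {z. Im z > 0}" for n
    unfolding D_def by (intro holomorphic_intros Ah holomorphic_outer[OF wui])
  have DAb: "cmod (D n z * A n z) \<le> exp (real n) * real (Suc n)" if "Im z > 0" for n z
    unfolding norm_mult using Ab Db that by (intro mult_mono) auto
  have DAG: "uniformly_integrable_hol (\<lambda>z. D n z * A n z * G z)" for n
    by (rule uniformly_integrable_hol_mult[OF G DA]) (rule DAb)
  have key: "ennreal (cmod (D n z * A n z * G z)) \<le> ?R" for n
  proof -
    have "ennreal (cmod (D n z * A n z * G z))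
      \<le> nn_poisson (\<lambda>t. exp (- w n t + - u t) * (exp (- v n t) * f t) * g t) z"
      by (rule modulus_le_poisson_boundary[OF DAG _ z])
         (intro radial_modulus_mult g Am, unfold D_def, rule radial_modulus_outer[OF wui])
    also have "\<dots> \<le> ?R"
    proof (intro nn_integral_mono mult_left_mono ennreal_leI)
      fix t
      have "exp (- w n t + - u t) * (exp (- v n t) * f t) * g t = (exp (- w n t) * exp (- v n t)) * (f t * g t * exp (- u t))"
        by (simp only: exp_add mult_ac)
      also have "\<dots> \<le> 1 * (f t * g t * exp (- u t))"
        using vb wb fpos gpos by (intro mult_right_mono mult_le_one) auto
      finally show "exp (- w n t + - u t) * (exp (- v n t) * f t) * g t \<le> f t * g t * exp (- u t)" by simp
    qed simp
    finally show ?thesis .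
  qed
  have eq: "cmod (D n z * A n z * G z) = exp (- poisson (w n) z) * exp (- poisson (v n) z) * cmod (F z * G z / outer u z)" for n
  proof -
    have "D n z = outer (\<lambda>t. - w n t) z * inverse (outer u z)"
      unfolding D_def using outer_add[OF poisson_integrable_uminus[OF wi] poisson_integrable_uminus[OF u] z]
      by (simp add: outer_uminus[OF u z])
    then have "D n z * A n z * G z = outer (\<lambda>t. - w n t) z * outer (\<lambda>t. - v n t) z * (F z * G z / outer u z)"
      by (simp add: A_def divide_inverse mult_ac)
    then show ?thesis
      by (simp add: norm_mult norm_divide norm_outer poisson_integrable_uminus vi wi z poisson_uminus)
  qed
  have limw: "(\<lambda>n. poisson (w n) z) \<longlonglongrightarrow> 0"
  proof (rule poisson_tendsto_zero[OF poisson_integrable_abs[OF u] z])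
    fix t
    obtain n0 :: nat where "- u t \<le> real n0" using real_arch_simple by blast
    then have "w n t = 0" if "n \<ge> n0" for n using that by (simp add: w_def)
    then show "(\<lambda>n. w n t) \<longlonglongrightarrow> 0" by (intro tendsto_eventually) (auto simp: eventually_sequentially)
  qed (use wb in auto)
  have limv: "(\<lambda>n. poisson (v n) z) \<longlonglongrightarrow> 0"
  proof (rule poisson_tendsto_zero[OF fi z])
    fix t
    have "(\<lambda>n. ln (1 + f t * inverse (real (Suc n)))) \<longlonglongrightarrow> ln (1 + f t * 0)"
      by (intro tendsto_intros LIMSEQ_inverse_real_of_nat) auto
    then show "(\<lambda>n. v n t) \<longlonglongrightarrow> 0" by (simp add: v_def divide_inverse)
  qed (use vb in auto)
  have "(\<lambda>n. exp (- poisson (w n) z) * exp (- poisson (v n) z) * cmod (F z * G z / outer u z))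
      \<longlonglongrightarrow> exp (- 0) * exp (- 0) * cmod (F z * G z / outer u z)"
    by (intro tendsto_intros limw limv)
  then have "(\<lambda>n. ennreal (cmod (D n z * A n z * G z))) \<longlonglongrightarrow> ennreal (cmod (F z * G z / outer u z))"
    unfolding eq by (intro tendsto_ennrealI) simp
  then show ?thesis by (rule LIMSEQ_le_const2) (use key in auto)
qed

text \<open>
  Dividing \<open>F\<close> by the outer function of modulus \<open>w + d\<close> gives a function bounded by 1, so \<open>ln |F z|\<close> is at most the
  Poisson integral of \<open>ln (w + d)\<close>. As \<open>d\<close> decreases to 0 this bounds the negative part of \<open>ln w\<close> in the mean,
  because \<open>F z\<close> is not zero.
\<close>

theorem log_modulus_poisson_integrable:
  assumes F: "uniformly_integrable_hol F" and w: "radial_modulus F w"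
    and z: "Im z > 0" and nz: "F z \<noteq> 0"
  shows "AE t in lborel. w t > 0" and "poisson_integrable (\<lambda>t. ln (w t))"
proof -
  have [measurable]: "w \<in> borel_measurable borel" and wpos: "\<And>t. w t \<ge> 0" using w by (auto simp: radial_modulus_def)
  have wi: "poisson_integrable w" by (rule poisson_integrable_radial_modulus[OF F w])
  define d where "d n = inverse (real (Suc n))" for n
  have d: "d n > 0" "d n \<le> 1" for n by (simp_all add: d_def inverse_le_1_iff)
  define u where "u n t = ln (w t + d n)" for n t
  have [measurable]: "u n \<in> borel_measurable borel" for n unfolding u_def by measurable
  have wd: "w t + d n > 0" for n t using wpos d by (simp add: add_nonneg_pos)
  have ui: "poisson_integrable (u n)" for n
  proof (rule poisson_integrable_bound[OF poisson_integrable_add[OF wi poisson_integrable_const[of "1 + \<bar>ln (d n)\<bar>"]]])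
    fix t
    have "u n t \<le> w t + d n" unfolding u_def using ln_le_minus_one[OF wd[of t n]] by simp
    moreover have "u n t \<ge> ln (d n)" unfolding u_def using wpos[of t] d[of n] wd[of t n] by (subst ln_le_cancel_iff) auto
    ultimately show "\<bar>u n t\<bar> \<le> w t + (1 + \<bar>ln (d n)\<bar>)" using d[of n] wpos[of t] by linarith
  qed measurable
  have lnF: "ln (cmod (F z)) \<le> poisson (u n) z" for n
  proof -
    have nui: "poisson_integrable (\<lambda>t. - u n t)" by (rule poisson_integrable_uminus[OF ui])
    have b: "cmod (outer (\<lambda>t. - u n t) z) \<le> exp (- ln (d n))" if "Im z > 0" for z
    proof (rule norm_outer_le[OF nui that])
      fix t show "- u n t \<le> - ln (d n)" unfolding u_def using wpos[of t] d[of n] wd[of t n] by simp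
    qed
    have "ennreal (cmod (outer (\<lambda>t. - u n t) z * F z)) \<le> nn_poisson (\<lambda>t. exp (- u n t) * w t) z"
      by (rule modulus_le_poisson_boundary[OF uniformly_integrable_hol_mult[OF F holomorphic_outer[OF nui] b]
            radial_modulus_mult[OF radial_modulus_outer[OF nui] w] z])
    also have "\<dots> \<le> (\<integral>\<^sup>+t. ennreal (poisson_kernel z t) * ennreal 1 \<partial>lborel)"
    proof (intro nn_integral_mono mult_left_mono ennreal_leI)
      fix t
      have "exp (- u n t) * w t = w t / (w t + d n)" unfolding u_def using wd[of t n] by (simp add: exp_minus field_simps)
      also have "\<dots> \<le> 1" using wd[of t n] d[of n] by simp
      finally show "exp (- u n t) * w t \<le> 1" .
    qed simp
    also have "\<dots> = 1" by (simp add: nn_integral_poisson_kernel z)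
    finally have "cmod (outer (\<lambda>t. - u n t) z * F z) \<le> 1" by simp
    then have "cmod (F z) \<le> exp (poisson (u n) z)"
      by (simp add: norm_mult norm_outer nui z poisson_uminus exp_minus field_simps)
    then show ?thesis using nz by (metis exp_le_cancel_iff exp_ln zero_less_norm_iff)
  qed
  \<comment> \<open>Increasing in n, with limit ln (w + 1) - ln w, or infinity where w vanishes.\<close>
  define h where "h n t = u 0 t - u n t" for n t
  have hpos: "h n t \<ge> 0" for n t unfolding h_def u_def using wd[of t n] wd[of t 0] d(2)[of n] by (simp add: d_def)
  have hi: "poisson_integrable (h n)" for n unfolding h_def by (intro poisson_integrable_diff ui)
  have [measurable]: "h n \<in> borel_measurable borel" for n unfolding h_def by measurable
  define C where "C = poisson (u 0) z - ln (cmod (F z))"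
  have hint: "(\<integral>\<^sup>+t. ennreal (poisson_kernel z t * h n t) \<partial>lborel) \<le> ennreal C" for n
  proof -
    have "(\<integral>\<^sup>+t. ennreal (poisson_kernel z t * h n t) \<partial>lborel) = ennreal (poisson (h n) z)"
      unfolding poisson_def using hi[of n] hpos poisson_kernel_nonneg[OF z]
      by (intro nn_integral_eq_integral) (auto simp: poisson_integrable_iff[OF z])
    also have "poisson (h n) z = poisson (u 0) z - poisson (u n) z"
      unfolding h_def using poisson_add[OF ui[of 0] poisson_integrable_uminus[OF ui[of n]] z] by (simp add: poisson_uminus)
    also have "ennreal \<dots> \<le> ennreal C" unfolding C_def using lnF[of n] by (intro ennreal_leI) simp
    finally show ?thesis .
  qed
  let ?L = "\<lambda>t. liminf (\<lambda>n. ennreal (poisson_kernel z t * h n t))"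
  have "(\<integral>\<^sup>+t. ?L t \<partial>lborel) \<le> liminf (\<lambda>n. \<integral>\<^sup>+t. ennreal (poisson_kernel z t * h n t) \<partial>lborel)"
    by (rule nn_integral_liminf) measurable
  also have "\<dots> \<le> limsup (\<lambda>n. \<integral>\<^sup>+t. ennreal (poisson_kernel z t * h n t) \<partial>lborel)" by (rule Liminf_le_Limsup) simp
  also have "\<dots> \<le> ennreal C" using hint by (intro Limsup_bounded) auto
  finally have Lint: "(\<integral>\<^sup>+t. ?L t \<partial>lborel) \<le> ennreal C" .
  then have "(\<integral>\<^sup>+t. ?L t \<partial>lborel) \<noteq> \<infinity>" by (auto simp: top_unique)
  then have Lfin: "AE t in lborel. ?L t \<noteq> \<infinity>" by (intro nn_integral_PInf_AE) auto
  have Linf: "?L t = \<infinity>" if "w t = 0" for t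
  proof -
    have "filterlim (\<lambda>n. ln (real (Suc n))) at_top sequentially"
      by (rule filterlim_compose[OF ln_at_top]) (simp add: filterlim_Suc filterlim_compose[OF filterlim_real_sequentially] del: of_nat_Suc)
    then have "filterlim (\<lambda>n. poisson_kernel z t * ln (real (Suc n))) at_top sequentially"
      by (rule filterlim_tendsto_pos_mult_at_top[OF tendsto_const poisson_kernel_pos[OF z]])
    moreover have "ln (real (Suc n)) = h n t" for n unfolding h_def u_def d_def that by (simp add: ln_inverse del: of_nat_Suc)
    ultimately have "filterlim (\<lambda>n. poisson_kernel z t * h n t) at_top sequentially" by simp
    then have "(\<lambda>n. ennreal (poisson_kernel z t * h n t)) \<longlonglongrightarrow> \<infinity>" by (simp add: ennreal_tendsto_top_eq_at_top)
    then show ?thesis by (intro lim_imp_Liminf) auto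
  qed
  show ae: "AE t in lborel. w t > 0"
    using Lfin
  proof eventually_elim
    case (elim t)
    then have "w t \<noteq> 0" using Linf[of t] by blast
    then show ?case using wpos[of t] by linarith
  qed
  let ?b = "\<lambda>t. u 0 t - ln (w t)"
  have Leq: "?L t = ennreal (poisson_kernel z t * ?b t)" if "w t > 0" for t
  proof -
    have "(\<lambda>n. w t + d n) \<longlonglongrightarrow> w t + 0" unfolding d_def
      by (intro tendsto_add tendsto_const LIMSEQ_inverse_real_of_nat)
    then have "(\<lambda>n. ln (w t + d n)) \<longlonglongrightarrow> ln (w t)" using tendsto_ln[of "\<lambda>n. w t + d n" "w t"] that by simp
    then have "(\<lambda>n. ennreal (poisson_kernel z t * h n t)) \<longlonglongrightarrow> ennreal (poisson_kernel z t * ?b t)"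
      unfolding h_def u_def by (intro tendsto_ennrealI tendsto_mult tendsto_diff tendsto_const)
    then show ?thesis by (intro lim_imp_Liminf) auto
  qed
  \<comment> \<open>Where w = 0 both logarithms are 0, since ln 0 = 0.\<close>
  have bpos: "?b t \<ge> 0" for t
  proof (cases "w t = 0")
    case True then show ?thesis by (simp add: u_def d_def)
  next
    case False then show ?thesis using wpos[of t] by (simp add: u_def d_def)
  qed
  have "poisson_integrable ?b"
  proof (rule poisson_integrableI_nn[OF _ z])
    have "(\<integral>\<^sup>+t. ennreal (poisson_kernel z t * \<bar>?b t\<bar>) \<partial>lborel) = (\<integral>\<^sup>+t. ?L t \<partial>lborel)"
      by (intro nn_integral_cong_AE, use ae in eventually_elim) (use Leq bpos in simp)
    also have "\<dots> < \<infinity>" using Lint by (rule order_le_less_trans) simp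
    finally show "(\<integral>\<^sup>+t. ennreal (poisson_kernel z t * \<bar>?b t\<bar>) \<partial>lborel) < \<infinity>" .
  qed measurable
  from poisson_integrable_diff[OF ui[of 0] this] show "poisson_integrable (\<lambda>t. ln (w t))" by simp
qed

section \<open>Radial limits of outer functions\<close>

lemma integrable_inverse_one_plus_square: "integrable lborel (\<lambda>x::real. 1 / (1 + x\<^sup>2))"
  and integral_inverse_one_plus_square: "(\<integral>x. 1 / (1 + (x::real)\<^sup>2) \<partial>lborel) = pi"
proof -
  have eq: "(\<lambda>x::real. 1 / (1 + x\<^sup>2)) = (\<lambda>x. pi * poisson_kernel \<i> x)"
    by (auto simp: poisson_kernel_def fun_eq_iff add.commute)
  show "integrable lborel (\<lambda>x::real. 1 / (1 + x\<^sup>2))" "(\<integral>x. 1 / (1 + (x::real)\<^sup>2) \<partial>lborel) = pi"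
    unfolding eq by (simp_all add: integrable_poisson_kernel integral_poisson_kernel)
qed

lemma borel_measurable_cnj [measurable]: "cnj \<in> borel_measurable borel"
  by (intro borel_measurable_continuous_onI continuous_intros)

text \<open>
  The slices of \<open>H\<close> form an orbit of the Poisson semigroup, whose operators are symmetric. Moving half of the step
  \<open>2 * s\<close> from the first factor to the second therefore does not change the inner product.
\<close>

lemma poisson_semigroup_inner_product:
  assumes H: "uniformly_integrable_hol H" and a: "a > 0" and s: "s > 0"
    and sq: "\<And>y. y > 0 \<Longrightarrow> integrable lborel (\<lambda>x. (cmod (H (Complex x y)))\<^sup>2)"
  shows "(\<integral>x. H (Complex x (a + 2 * s)) * cnj (H (Complex x a)) \<partial>lborel)
    = complex_of_real (\<integral>x. (cmod (H (Complex x (a + s))))\<^sup>2 \<partial>lborel)"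
proof -
  have Hh: "H holomorphic_on {z. Im z > 0}" using H by (simp add: uniformly_integrable_hol_def)
  have as: "a + s > 0" using a s by simp
  note [measurable] = measurable_upper_line[OF Hh a] measurable_upper_line[OF Hh as]
  let ?P = "\<lambda>x t. poisson_kernel (Complex x s) t"
  have mP[measurable]: "(\<lambda>(x,t). ?P x t) \<in> borel_measurable (borel \<Otimes>\<^sub>M borel)"
    unfolding poisson_kernel_def by simp
  have P0: "?P x t \<ge> 0" for x t using s poisson_kernel_nonneg[of "Complex x s"] by simp
  let ?A = "\<lambda>x. H (Complex x a)" and ?C = "\<lambda>t. H (Complex t (a + s))"
  let ?k = "\<lambda>x t. complex_of_real (?P x t) * ?C t * cnj (?A x)"
  have r1: "H (Complex x (a + 2 * s)) = (\<integral>t. complex_of_real (?P x t) * ?C t \<partial>lborel)" for x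
    using uniformly_integrable_poisson(2)[OF H, of "Complex x s" "a + s"] s as
    by (simp add: Complex_eq algebra_simps)
  have r2: "?C t = (\<integral>x. complex_of_real (?P x t) * ?A x \<partial>lborel)" for t
  proof -
    have "?C t = (\<integral>x. complex_of_real (poisson_kernel (Complex t s) x) * ?A x \<partial>lborel)"
      using uniformly_integrable_poisson(2)[OF H, of "Complex t s" a] s a by (simp add: Complex_eq algebra_simps)
    also have "\<dots> = (\<integral>x. complex_of_real (?P x t) * ?A x \<partial>lborel)"
      by (intro Bochner_Integration.integral_cong refl, subst poisson_kernel_sym, rule refl)
    finally show ?thesis .
  qed
  have int: "integrable (lborel \<Otimes>\<^sub>M lborel) (\<lambda>(x,t). ?k x t)"
  proof (rule integrableI_bounded)
    show "(\<lambda>(x,t). ?k x t) \<in> borel_measurable (lborel \<Otimes>\<^sub>M lborel)"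
      using mP by simp
    have "(\<integral>\<^sup>+w. ennreal (norm (case w of (x,t) \<Rightarrow> ?k x t)) \<partial>(lborel \<Otimes>\<^sub>M lborel))
       = (\<integral>\<^sup>+x. (\<integral>\<^sup>+t. ennreal (norm (?k x t)) \<partial>lborel) \<partial>lborel)"
      by (subst lborel.nn_integral_fst[symmetric]) (use mP in simp_all)
    also have "\<dots> \<le> (\<integral>\<^sup>+x. (\<integral>\<^sup>+t. ennreal (?P x t) * ennreal ((cmod (?C t))\<^sup>2) + ennreal (?P x t) * ennreal ((cmod (?A x))\<^sup>2) \<partial>lborel) \<partial>lborel)"
    proof (intro nn_integral_mono)
      fix x t
      have "cmod (?C t) * cmod (?A x) \<le> (cmod (?C t))\<^sup>2 + (cmod (?A x))\<^sup>2"
        using sum_squares_bound[of "cmod (?C t)" "cmod (?A x)"] mult_nonneg_nonneg[OF norm_ge_zero[of "?C t"] norm_ge_zero[of "?A x"]] by linarith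
      then have "?P x t * (cmod (?C t) * cmod (?A x)) \<le> ?P x t * ((cmod (?C t))\<^sup>2 + (cmod (?A x))\<^sup>2)"
        using P0 by (intro mult_left_mono) auto
      then have "norm (?k x t) \<le> ?P x t * (cmod (?C t))\<^sup>2 + ?P x t * (cmod (?A x))\<^sup>2"
        using P0 by (simp add: norm_mult algebra_simps)
      then have "ennreal (norm (?k x t)) \<le> ennreal (?P x t * (cmod (?C t))\<^sup>2 + ?P x t * (cmod (?A x))\<^sup>2)" by (rule ennreal_leI)
      also have "\<dots> = ennreal (?P x t) * ennreal ((cmod (?C t))\<^sup>2) + ennreal (?P x t) * ennreal ((cmod (?A x))\<^sup>2)"
        using P0 by (subst ennreal_plus) (auto simp: ennreal_mult)
      finally show "ennreal (norm (?k x t)) \<le> ennreal (?P x t) * ennreal ((cmod (?C t))\<^sup>2) + ennreal (?P x t) * ennreal ((cmod (?A x))\<^sup>2)" .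
    qed
    also have "\<dots> = (\<integral>\<^sup>+x. (\<integral>\<^sup>+t. ennreal (?P x t) * ennreal ((cmod (?C t))\<^sup>2) \<partial>lborel) + ennreal ((cmod (?A x))\<^sup>2) \<partial>lborel)"
      using s by (intro nn_integral_cong, subst nn_integral_add) (auto simp: nn_integral_multc nn_integral_poisson_kernel)
    also have "\<dots> = (\<integral>\<^sup>+x. (\<integral>\<^sup>+t. ennreal (?P x t) * ennreal ((cmod (?C t))\<^sup>2) \<partial>lborel) \<partial>lborel) + (\<integral>\<^sup>+x. ennreal ((cmod (?A x))\<^sup>2) \<partial>lborel)"
      using mP by (intro nn_integral_add) (auto intro!: lborel.borel_measurable_nn_integral)
    also have "(\<integral>\<^sup>+x. (\<integral>\<^sup>+t. ennreal (?P x t) * ennreal ((cmod (?C t))\<^sup>2) \<partial>lborel) \<partial>lborel) = (\<integral>\<^sup>+t. ennreal ((cmod (?C t))\<^sup>2) \<partial>lborel)"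
      by (rule nn_integral_poisson_Fubini[OF _ s]) measurable
    also have "(\<integral>\<^sup>+t. ennreal ((cmod (?C t))\<^sup>2) \<partial>lborel) + (\<integral>\<^sup>+x. ennreal ((cmod (?A x))\<^sup>2) \<partial>lborel) < \<infinity>"
      using sq[OF a] sq[OF as] by (simp add: integrable_iff_bounded)
    finally show "(\<integral>\<^sup>+w. ennreal (norm (case w of (x,t) \<Rightarrow> ?k x t)) \<partial>(lborel \<Otimes>\<^sub>M lborel)) < \<infinity>" .
  qed
  have "(\<integral>x. H (Complex x (a + 2 * s)) * cnj (?A x) \<partial>lborel) = (\<integral>x. (\<integral>t. ?k x t \<partial>lborel) \<partial>lborel)"
    unfolding r1 by (simp only: integral_mult_left_zero)
  also have "\<dots> = (\<integral>t. (\<integral>x. ?k x t \<partial>lborel) \<partial>lborel)"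
    using lborel_pair.Fubini_integral[OF int] by simp
  also have "\<dots> = (\<integral>t. ?C t * cnj (?C t) \<partial>lborel)"
  proof (rule Bochner_Integration.integral_cong[OF refl])
    fix t
    have "(\<integral>x. ?k x t \<partial>lborel) = (\<integral>x. ?C t * cnj (complex_of_real (?P x t) * ?A x) \<partial>lborel)"
      by (simp add: mult_ac)
    also have "\<dots> = ?C t * cnj (\<integral>x. complex_of_real (?P x t) * ?A x \<partial>lborel)" by (simp only: integral_mult_right_zero Bochner_Integration.integral_cnj)
    also have "\<dots> = ?C t * cnj (?C t)" by (simp only: r2[symmetric])
    finally show "(\<integral>x. ?k x t \<partial>lborel) = ?C t * cnj (?C t)" .
  qed
  also have "\<dots> = (\<integral>t. complex_of_real ((cmod (?C t))\<^sup>2) \<partial>lborel)" by (simp only: complex_norm_square)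
  also have "\<dots> = complex_of_real (\<integral>t. (cmod (?C t))\<^sup>2 \<partial>lborel)" by (rule integral_complex_of_real)
  finally show ?thesis .
qed

lemma cmod_diff_squared: "(cmod (x - y))\<^sup>2 = (cmod x)\<^sup>2 + (cmod y)\<^sup>2 - 2 * Re (x * cnj y)"
  by (simp only: cmod_power2) (simp add: power2_eq_square algebra_simps)

lemma integrable_product_cnj:
  assumes "integrable lborel (\<lambda>x. (cmod (f x))\<^sup>2)" "integrable lborel (\<lambda>x. (cmod (g x))\<^sup>2)"
    and [measurable]: "f \<in> borel_measurable borel" "g \<in> borel_measurable borel"
  shows "integrable lborel (\<lambda>x::real. f x * cnj (g x))"
proof (rule Bochner_Integration.integrable_bound[OF Bochner_Integration.integrable_add[OF assms(1,2)]])
  show "AE x in lborel. norm (f x * cnj (g x)) \<le> norm ((cmod (f x))\<^sup>2 + (cmod (g x))\<^sup>2)"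
  proof (rule AE_I2)
    fix x
    have "cmod (f x) * cmod (g x) \<le> (cmod (f x))\<^sup>2 + (cmod (g x))\<^sup>2"
      using sum_squares_bound[of "cmod (f x)" "cmod (g x)"] mult_nonneg_nonneg[OF norm_ge_zero[of "f x"] norm_ge_zero[of "g x"]] by linarith
    then show "norm (f x * cnj (g x)) \<le> norm ((cmod (f x))\<^sup>2 + (cmod (g x))\<^sup>2)" by (simp add: norm_mult)
  qed
qed measurable

text \<open>
  Dividing by \<open>z + \<i>\<close> makes the slices square integrable. By the semigroup identity the squared \<open>L\<^sup>2\<close> distance of
  the slices at heights \<open>a\<close> and \<open>c\<close> is \<open>N c + N a - 2 * N ((a + c) / 2)\<close>, where \<open>N\<close> is the squared norm. The convergence of
  the moduli gives a limit of \<open>N\<close> at 0, so the slices are Cauchy. A subsequence converges almost everywhere to a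
  bounded function, the Poisson integral of this function is the given one, and \<open>poisson_radial_limit\<close> applies to its real
  and imaginary parts.
\<close>

theorem bounded_radial_limit:
  assumes B: "B holomorphic_on {z. Im z > 0}" and B1: "\<And>z. Im z > 0 \<Longrightarrow> cmod (B z) \<le> 1" and b: "radial_modulus B b"
  shows "\<exists>h\<in>borel_measurable borel. AE x in lborel. ((\<lambda>y. B (Complex x y)) \<longlongrightarrow> h x) (at_right 0)"
proof -
  have [measurable]: "b \<in> borel_measurable borel" and bpos: "\<And>t. b t \<ge> 0" using b by (auto simp: radial_modulus_def)
  have bae: "AE x in lborel. ((\<lambda>y. cmod (B (Complex x y))) \<longlongrightarrow> b x) (at_right 0)" using b by (simp add: radial_modulus_def)
  define H where "H z = B z / (z + \<i>)" for z
  have zi: "cmod (z + \<i>) \<ge> 1" "z + \<i> \<noteq> 0" if "Im z > 0" for z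
    using that abs_Im_le_cmod[of "z + \<i>"] by (auto simp: complex_eq_iff)
  have Hh: "H holomorphic_on {z. Im z > 0}" unfolding H_def using zi by (intro holomorphic_intros B) auto
  have H1: "cmod (H z) \<le> 1" if "Im z > 0" for z
    unfolding H_def norm_divide using B1[OF that] zi[OF that] by (simp add: divide_simps)
  have Hu: "uniformly_integrable_hol H" by (rule uniformly_integrable_hol_bounded[OF Hh H1])
  note mH = measurable_upper_line[OF Hh]
  have den: "(cmod (Complex x y + \<i>))\<^sup>2 = x\<^sup>2 + (1 + y)\<^sup>2" for x y by (simp add: cmod_power2 add.commute)
  have Hsq: "(cmod (H (Complex x y)))\<^sup>2 \<le> 1 / (1 + x\<^sup>2)" if y: "y > 0" for x y
  proof -
    have "(cmod (H (Complex x y)))\<^sup>2 = (cmod (B (Complex x y)))\<^sup>2 / (x\<^sup>2 + (1 + y)\<^sup>2)"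
      unfolding H_def by (simp add: norm_divide power_divide den)
    also have "\<dots> \<le> 1 / (1 + x\<^sup>2)"
    proof (rule frac_le)
      show "(cmod (B (Complex x y)))\<^sup>2 \<le> 1" using B1[of "Complex x y"] y by (simp add: power_le_one)
      have "1\<^sup>2 \<le> (1 + y)\<^sup>2" using y by (intro power_mono) auto
      then show "1 + x\<^sup>2 \<le> x\<^sup>2 + (1 + y)\<^sup>2" by simp
    qed (auto simp: one_plus_square_pos)
    finally show ?thesis .
  qed
  have sq: "integrable lborel (\<lambda>x. (cmod (H (Complex x y)))\<^sup>2)" if y: "y > 0" for y
  proof (rule Bochner_Integration.integrable_bound[OF integrable_inverse_one_plus_square])
    note [measurable] = mH[OF y]
    show "(\<lambda>x. (cmod (H (Complex x y)))\<^sup>2) \<in> borel_measurable lborel" by measurable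
    show "AE x in lborel. norm ((cmod (H (Complex x y)))\<^sup>2) \<le> norm (1 / (1 + x\<^sup>2))"
      using Hsq[OF y] by (intro AE_I2) (simp add: add_nonneg_nonneg)
  qed
  define N where "N y = (\<integral>x. (cmod (H (Complex x y)))\<^sup>2 \<partial>lborel)" for y
  define L where "L = (\<integral>x. (b x)\<^sup>2 / (x\<^sup>2 + 1) \<partial>lborel)"
  have NL: "(N \<longlongrightarrow> L) (at_right 0)"
    unfolding tendsto_at_iff_sequentially
  proof (intro allI impI)
    fix X :: "nat \<Rightarrow> real" assume X: "\<forall>i. X i \<in> {0<..} - {0}" "X \<longlonglongrightarrow> 0"
    have X0: "X i > 0" for i using X(1) by auto
    have fX: "filterlim X (at_right 0) sequentially"
      using X X0 by (auto simp: filterlim_at intro!: always_eventually) (metis less_irrefl)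
    note [measurable] = mH[OF X0]
    have "(\<lambda>i. \<integral>x. (cmod (H (Complex x (X i))))\<^sup>2 \<partial>lborel) \<longlonglongrightarrow> L"
      unfolding L_def
    proof (rule integral_dominated_convergence[where w = "\<lambda>x. 1 / (1 + x\<^sup>2)"])
      show "AE x in lborel. (\<lambda>i. (cmod (H (Complex x (X i))))\<^sup>2) \<longlonglongrightarrow> (b x)\<^sup>2 / (x\<^sup>2 + 1)"
        using bae
      proof eventually_elim
        case (elim x)
        have "(\<lambda>i. cmod (B (Complex x (X i)))) \<longlonglongrightarrow> b x" by (rule filterlim_compose[OF elim fX])
        then have "(\<lambda>i. (cmod (B (Complex x (X i))))\<^sup>2 / (x\<^sup>2 + (1 + X i)\<^sup>2)) \<longlonglongrightarrow> (b x)\<^sup>2 / (x\<^sup>2 + (1 + 0)\<^sup>2)"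
          using one_plus_square_pos[of x] by (intro tendsto_intros X(2)) (auto simp: add.commute)
        then show ?case unfolding H_def by (simp add: norm_divide power_divide den)
      qed
      show "AE x in lborel. norm ((cmod (H (Complex x (X i))))\<^sup>2) \<le> 1 / (1 + x\<^sup>2)" for i
        using Hsq[OF X0] by (intro AE_I2) simp
    qed (use integrable_inverse_one_plus_square in measurable)
    then show "(N \<circ> X) \<longlonglongrightarrow> L" by (simp add: N_def o_def)
  qed
  have dist2: "(\<integral>x. (cmod (H (Complex x c) - H (Complex x a)))\<^sup>2 \<partial>lborel) = N c + N a - 2 * N ((a + c) / 2)" if a: "0 < a" "a < c" for a c
  proof -
    define s where "s = (c - a) / 2"
    have s: "s > 0" and c: "c = a + 2 * s" "(a + c) / 2 = a + s" "c > 0" using a by (auto simp: s_def field_simps)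
    note [measurable] = mH[OF a(1)] mH[OF c(3)]
    have ip: "integrable lborel (\<lambda>x. H (Complex x c) * cnj (H (Complex x a)))"
      by (rule integrable_product_cnj[OF sq[OF c(3)] sq[OF a(1)]]) measurable
    have "(\<integral>x. (cmod (H (Complex x c) - H (Complex x a)))\<^sup>2 \<partial>lborel)
      = (\<integral>x. (cmod (H (Complex x c)))\<^sup>2 + (cmod (H (Complex x a)))\<^sup>2 - 2 * Re (H (Complex x c) * cnj (H (Complex x a))) \<partial>lborel)"
      by (simp only: cmod_diff_squared)
    also have "\<dots> = N c + N a - 2 * Re (\<integral>x. H (Complex x c) * cnj (H (Complex x a)) \<partial>lborel)"
      unfolding N_def
      by (simp only: integral_Re[OF ip]
          Bochner_Integration.integral_diff[OF Bochner_Integration.integrable_add[OF sq[OF c(3)] sq[OF a(1)]] integrable_mult_right[OF integrable_Re[OF ip], of 2]]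
          Bochner_Integration.integral_add[OF sq[OF c(3)] sq[OF a(1)]] integral_mult_right_zero)
    also have "(\<integral>x. H (Complex x c) * cnj (H (Complex x a)) \<partial>lborel) = complex_of_real (N (a + s))"
      unfolding c(1) N_def by (rule poisson_semigroup_inner_product[OF Hu a(1) s sq])
    finally show ?thesis by (simp add: c(2))
  qed
  define h where "h n = inverse (real (Suc n))" for n
  have h: "h n > 0" for n by (simp add: h_def)
  have h0: "h \<longlonglongrightarrow> 0" unfolding h_def by (rule LIMSEQ_inverse_real_of_nat)
  note [measurable] = mH[OF h]
  have L2: "\<exists>M. \<forall>i\<ge>M. \<forall>j\<ge>M. (\<integral>x. (cmod (H (Complex x (h i)) - H (Complex x (h j))))\<^sup>2 \<partial>lborel) < e" if e: "e > 0" for e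
  proof -
    have "e / 4 > 0" using e by simp
    from tendstoD[OF NL this] obtain d where d: "d > 0" "\<And>y. 0 < y \<Longrightarrow> y < d \<Longrightarrow> \<bar>N y - L\<bar> < e / 4"
      unfolding eventually_at_right_field dist_real_def by auto
    have close: "(\<integral>x. (cmod (H (Complex x c) - H (Complex x a)))\<^sup>2 \<partial>lborel) < e" if "0 < a" "0 < c" "a < d" "c < d" for a c
    proof -
      have *: "(\<integral>x. (cmod (H (Complex x c) - H (Complex x a)))\<^sup>2 \<partial>lborel) < e" if "0 < a" "a < c" "c < d" for a c
      proof -
        have "\<bar>N a - L\<bar> < e / 4" "\<bar>N c - L\<bar> < e / 4" "\<bar>N ((a + c) / 2) - L\<bar> < e / 4"
          using d(2)[of a] d(2)[of c] d(2)[of "(a + c) / 2"] that by simp_all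
        then show ?thesis unfolding dist2[OF that(1,2)] by linarith
      qed
      show ?thesis
      proof (cases a c rule: linorder_cases)
        case less then show ?thesis using * that by blast
      next
        case equal then show ?thesis using e by simp
      next
        case greater then show ?thesis using *[of c a] that by (simp add: norm_minus_commute)
      qed
    qed
    obtain M where "\<And>n. n \<ge> M \<Longrightarrow> h n < d" using order_tendstoD(2)[OF h0 d(1)] unfolding eventually_sequentially by blast
    then show ?thesis using close h by (intro exI[of _ M]) auto
  qed
  define w where "w x = 1 / (1 + x\<^sup>2)" for x :: real
  have wpos: "0 < w x" "w x \<le> 1" for x by (simp_all add: w_def one_plus_square_pos)
  have [measurable]: "w \<in> borel_measurable borel" unfolding w_def by measurable
  have wint: "integrable lborel w" "(\<integral>x. w x \<partial>lborel) = pi"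
    unfolding w_def by (rule integrable_inverse_one_plus_square integral_inverse_one_plus_square)+
  \<comment> \<open>The weight turns convergence in the square mean into convergence in the mean.\<close>
  define S where "S n x = complex_of_real (w x) * H (Complex x (h n))" for n x
  have Sint: "integrable lborel (S n)" for n
  proof (rule Bochner_Integration.integrable_bound[OF wint(1)])
    show "S n \<in> borel_measurable lborel" unfolding S_def by measurable
    show "AE x in lborel. norm (S n x) \<le> norm (w x)"
      unfolding S_def using wpos H1 h by (intro AE_I2) (simp add: norm_mult mult_left_le)
  qed
  have Scau: "\<exists>M. \<forall>i\<ge>M. \<forall>j\<ge>M. (\<integral>x. norm (S i x - S j x) \<partial>lborel) < e" if e: "e > 0" for e
  proof -
    \<comment> \<open>D \<le> \<kappa> + D^2 / \<kappa>, and the weight has total mass \<pi>: the two terms contribute e / 4 each.\<close>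
    define \<kappa> where "\<kappa> = e / (4 * pi)"
    have \<kappa>: "\<kappa> > 0" using e by (simp add: \<kappa>_def)
    have "\<kappa> * e / 4 > 0" using \<kappa> e by simp
    from L2[OF this] obtain M where M: "\<And>i j. i \<ge> M \<Longrightarrow> j \<ge> M \<Longrightarrow> (\<integral>x. (cmod (H (Complex x (h i)) - H (Complex x (h j))))\<^sup>2 \<partial>lborel) < \<kappa> * e / 4" by blast
    have "(\<integral>x. norm (S i x - S j x) \<partial>lborel) < e" if "i \<ge> M" "j \<ge> M" for i j
    proof -
      let ?D = "\<lambda>x. cmod (H (Complex x (h i)) - H (Complex x (h j)))"
      have Dsq: "integrable lborel (\<lambda>x. (?D x)\<^sup>2)"
      proof (rule Bochner_Integration.integrable_bound[OF integrable_mult_right[OF Bochner_Integration.integrable_add[OF sq[OF h[of i]] sq[OF h[of j]]], of 2]])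
        show "AE x in lborel. norm ((?D x)\<^sup>2) \<le> norm (2 * ((cmod (H (Complex x (h i))))\<^sup>2 + (cmod (H (Complex x (h j))))\<^sup>2))"
        proof (rule AE_I2)
          fix x
          have "(?D x)\<^sup>2 \<le> (cmod (H (Complex x (h i))) + cmod (H (Complex x (h j))))\<^sup>2"
            by (intro power_mono norm_triangle_ineq4) simp
          also have "\<dots> \<le> 2 * ((cmod (H (Complex x (h i))))\<^sup>2 + (cmod (H (Complex x (h j))))\<^sup>2)"
            using sum_squares_bound[of "cmod (H (Complex x (h i)))" "cmod (H (Complex x (h j)))"] by (simp add: power2_sum)
          finally show "norm ((?D x)\<^sup>2) \<le> norm (2 * ((cmod (H (Complex x (h i))))\<^sup>2 + (cmod (H (Complex x (h j))))\<^sup>2))" by simp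
        qed
      qed measurable
      have "(\<integral>x. norm (S i x - S j x) \<partial>lborel) \<le> (\<integral>x. \<kappa> * w x + (?D x)\<^sup>2 / \<kappa> \<partial>lborel)"
      proof (rule integral_mono)
        show "integrable lborel (\<lambda>x. norm (S i x - S j x))" using Sint by (intro integrable_norm Bochner_Integration.integrable_diff)
        show "integrable lborel (\<lambda>x. \<kappa> * w x + (?D x)\<^sup>2 / \<kappa>)" using wint(1) Dsq by simp
        fix x
        have "S i x - S j x = complex_of_real (w x) * (H (Complex x (h i)) - H (Complex x (h j)))" by (simp add: S_def right_diff_distrib)
        then have e1: "norm (S i x - S j x) = w x * ?D x" using wpos[of x] by (simp add: norm_mult)
        have "?D x \<le> \<kappa> + (?D x)\<^sup>2 / \<kappa>"
        proof (cases "?D x \<le> \<kappa>")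
          case True then show ?thesis using \<kappa> by (simp add: add_increasing2)
        next
          case False
          then have "?D x * \<kappa> \<le> ?D x * ?D x" by (intro mult_left_mono) auto
          then have "?D x \<le> (?D x)\<^sup>2 / \<kappa>" using \<kappa> by (simp add: field_simps power2_eq_square)
          then show ?thesis using \<kappa> by linarith
        qed
        then have "w x * ?D x \<le> w x * (\<kappa> + (?D x)\<^sup>2 / \<kappa>)" using wpos[of x] by (intro mult_left_mono) auto
        also have "\<dots> \<le> \<kappa> * w x + (?D x)\<^sup>2 / \<kappa>"
          using mult_right_mono[OF wpos(2)[of x], of "(?D x)\<^sup>2 / \<kappa>"] \<kappa> by (simp add: algebra_simps)
        finally show "norm (S i x - S j x) \<le> \<kappa> * w x + (?D x)\<^sup>2 / \<kappa>" unfolding e1 .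
      qed
      also have "\<dots> = \<kappa> * pi + (\<integral>x. (?D x)\<^sup>2 \<partial>lborel) / \<kappa>" using wint Dsq by simp
      also have "\<dots> < \<kappa> * pi + \<kappa> * e / 4 / \<kappa>" using M[OF that] \<kappa> by (intro add_strict_left_mono divide_strict_right_mono)
      also have "\<dots> = e / 2" using \<kappa> by (simp add: \<kappa>_def)
      also have "\<dots> < e" using e by simp
      finally show ?thesis .
    qed
    then show ?thesis by blast
  qed
  obtain r where r: "strict_mono r" "AE x in lborel. Cauchy (\<lambda>i. S (r i) x)"
    using cauchy_L1_AE_cauchy_subseq[of lborel S, OF Sint Scau] by metis
  define f0 where "f0 x = lim (\<lambda>i. H (Complex x (h (r i))))" for x
  have [measurable]: "f0 \<in> borel_measurable borel" unfolding f0_def by (rule borel_measurable_lim_metric) measurable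
  have f0lim: "AE x in lborel. (\<lambda>i. H (Complex x (h (r i)))) \<longlonglongrightarrow> f0 x"
    using r(2)
  proof eventually_elim
    case (elim x)
    then have "convergent (\<lambda>i. S (r i) x)" by (rule Cauchy_convergent)
    then obtain l where "(\<lambda>i. S (r i) x) \<longlonglongrightarrow> l" by (auto simp: convergent_def)
    then have "(\<lambda>i. S (r i) x / complex_of_real (w x)) \<longlonglongrightarrow> l / complex_of_real (w x)"
      using wpos[of x] by (intro tendsto_divide tendsto_const) auto
    then have "convergent (\<lambda>i. H (Complex x (h (r i))))" using wpos(1)[of x] by (auto simp: S_def convergent_def)
    then show ?case unfolding f0_def by (simp add: convergent_LIMSEQ_iff)
  qed
  \<comment> \<open>The limit is bounded by 1 only almost everywhere; f is a version bounded everywhere.\<close>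
  define f where "f x = (if cmod (f0 x) \<le> 1 then f0 x else 0)" for x
  have [measurable]: "f \<in> borel_measurable borel" unfolding f_def by measurable
  have f1: "cmod (f x) \<le> 1" for x by (simp add: f_def)
  have flim: "AE x in lborel. (\<lambda>i. H (Complex x (h (r i)))) \<longlonglongrightarrow> f x"
    using f0lim
  proof eventually_elim
    case (elim x)
    have "cmod (f0 x) \<le> 1"
      by (rule LIMSEQ_le_const2[OF tendsto_norm[OF elim]]) (use H1 h in auto)
    then show ?case using elim by (simp add: f_def)
  qed
  have rh: "(\<lambda>i. h (r i)) \<longlonglongrightarrow> 0" using LIMSEQ_subseq_LIMSEQ[OF h0 r(1)] by (simp add: o_def)
  have pf: "integrable lborel (\<lambda>t. complex_of_real (poisson_kernel z t) * f t)" if z: "Im z > 0" for z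
    by (rule Bochner_Integration.integrable_bound[OF integrable_poisson_kernel[OF z]])
       (use f1 poisson_kernel_nonneg[OF z] in \<open>auto simp: norm_mult mult_left_le\<close>)
  have rep: "H z = (\<integral>t. complex_of_real (poisson_kernel z t) * f t \<partial>lborel)" if z: "Im z > 0" for z
  proof (rule LIMSEQ_unique)
    have "(\<lambda>i. H (z + \<i> * complex_of_real (h (r i)))) \<longlonglongrightarrow> H z"
    proof (rule continuous_on_tendsto_compose[OF holomorphic_on_imp_continuous_on[OF Hh]])
      have "(\<lambda>n. z + \<i> * complex_of_real (h (r n))) \<longlonglongrightarrow> z + \<i> * complex_of_real 0" by (intro tendsto_intros rh)
      then show "(\<lambda>n. z + \<i> * complex_of_real (h (r n))) \<longlonglongrightarrow> z" by simp
    qed (use z h in \<open>auto simp: add_pos_pos\<close>)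
    then show "(\<lambda>i. \<integral>t. complex_of_real (poisson_kernel z t) * H (Complex t (h (r i))) \<partial>lborel) \<longlonglongrightarrow> H z"
      by (simp only: uniformly_integrable_poisson(2)[OF Hu z h])
    show "(\<lambda>i. \<integral>t. complex_of_real (poisson_kernel z t) * H (Complex t (h (r i))) \<partial>lborel) \<longlonglongrightarrow> (\<integral>t. complex_of_real (poisson_kernel z t) * f t \<partial>lborel)"
    proof (rule integral_dominated_convergence[where w = "poisson_kernel z"])
      show "integrable lborel (poisson_kernel z)" by (rule integrable_poisson_kernel[OF z])
      show "AE t in lborel. (\<lambda>i. complex_of_real (poisson_kernel z t) * H (Complex t (h (r i)))) \<longlonglongrightarrow> complex_of_real (poisson_kernel z t) * f t"
        using flim by eventually_elim (intro tendsto_intros)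
      show "AE t in lborel. norm (complex_of_real (poisson_kernel z t) * H (Complex t (h (r i)))) \<le> poisson_kernel z t" for i
        using H1 h poisson_kernel_nonneg[OF z] by (intro AE_I2) (simp add: norm_mult mult_left_le)
    qed measurable
  qed
  have pr: "poisson_integrable (\<lambda>t. Re (f t))"
    by (rule poisson_integrable_bound[OF poisson_integrable_const[of 1]]) (use order_trans[OF abs_Re_le_cmod f1] in auto)
  have pim: "poisson_integrable (\<lambda>t. Im (f t))"
    by (rule poisson_integrable_bound[OF poisson_integrable_const[of 1]]) (use order_trans[OF abs_Im_le_cmod f1] in auto)
  have HRe: "Re (H z) = poisson (\<lambda>t. Re (f t)) z" and HIm: "Im (H z) = poisson (\<lambda>t. Im (f t)) z" if z: "Im z > 0" for z
    unfolding rep[OF z] poisson_def integral_Re[OF pf[OF z], symmetric] integral_Im[OF pf[OF z], symmetric] by simp_all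
  show ?thesis
  proof (rule bexI[of _ "\<lambda>x. f x * (complex_of_real x + \<i>)"])
    show "(\<lambda>x. f x * (complex_of_real x + \<i>)) \<in> borel_measurable borel" by measurable
    show "AE x in lborel. ((\<lambda>y. B (Complex x y)) \<longlongrightarrow> f x * (complex_of_real x + \<i>)) (at_right 0)"
      using poisson_radial_limit[OF pr] poisson_radial_limit[OF pim]
    proof eventually_elim
      case (elim x)
      have "((\<lambda>y. Complex (poisson (\<lambda>t. Re (f t)) (Complex x y)) (poisson (\<lambda>t. Im (f t)) (Complex x y)) * (Complex x y + \<i>))
           \<longlongrightarrow> Complex (Re (f x)) (Im (f x)) * (Complex x 0 + \<i>)) (at_right 0)"
        by (intro tendsto_mult tendsto_add tendsto_Complex tendsto_const elim tendsto_ident_at)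
      moreover have "\<forall>\<^sub>F y in at_right (0::real). Complex (poisson (\<lambda>t. Re (f t)) (Complex x y)) (poisson (\<lambda>t. Im (f t)) (Complex x y)) * (Complex x y + \<i>) = B (Complex x y)"
        using eventually_at_right_less
      proof eventually_elim
        case (elim y)
        then have "Complex (poisson (\<lambda>t. Re (f t)) (Complex x y)) (poisson (\<lambda>t. Im (f t)) (Complex x y)) = H (Complex x y)"
          by (simp add: complex_eq_iff HRe HIm)
        then show ?case using zi(2)[of "Complex x y"] elim by (simp add: H_def)
      qed
      ultimately have "((\<lambda>y. B (Complex x y)) \<longlongrightarrow> Complex (Re (f x)) (Im (f x)) * (Complex x 0 + \<i>)) (at_right 0)"
        by (rule Lim_transform_eventually)
      then show ?case by (simp add: complex_of_real_def)
    qed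
  qed
qed

text \<open>
  Writing \<open>u\<close> as a difference of two nonpositive functions makes the outer function a quotient of two bounded ones.
  The limit of the denominator vanishes almost nowhere, because its modulus is an exponential.
\<close>

theorem outer_radial_limit:
  assumes u: "poisson_integrable u"
  shows "\<exists>h\<in>borel_measurable borel. boundary_upper (outer u) h \<and> (AE x in lborel. cmod (h x) = exp (u x))"
proof -
  note [measurable] = poisson_integrable_measurable[OF u]
  define p n where "p t = - max 0 (u t)" and "n t = - max 0 (- u t)" for t
  have pi: "poisson_integrable p" "poisson_integrable n" unfolding p_def n_def
    by (rule poisson_integrable_bound[OF poisson_integrable_abs[OF u]]; auto)+
  have le: "cmod (outer p z) \<le> 1" "cmod (outer n z) \<le> 1" if "Im z > 0" for z
    using norm_outer_le[OF pi(1) that, of 0] norm_outer_le[OF pi(2) that, of 0] by (simp_all add: p_def n_def)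
  obtain P where P[measurable]: "P \<in> borel_measurable borel" and Pl: "AE x in lborel. ((\<lambda>y. outer p (Complex x y)) \<longlongrightarrow> P x) (at_right 0)"
    using bounded_radial_limit[OF holomorphic_outer[OF pi(1)] le(1) radial_modulus_outer[OF pi(1)]] by blast
  obtain N where N[measurable]: "N \<in> borel_measurable borel" and Nl: "AE x in lborel. ((\<lambda>y. outer n (Complex x y)) \<longlongrightarrow> N x) (at_right 0)"
    using bounded_radial_limit[OF holomorphic_outer[OF pi(2)] le(2) radial_modulus_outer[OF pi(2)]] by blast
  have mp: "AE x in lborel. ((\<lambda>y. cmod (outer p (Complex x y))) \<longlongrightarrow> exp (p x)) (at_right 0)"
   and mn: "AE x in lborel. ((\<lambda>y. cmod (outer n (Complex x y))) \<longlongrightarrow> exp (n x)) (at_right 0)"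
    using radial_modulus_outer[OF pi(1)] radial_modulus_outer[OF pi(2)] by (auto simp: radial_modulus_def)
  have eq: "outer u z = outer n z / outer p z" if z: "Im z > 0" for z
  proof -
    have "u = (\<lambda>t. n t + - p t)" by (auto simp: fun_eq_iff p_def n_def max_def)
    then show ?thesis using outer_add[OF pi(2) poisson_integrable_uminus[OF pi(1)] z]
      by (simp add: outer_uminus[OF pi(1) z] divide_inverse)
  qed
  have all: "AE x in lborel. cmod (P x) = exp (p x) \<and> cmod (N x) = exp (n x)"
    using Pl Nl mp mn
  proof eventually_elim
    case (elim x)
    then show ?case using tendsto_unique[OF trivial_limit_at_right_real tendsto_norm[OF elim(1)] elim(3)]
        tendsto_unique[OF trivial_limit_at_right_real tendsto_norm[OF elim(2)] elim(4)] by simp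
  qed
  show ?thesis
  proof (rule bexI[of _ "\<lambda>x. N x / P x"], intro conjI)
    show "(\<lambda>x. N x / P x) \<in> borel_measurable borel" by measurable
    show "AE x in lborel. cmod (N x / P x) = exp (u x)"
      using all by eventually_elim (simp add: norm_divide exp_diff[symmetric] p_def n_def max_def)
    show "boundary_upper (outer u) (\<lambda>x. N x / P x)"
      unfolding boundary_upper_def using Pl Nl all
    proof eventually_elim
      case (elim x)
      have "P x \<noteq> 0" using elim(3) by auto
      then have "((\<lambda>y. outer n (Complex x y) / outer p (Complex x y)) \<longlongrightarrow> N x / P x) (at_right 0)"
        by (intro tendsto_divide elim)
      moreover have "\<forall>\<^sub>F y in at_right (0::real). outer n (Complex x y) / outer p (Complex x y) = outer u (Complex x y)"
        using eventually_at_right_less by eventually_elim (simp add: eq)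
      ultimately show ?case by (rule Lim_transform_eventually)
    qed
  qed
qed

section \<open>Hardy classes and outer factors\<close>

text \<open>
  Jensen's inequality for the exponential, by integrating the tangent line at the mean.
\<close>

lemma exp_poisson_le:
  assumes u: "poisson_integrable u" and z: "Im z > 0"
  shows "ennreal (exp (poisson u z)) \<le> nn_poisson (\<lambda>t. exp (u t)) z" (is "_ \<le> ?R")
proof (cases "?R = \<infinity>")
  case False
  note [measurable] = poisson_integrable_measurable[OF u]
  define m where "m = poisson u z"
  have P: "poisson_kernel z t \<ge> 0" for t using poisson_kernel_nonneg[OF z] .
  have R: "?R = (\<integral>\<^sup>+t. ennreal (poisson_kernel z t * exp (u t)) \<partial>lborel)" using P by (simp add: ennreal_mult)
  have fin: "integrable lborel (\<lambda>t. poisson_kernel z t * exp (u t))"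
    by (rule integrableI_bounded) (use False P in \<open>auto simp: R less_top\<close>)
  then have eu: "poisson_integrable (\<lambda>t. exp (u t))" by (simp add: poisson_integrable_iff[OF z])
  have tang: "exp m * u t + exp m * (1 - m) \<le> exp (u t)" for t
  proof -
    have "exp m * (1 + (u t - m)) \<le> exp m * exp (u t - m)" by (intro mult_left_mono exp_ge_add_one_self) simp
    then show ?thesis by (simp add: exp_diff algebra_simps)
  qed
  have "exp m = exp m * m + exp m * (1 - m)" by (simp add: algebra_simps)
  also have "\<dots> = poisson (\<lambda>t. exp m * u t + exp m * (1 - m)) z"
    using poisson_add[OF poisson_integrable_cmult[OF u] poisson_integrable_const z] by (simp add: poisson_cmult poisson_const[OF z] m_def)
  also have "\<dots> \<le> poisson (\<lambda>t. exp (u t)) z"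
    by (rule poisson_mono[OF poisson_integrable_add[OF poisson_integrable_cmult[OF u] poisson_integrable_const] eu z tang])
  finally have "ennreal (exp m) \<le> ennreal (poisson (\<lambda>t. exp (u t)) z)" by (rule ennreal_leI)
  also have "\<dots> = ?R" unfolding R poisson_def using fin P by (intro nn_integral_eq_integral[symmetric]) auto
  finally show ?thesis by (simp add: m_def)
qed simp

text \<open>
  Jensen's inequality for the \<open>p\<close>-th power. Young's inequality supplies the tangent line in the form
  \<open>p * c powr (p - 1) * s \<le> s powr p + (p - 1) * c powr p\<close> with nonnegative terms only, so that it can be integrated in
  \<open>ennreal\<close> whether or not the integrals are finite.
\<close>

lemma poisson_powr_le:
  assumes p: "p > 1" and [measurable]: "k \<in> borel_measurable borel" and k: "\<And>t. k t \<ge> (0::real)" and z: "Im z > 0" and c: "c \<ge> 0"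
    and le: "ennreal c \<le> nn_poisson k z"
  shows "ennreal (c powr p) \<le> nn_poisson (\<lambda>t. k t powr p) z" (is "_ \<le> ?R")
proof -
  define q where "q = p / (p - 1)"
  have q: "q > 1" "1 / p + 1 / q = 1" using p by (auto simp: q_def field_simps)
  have young: "p * c powr (p - 1) * s \<le> s powr p + (p - 1) * c powr p" if "s \<ge> 0" for s
  proof -
    have "s * c powr (p - 1) \<le> s powr p / p + (c powr (p - 1)) powr q / q"
      using Youngs_inequality[OF p q(1) q(2) that, of "c powr (p - 1)"] by simp
    also have "(c powr (p - 1)) powr q = c powr p" using p by (simp add: powr_powr q_def)
    finally have "p * (s * c powr (p - 1)) \<le> p * (s powr p / p + c powr p / q)" using p by (intro mult_left_mono) auto
    also have "\<dots> = s powr p + (p - 1) * c powr p" using p by (simp add: q_def field_simps)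
    finally show ?thesis by (simp add: mult_ac)
  qed
  have "ennreal (p * c powr p) = ennreal (p * c powr (p - 1)) * ennreal c"
    using p c by (simp add: ennreal_mult[symmetric] mult.assoc powr_mult_base[symmetric] powr_diff)
  also have "\<dots> \<le> ennreal (p * c powr (p - 1)) * nn_poisson k z"
    by (intro mult_left_mono le) simp
  also have "\<dots> = (\<integral>\<^sup>+t. ennreal (p * c powr (p - 1)) * (ennreal (poisson_kernel z t) * ennreal (k t)) \<partial>lborel)"
    by (rule nn_integral_cmult[symmetric]) measurable
  also have "\<dots> \<le> (\<integral>\<^sup>+t. ennreal (poisson_kernel z t) * ennreal (k t powr p) + ennreal (poisson_kernel z t) * ennreal ((p - 1) * c powr p) \<partial>lborel)"
  proof (rule nn_integral_mono)
    fix t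
    have "ennreal (p * c powr (p - 1)) * (ennreal (poisson_kernel z t) * ennreal (k t)) = ennreal (poisson_kernel z t) * ennreal (p * c powr (p - 1) * k t)"
      using p k[of t] by (simp add: ennreal_mult mult_ac)
    also have "\<dots> \<le> ennreal (poisson_kernel z t) * ennreal (k t powr p + (p - 1) * c powr p)"
      by (intro mult_left_mono ennreal_leI young k) simp
    also have "\<dots> = ennreal (poisson_kernel z t) * ennreal (k t powr p) + ennreal (poisson_kernel z t) * ennreal ((p - 1) * c powr p)"
      using p by (simp add: distrib_left)
    finally show "ennreal (p * c powr (p - 1)) * (ennreal (poisson_kernel z t) * ennreal (k t))
       \<le> ennreal (poisson_kernel z t) * ennreal (k t powr p) + ennreal (poisson_kernel z t) * ennreal ((p - 1) * c powr p)" .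
  qed
  also have "\<dots> = ?R + ennreal ((p - 1) * c powr p)"
    by (subst nn_integral_add) (auto simp: nn_integral_multc nn_integral_poisson_kernel z)
  finally have *: "ennreal (p * c powr p) \<le> ?R + ennreal ((p - 1) * c powr p)" .
  show ?thesis
  proof (cases ?R)
    case (real r)
    then have "ennreal (p * c powr p) \<le> ennreal (r + (p - 1) * c powr p)" using * p by simp
    then have "p * c powr p \<le> r + (p - 1) * c powr p" using real p by (subst (asm) ennreal_le_iff) auto
    then have "c powr p \<le> r" by (simp add: algebra_simps)
    then show ?thesis unfolding real(2) by (rule ennreal_leI)
  qed simp
qed

lemma hardy_upperI_poisson:
  assumes p: "p > 1" and K: "K holomorphic_on {z. Im z > 0}" and [measurable]: "k \<in> borel_measurable borel" and k: "\<And>t. k t \<ge> (0::real)"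
    and fin: "(\<integral>\<^sup>+t. ennreal (k t powr p) \<partial>lborel) < \<infinity>"
    and le: "\<And>z. Im z > 0 \<Longrightarrow> ennreal (cmod (K z)) \<le> nn_poisson k z"
  shows "K \<in> hardy_upper p"
proof -
  have "(SUP y\<in>{0<..}. \<integral>\<^sup>+x. ennreal (cmod (K (Complex x y)) powr p) \<partial>lborel) \<le> (\<integral>\<^sup>+t. ennreal (k t powr p) \<partial>lborel)"
  proof (rule SUP_least)
    fix y :: real assume "y \<in> {0<..}"
    then have y: "y > 0" by simp
    have "(\<integral>\<^sup>+x. ennreal (cmod (K (Complex x y)) powr p) \<partial>lborel)
       \<le> (\<integral>\<^sup>+x. nn_poisson (\<lambda>t. k t powr p) (Complex x y) \<partial>lborel)"
      using y by (intro nn_integral_mono poisson_powr_le[OF p _ k _ _ le]) auto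
    also have "\<dots> = (\<integral>\<^sup>+t. ennreal (k t powr p) \<partial>lborel)" by (rule nn_integral_poisson_Fubini[OF _ y]) measurable
    finally show "(\<integral>\<^sup>+x. ennreal (cmod (K (Complex x y)) powr p) \<partial>lborel) \<le> (\<integral>\<^sup>+t. ennreal (k t powr p) \<partial>lborel)" .
  qed
  then show ?thesis using K fin by (simp add: hardy_upper_def order_le_less_trans)
qed

lemma hardy_upper_diff:
  assumes p: "p > 1" and F: "F \<in> hardy_upper p" and G: "G \<in> hardy_upper p"
  shows "(\<lambda>z. F z - G z) \<in> hardy_upper p"
proof -
  have Fh: "F holomorphic_on {z. Im z > 0}" and Gh: "G holomorphic_on {z. Im z > 0}" using F G by (auto simp: hardy_upper_def)
  obtain M where M: "M \<ge> 0" "\<And>y. y > 0 \<Longrightarrow> (\<integral>\<^sup>+x. ennreal (cmod (F (Complex x y)) powr p) \<partial>lborel) \<le> ennreal M" using hardy_upper_bound[OF F] by metis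
  obtain N where N: "N \<ge> 0" "\<And>y. y > 0 \<Longrightarrow> (\<integral>\<^sup>+x. ennreal (cmod (G (Complex x y)) powr p) \<partial>lborel) \<le> ennreal N" using hardy_upper_bound[OF G] by metis
  have "(SUP y\<in>{0<..}. \<integral>\<^sup>+x. ennreal (cmod (F (Complex x y) - G (Complex x y)) powr p) \<partial>lborel) \<le> ennreal (2 powr p) * (ennreal M + ennreal N)"
  proof (rule SUP_least)
    fix y :: real assume "y \<in> {0<..}"
    then have y: "y > 0" by simp
    note [measurable] = measurable_upper_line[OF Fh y] measurable_upper_line[OF Gh y]
    have "(\<integral>\<^sup>+x. ennreal (cmod (F (Complex x y) - G (Complex x y)) powr p) \<partial>lborel)
      \<le> (\<integral>\<^sup>+x. ennreal (2 powr p) * (ennreal (cmod (F (Complex x y)) powr p) + ennreal (cmod (G (Complex x y)) powr p)) \<partial>lborel)"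
    proof (rule nn_integral_mono)
      fix x
      let ?f = "cmod (F (Complex x y))" and ?g = "cmod (G (Complex x y))"
      have "cmod (F (Complex x y) - G (Complex x y)) \<le> 2 * max ?f ?g"
        using norm_triangle_ineq4[of "F (Complex x y)" "G (Complex x y)"] by linarith
      then have "cmod (F (Complex x y) - G (Complex x y)) powr p \<le> (2 * max ?f ?g) powr p" using p by (intro powr_mono2) auto
      also have "\<dots> = 2 powr p * max ?f ?g powr p" by (simp add: powr_mult)
      also have "\<dots> \<le> 2 powr p * (?f powr p + ?g powr p)" by (intro mult_left_mono) (auto simp: max_def)
      finally show "ennreal (cmod (F (Complex x y) - G (Complex x y)) powr p) \<le> ennreal (2 powr p) * (ennreal (?f powr p) + ennreal (?g powr p))"
        by (simp add: ennreal_plus[symmetric] ennreal_mult[symmetric] ennreal_leI del: ennreal_plus)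
    qed
    also have "\<dots> = ennreal (2 powr p) * ((\<integral>\<^sup>+x. ennreal (cmod (F (Complex x y)) powr p) \<partial>lborel) + (\<integral>\<^sup>+x. ennreal (cmod (G (Complex x y)) powr p) \<partial>lborel))"
      by (simp add: nn_integral_cmult nn_integral_add)
    also have "\<dots> \<le> ennreal (2 powr p) * (ennreal M + ennreal N)" using M N y by (intro mult_left_mono add_mono) auto
    finally show "(\<integral>\<^sup>+x. ennreal (cmod (F (Complex x y) - G (Complex x y)) powr p) \<partial>lborel) \<le> ennreal (2 powr p) * (ennreal M + ennreal N)" .
  qed
  also have "\<dots> < \<infinity>" by (simp add: ennreal_mult_less_top)
  finally show ?thesis using Fh Gh by (auto simp: hardy_upper_def intro!: holomorphic_intros)
qed

lemma boundary_upper_cmod: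
  assumes "boundary_upper F f" "f \<in> borel_measurable borel"
  shows "radial_modulus F (\<lambda>x. cmod (f x))"
proof -
  have "AE x in lborel. ((\<lambda>y. cmod (F (Complex x y))) \<longlongrightarrow> cmod (f x)) (at_right 0)"
    using assms(1) unfolding boundary_upper_def by eventually_elim (rule tendsto_norm)
  then show ?thesis using assms(2) by (auto simp: radial_modulus_def)
qed

text \<open>
  The difference is in the Hardy class and has boundary modulus 0, so its Poisson majorant is 0.
\<close>

lemma hardy_upper_unique:
  assumes p: "p > 1" and F: "F \<in> hardy_upper p" "boundary_upper F f" and G: "G \<in> hardy_upper p" "boundary_upper G f" and z: "Im z > 0"
  shows "F z = G z"
proof -
  have "boundary_upper (\<lambda>z. F z - G z) (\<lambda>_. 0)" using F(2) G(2) unfolding boundary_upper_def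
  proof eventually_elim
    case (elim x)
    show ?case using tendsto_diff[OF elim] by simp
  qed
  then have "radial_modulus (\<lambda>z. F z - G z) (\<lambda>x. cmod 0)" by (rule boundary_upper_cmod) simp
  from modulus_le_poisson_boundary[OF hardy_upper_uniformly_integrable[OF p hardy_upper_diff[OF p F(1) G(1)]] this z]
  show ?thesis by simp
qed

lemma Lp_measurable: "f \<in> Lp p \<Longrightarrow> f \<in> borel_measurable borel"
  by (simp add: Lp_def)

lemma Lp_dominated:
  assumes f: "f \<in> Lp p" and p: "p > 0" and [measurable]: "g \<in> borel_measurable borel" and le: "AE x in lborel. cmod (g x) \<le> C * cmod (f x)"
  shows "g \<in> Lp p"
proof -
  have i: "integrable lborel (\<lambda>x. \<bar>C\<bar> powr p * cmod (f x) powr p)" using f by (simp add: Lp_def)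
  have "integrable lborel (\<lambda>x. cmod (g x) powr p)"
  proof (rule Bochner_Integration.integrable_bound[OF i])
    show "AE x in lborel. norm (cmod (g x) powr p) \<le> norm (\<bar>C\<bar> powr p * cmod (f x) powr p)"
      using le
    proof eventually_elim
      case (elim x)
      have "C * cmod (f x) \<le> \<bar>C\<bar> * cmod (f x)" by (intro mult_right_mono) auto
      then have "cmod (g x) powr p \<le> (\<bar>C\<bar> * cmod (f x)) powr p" using elim p by (intro powr_mono2) auto
      then show ?case by (simp add: powr_mult)
    qed
  qed measurable
  then show ?thesis by (simp add: Lp_def)
qed

lemma Lp_cong_AE:
  assumes f: "f \<in> Lp p" and p: "p > 0" and g: "g \<in> borel_measurable borel" and eq: "AE x in lborel. cmod (g x) = cmod (f x)"
  shows "g \<in> Lp p"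
  by (rule Lp_dominated[OF f p g, of 1]) (use eq in eventually_elim, simp)

lemma Lp_nn_integral_finite:
  assumes "f \<in> Lp p"
  shows "(\<integral>\<^sup>+t. ennreal (cmod (f t) powr p) \<partial>lborel) < \<infinity>"
  using assms by (simp add: Lp_def integrable_iff_bounded)

lemma Hp_plus_cong_AE:
  assumes f: "f \<in> Hp_plus p" and p: "p > 0" and g: "g \<in> borel_measurable borel" and eq: "AE x in lborel. g x = f x"
  shows "g \<in> Hp_plus p"
proof -
  obtain F where F: "F \<in> hardy_upper p" "boundary_upper F f" and fL: "f \<in> Lp p" using f by (auto simp: Hp_plus_def)
  have "g \<in> Lp p" by (rule Lp_cong_AE[OF fL p g]) (use eq in eventually_elim, simp)
  moreover have "boundary_upper F g" using F(2) eq unfolding boundary_upper_def by eventually_elim simp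
  ultimately show ?thesis using F(1) by (auto simp: Hp_plus_def)
qed

text \<open>
  Reflection in the real line exchanges the two half-planes, so that everything proved for the upper one applies to
  \<open>Hp_minus\<close> after conjugation of the boundary values.
\<close>

lemma hardy_lower_cnj_iff: "F \<in> hardy_lower p \<longleftrightarrow> (\<lambda>z. cnj (F (cnj z))) \<in> hardy_upper p"
proof -
  have im: "cnj ` {z. Im z > 0} = {z. Im z < 0}" "cnj ` {z. Im z < 0} = {z. Im z > 0}"
    by (auto simp: image_cnj_conv_vimage_cnj)
  have h: "F holomorphic_on {z. Im z < 0} \<longleftrightarrow> (\<lambda>z. cnj (F (cnj z))) holomorphic_on {z. Im z > 0}"
    using holomorphic_on_compose_cnj_cnj[of F "{z. Im z > 0}"] holomorphic_on_compose_cnj_cnj[of "cnj \<circ> F \<circ> cnj" "{z. Im z < 0}"]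
    by (auto simp: im o_def open_halfspace_Im_gt open_halfspace_Im_lt)
  have c: "cnj (Complex x y) = Complex x (- y)" for x y by (simp add: complex_eq_iff)
  have s: "{..<(0::real)} = uminus ` {0<..}" by simp
  have "(SUP y\<in>{..<0}. \<integral>\<^sup>+x. ennreal (cmod (F (Complex x y)) powr p) \<partial>lborel)
     = (SUP y\<in>{0<..}. \<integral>\<^sup>+x. ennreal (cmod (cnj (F (cnj (Complex x y)))) powr p) \<partial>lborel)"
    unfolding s image_image c complex_mod_cnj ..
  then show ?thesis unfolding hardy_lower_def hardy_upper_def mem_Collect_eq h by simp
qed

lemma boundary_lower_cnj_iff: "boundary_lower F f \<longleftrightarrow> boundary_upper (\<lambda>z. cnj (F (cnj z))) (\<lambda>x. cnj (f x))"
proof -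
  have c: "cnj (Complex x y) = Complex x (- y)" for x y by (simp add: complex_eq_iff)
  have "((\<lambda>y. F (Complex x y)) \<longlongrightarrow> f x) (at_left 0) \<longleftrightarrow> ((\<lambda>y. cnj (F (cnj (Complex x y)))) \<longlongrightarrow> cnj (f x)) (at_right 0)" for x
    unfolding at_left_minus[of "0::real"] filterlim_filtermap by (simp add: lim_cnj c)
  then show ?thesis by (simp add: boundary_lower_def boundary_upper_def)
qed

lemma Hp_minus_iff_cnj: "f \<in> Hp_minus p \<longleftrightarrow> (\<lambda>x. cnj (f x)) \<in> Hp_plus p"
proof -
  have m: "f \<in> borel_measurable borel \<longleftrightarrow> (\<lambda>x. cnj (f x)) \<in> borel_measurable borel"
  proof
    assume "(\<lambda>x. cnj (f x)) \<in> borel_measurable borel"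
    then have "(\<lambda>x. cnj (cnj (f x))) \<in> borel_measurable borel" by measurable
    then show "f \<in> borel_measurable borel" by simp
  qed measurable
  have "f \<in> Lp p \<longleftrightarrow> (\<lambda>x. cnj (f x)) \<in> Lp p" by (simp add: Lp_def m)
  moreover have "(\<exists>F\<in>hardy_lower p. boundary_lower F f) \<longleftrightarrow> (\<exists>F\<in>hardy_upper p. boundary_upper F (\<lambda>x. cnj (f x)))"
  proof
    assume "\<exists>F\<in>hardy_lower p. boundary_lower F f"
    then obtain F where "F \<in> hardy_lower p" "boundary_lower F f" by blast
    then have "(\<lambda>z. cnj (F (cnj z))) \<in> hardy_upper p" "boundary_upper (\<lambda>z. cnj (F (cnj z))) (\<lambda>x. cnj (f x))"
      by (simp_all only: hardy_lower_cnj_iff boundary_lower_cnj_iff)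
    then show "\<exists>F\<in>hardy_upper p. boundary_upper F (\<lambda>x. cnj (f x))" by blast
  next
    assume "\<exists>F\<in>hardy_upper p. boundary_upper F (\<lambda>x. cnj (f x))"
    then obtain F where "F \<in> hardy_upper p" "boundary_upper F (\<lambda>x. cnj (f x))" by blast
    then have "(\<lambda>z. cnj (F (cnj z))) \<in> hardy_lower p" "boundary_lower (\<lambda>z. cnj (F (cnj z))) f"
      by (simp_all add: hardy_lower_cnj_iff boundary_lower_cnj_iff)
    then show "\<exists>F\<in>hardy_lower p. boundary_lower F f" by blast
  qed
  ultimately show ?thesis by (simp add: Hp_minus_def Hp_plus_def)
qed

lemma Hp_minus_cong_AE:
  assumes f: "f \<in> Hp_minus p" and p: "p > 0" and g: "g \<in> borel_measurable borel" and eq: "AE x in lborel. g x = f x"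
  shows "g \<in> Hp_minus p"
  unfolding Hp_minus_iff_cnj
proof (rule Hp_plus_cong_AE[OF _ p])
  show "(\<lambda>x. cnj (f x)) \<in> Hp_plus p" using f by (simp add: Hp_minus_iff_cnj)
  show "(\<lambda>x. cnj (g x)) \<in> borel_measurable borel" using g by measurable
  show "AE x in lborel. cnj (g x) = cnj (f x)" using eq by eventually_elim simp
qed

lemma outer_boundary_modulus:
  assumes \<Omega>: "outer_formula \<Omega>" and \<omega>: "boundary_upper \<Omega> \<omega>"
  obtains c u where "cmod c = 1" "poisson_integrable u" "\<And>z. Im z > 0 \<Longrightarrow> \<Omega> z = c * outer u z" "AE x in lborel. cmod (\<omega> x) = exp (u x)"
proof -
  obtain c u where cu: "cmod c = 1" "poisson_integrable u" "\<And>z. Im z > 0 \<Longrightarrow> \<Omega> z = c * outer u z"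
    using \<Omega> unfolding outer_formula_iff by blast
  have m: "AE x in lborel. ((\<lambda>y. cmod (outer u (Complex x y))) \<longlongrightarrow> exp (u x)) (at_right 0)"
    using radial_modulus_outer[OF cu(2)] by (simp add: radial_modulus_def)
  have "AE x in lborel. cmod (\<omega> x) = exp (u x)" using \<omega> m unfolding boundary_upper_def
  proof eventually_elim
    case (elim x)
    have "\<forall>\<^sub>F y in at_right (0::real). cmod (\<Omega> (Complex x y)) = cmod (outer u (Complex x y))"
      using eventually_at_right_less by eventually_elim (simp add: cu norm_mult)
    with tendsto_norm[OF elim(1)] have "((\<lambda>y. cmod (outer u (Complex x y))) \<longlongrightarrow> cmod (\<omega> x)) (at_right 0)"
      by (rule Lim_transform_eventually)
    then show ?case using tendsto_unique[OF trivial_limit_at_right_real _ elim(2)] by blast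
  qed
  then show ?thesis using that cu by blast
qed

text \<open>
  Smirnov's theorem, with the extension given explicitly: Smirnov's inequality bounds the quotient by the Poisson
  integral of \<open>|q|\<close>, and Poisson integrals of \<open>L_p\<close> functions have uniformly bounded \<open>L_p\<close> norms on horizontal lines.
\<close>

theorem smirnov_hardy:
  assumes p: "p > 1" and A: "A \<in> hardy_upper p" "boundary_upper A a" "a \<in> borel_measurable borel"
    and B: "B \<in> hardy_upper p" "boundary_upper B b" "b \<in> borel_measurable borel"
    and \<Omega>: "outer_formula \<Omega>" and \<omega>: "boundary_upper \<Omega> \<omega>"
    and q: "q \<in> Lp p" and eq: "AE x in lborel. q x * \<omega> x = a x * b x"
  shows "(\<lambda>z. A z * B z / \<Omega> z) \<in> hardy_upper p" and "boundary_upper (\<lambda>z. A z * B z / \<Omega> z) q"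
proof -
  obtain c u where cu: "cmod c = 1" "poisson_integrable u" "\<And>z. Im z > 0 \<Longrightarrow> \<Omega> z = c * outer u z" "AE x in lborel. cmod (\<omega> x) = exp (u x)"
    using outer_boundary_modulus[OF \<Omega> \<omega>] by metis
  have Ah: "A holomorphic_on {z. Im z > 0}" and Bh: "B holomorphic_on {z. Im z > 0}" using A B by (auto simp: hardy_upper_def)
  have [simp]: "c \<noteq> 0" using cu(1) by auto
  have Kh: "(\<lambda>z. A z * B z / \<Omega> z) holomorphic_on {z. Im z > 0}"
  proof (rule holomorphic_transform)
    show "(\<lambda>z. A z * B z / (c * outer u z)) holomorphic_on {z. Im z > 0}"
      by (intro holomorphic_intros Ah Bh holomorphic_outer[OF cu(2)]) simp
  qed (simp add: cu(3))
  note [measurable] = Lp_measurable[OF q]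
  show "(\<lambda>z. A z * B z / \<Omega> z) \<in> hardy_upper p"
  proof (rule hardy_upperI_poisson[OF p Kh _ _ Lp_nn_integral_finite[OF q]])
    fix z :: complex assume z: "Im z > 0"
    have "ennreal (cmod (A z * B z / \<Omega> z)) = ennreal (cmod (A z * B z / outer u z))"
      using z cu by (simp add: norm_divide norm_mult)
    also have "\<dots> \<le> nn_poisson (\<lambda>t. cmod (a t) * cmod (b t) * exp (- u t)) z"
      by (rule smirnov_inequality[OF hardy_upper_uniformly_integrable[OF p A(1)] boundary_upper_cmod[OF A(2,3)]
            hardy_upper_uniformly_integrable[OF p B(1)] boundary_upper_cmod[OF B(2,3)] cu(2) z])
    also have "\<dots> = nn_poisson (\<lambda>t. cmod (q t)) z"
    proof (rule nn_integral_cong_AE)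
      show "AE t in lborel. ennreal (poisson_kernel z t) * ennreal (cmod (a t) * cmod (b t) * exp (- u t)) = ennreal (poisson_kernel z t) * ennreal (cmod (q t))"
        using eq cu(4)
      proof eventually_elim
        case (elim t)
        have "cmod (a t) * cmod (b t) = cmod (q t) * exp (u t)" using arg_cong[OF elim(1), of cmod] elim(2) by (simp add: norm_mult)
        then have "cmod (a t) * cmod (b t) * exp (- u t) = cmod (q t)" by (simp add: exp_minus)
        then show ?case by (rule arg_cong)
      qed
    qed
    finally show "ennreal (cmod (A z * B z / \<Omega> z)) \<le> nn_poisson (\<lambda>t. cmod (q t)) z" .
  qed auto
  show "boundary_upper (\<lambda>z. A z * B z / \<Omega> z) q"
    using A(2) B(2) \<omega> eq cu(4) unfolding boundary_upper_def
  proof eventually_elim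
    case (elim x)
    have "\<omega> x \<noteq> 0" using elim(5) by auto
    then have "((\<lambda>y. A (Complex x y) * B (Complex x y) / \<Omega> (Complex x y)) \<longlongrightarrow> a x * b x / \<omega> x) (at_right 0)"
      by (intro tendsto_intros elim)
    moreover have "a x * b x / \<omega> x = q x" using elim(4)[symmetric] \<open>\<omega> x \<noteq> 0\<close> by simp
    ultimately show ?case by simp
  qed
qed

theorem Hp_plus_smirnov:
  assumes p: "p > 1" and a: "a \<in> Hp_plus p" and b: "b \<in> Hp_plus p" and \<omega>: "outer_plus p \<omega>"
    and q: "q \<in> Lp p" and eq: "AE x in lborel. q x * \<omega> x = a x * b x"
  shows "q \<in> Hp_plus p"
proof -
  obtain A where A: "A \<in> hardy_upper p" "boundary_upper A a" "a \<in> borel_measurable borel" using a by (auto simp: Hp_plus_def Lp_def)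
  obtain B where B: "B \<in> hardy_upper p" "boundary_upper B b" "b \<in> borel_measurable borel" using b by (auto simp: Hp_plus_def Lp_def)
  obtain \<Omega> where \<Omega>: "outer_formula \<Omega>" "boundary_upper \<Omega> \<omega>" using \<omega> by (auto simp: outer_plus_def)
  from smirnov_hardy[OF p A B \<Omega> q eq] q show ?thesis by (auto simp: Hp_plus_def)
qed

lemma outer_plus_imp_Hp_plus: "outer_plus p \<omega> \<Longrightarrow> \<omega> \<in> Hp_plus p"
  by (auto simp: outer_plus_def Hp_plus_def)

lemma boundary_nonzero_imp_extension_nonzero:
  assumes "boundary_upper F f" "\<not> (AE x in lborel. f x = 0)"
  obtains z where "Im z > 0" "F z \<noteq> 0"
proof (rule ccontr)
  assume "\<not> thesis"
  then have zero: "\<forall>z. Im z > 0 \<longrightarrow> F z = 0" using that by blast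
  have "AE x in lborel. f x = 0" using assms(1) unfolding boundary_upper_def
  proof eventually_elim
    case (elim x)
    have "\<forall>\<^sub>F y in at_right (0::real). F (Complex x y) = 0"
      using eventually_at_right_less by eventually_elim (simp add: zero)
    with elim have "((\<lambda>_::real. 0) \<longlongrightarrow> f x) (at_right 0)" by (rule Lim_transform_eventually)
    then show ?case by (simp add: tendsto_const_iff)
  qed
  then show False using assms(2) by simp
qed

text \<open>
  The logarithm of the boundary modulus is Poisson integrable because the extension is not identically zero. The outer
  function built from it is in the Hardy class by Jensen's inequality and has radial limits of the right modulus.
\<close>

theorem outer_factor_exists:
  assumes p: "p > 1" and f: "f \<in> Hp_plus p" and nz: "\<not> (AE x in lborel. f x = 0)"
  obtains \<omega> u where "outer_plus p \<omega>" "poisson_integrable u" "outer u \<in> hardy_upper p" "boundary_upper (outer u) \<omega>"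
    "AE x in lborel. cmod (\<omega> x) = cmod (f x)" "AE x in lborel. exp (u x) = cmod (f x)" "\<omega> \<in> borel_measurable borel"
proof -
  obtain F where F: "F \<in> hardy_upper p" "boundary_upper F f" and fL: "f \<in> Lp p" using f by (auto simp: Hp_plus_def)
  note [measurable] = Lp_measurable[OF fL]
  have Fu: "uniformly_integrable_hol F" by (rule hardy_upper_uniformly_integrable[OF p F(1)])
  have Fm: "radial_modulus F (\<lambda>x. cmod (f x))" by (rule boundary_upper_cmod[OF F(2)]) measurable
  obtain z0 where z0: "Im z0 > 0" "F z0 \<noteq> 0" using boundary_nonzero_imp_extension_nonzero[OF F(2) nz] by blast
  define u where "u t = ln (cmod (f t))" for t
  have pos: "AE t in lborel. cmod (f t) > 0" and u: "poisson_integrable u"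
    using log_modulus_poisson_integrable[OF Fu Fm z0] by (auto simp: u_def[abs_def])
  note [measurable] = poisson_integrable_measurable[OF u]
  have eu: "AE x in lborel. exp (u x) = cmod (f x)" using pos by eventually_elim (simp add: u_def)
  have "(\<integral>\<^sup>+t. ennreal (exp (u t) powr p) \<partial>lborel) = (\<integral>\<^sup>+t. ennreal (cmod (f t) powr p) \<partial>lborel)"
    by (intro nn_integral_cong_AE, use eu in eventually_elim) simp
  then have fin: "(\<integral>\<^sup>+t. ennreal (exp (u t) powr p) \<partial>lborel) < \<infinity>" using Lp_nn_integral_finite[OF fL] by simp
  have oh: "outer u \<in> hardy_upper p"
    by (rule hardy_upperI_poisson[OF p holomorphic_outer[OF u] _ _ fin]) (auto simp: norm_outer[OF u] intro: exp_poisson_le[OF u])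
  obtain \<omega> where \<omega>: "\<omega> \<in> borel_measurable borel" "boundary_upper (outer u) \<omega>" "AE x in lborel. cmod (\<omega> x) = exp (u x)"
    using outer_radial_limit[OF u] by blast
  have om: "AE x in lborel. cmod (\<omega> x) = cmod (f x)" using \<omega>(3) eu by eventually_elim simp
  have "\<omega> \<in> Lp p" by (rule Lp_cong_AE[OF fL _ \<omega>(1) om]) (use p in simp)
  moreover have "outer_formula (outer u)" unfolding outer_formula_iff using u by (intro exI[of _ 1] exI[of _ u]) simp
  ultimately have "outer_plus p \<omega>" using oh \<omega>(2) by (auto simp: outer_plus_def)
  then show ?thesis using that u oh \<omega>(2) om eu \<omega>(1) by blast
qed

section \<open>The minimal kernel\<close>

text \<open>
  The outer function enters through its role as the divisor in Smirnov's theorem: dividing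
  \<open>cnj (g * \<phi>) * cnj (g\<^sub>0 * f)\<close> by it leaves \<open>cnj (g * f)\<close>. In an inner-outer factorisation of \<open>\<phi>\<close> the symbol \<open>g\<^sub>0\<close> is
  the conjugate inner factor times the conjugate outer factor divided by the outer factor.
\<close>

theorem min_kernel_eq_toeplitz_kernel:
  assumes p: "p > 1" and \<phi>: "\<phi> \<in> Hp_plus p" and \<omega>: "outer_plus p \<omega>" and g0: "g\<^sub>0 \<in> Linf"
    and eq: "AE x in lborel. g\<^sub>0 x * \<phi> x = cnj (\<omega> x)"
  shows "\<phi> \<in> toeplitz_kernel p g\<^sub>0" and "min_kernel p \<phi> = toeplitz_kernel p g\<^sub>0"
    and "\<And>g. g \<in> Linf \<Longrightarrow> \<phi> \<in> toeplitz_kernel p g \<Longrightarrow> toeplitz_kernel p g\<^sub>0 \<subseteq> toeplitz_kernel p g"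
proof -
  have p0: "p > 0" using p by simp
  have m\<phi>[measurable]: "\<phi> \<in> borel_measurable borel" using \<phi> by (auto simp: Hp_plus_def Lp_def)
  have mg0[measurable]: "g\<^sub>0 \<in> borel_measurable borel" using g0 by (simp add: Linf_def)
  have oH: "\<omega> \<in> Hp_plus p" by (rule outer_plus_imp_Hp_plus[OF \<omega>])
  have oL: "(\<lambda>x. cnj (\<omega> x)) \<in> Hp_minus p" using oH by (simp add: Hp_minus_iff_cnj)
  have "(\<lambda>x. g\<^sub>0 x * \<phi> x) \<in> Hp_minus p" by (rule Hp_minus_cong_AE[OF oL p0 _ eq]) measurable
  then show in0: "\<phi> \<in> toeplitz_kernel p g\<^sub>0" using \<phi> by (simp add: toeplitz_kernel_eq)
  show sub: "toeplitz_kernel p g\<^sub>0 \<subseteq> toeplitz_kernel p g" if g: "g \<in> Linf" and ker: "\<phi> \<in> toeplitz_kernel p g" for g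
  proof
    fix f assume "f \<in> toeplitz_kernel p g\<^sub>0"
    then have f: "f \<in> Hp_plus p" and g0f: "(\<lambda>x. g\<^sub>0 x * f x) \<in> Hp_minus p" by (auto simp: toeplitz_kernel_eq)
    have g\<phi>: "(\<lambda>x. g x * \<phi> x) \<in> Hp_minus p" using ker by (simp add: toeplitz_kernel_eq)
    have fL: "f \<in> Lp p" using f by (simp add: Hp_plus_def)
    note [measurable] = Lp_measurable[OF fL]
    have [measurable]: "g \<in> borel_measurable borel" using g by (simp add: Linf_def)
    obtain C where C: "AE x in lborel. cmod (g x) \<le> C" using g by (auto simp: Linf_def)
    have q: "(\<lambda>x. cnj (g x * f x)) \<in> Lp p"
    proof (rule Lp_dominated[OF fL p0])
      show "AE x in lborel. cmod (cnj (g x * f x)) \<le> C * cmod (f x)"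
        using C by eventually_elim (simp add: norm_mult mult_right_mono)
    qed measurable
    have "(\<lambda>x. cnj (g x * f x)) \<in> Hp_plus p"
    proof (rule Hp_plus_smirnov[OF p _ _ \<omega> q])
      show "(\<lambda>x. cnj (g x * \<phi> x)) \<in> Hp_plus p" using g\<phi> by (simp only: Hp_minus_iff_cnj)
      show "(\<lambda>x. cnj (g\<^sub>0 x * f x)) \<in> Hp_plus p" using g0f by (simp only: Hp_minus_iff_cnj)
      show "AE x in lborel. cnj (g x * f x) * \<omega> x = cnj (g x * \<phi> x) * cnj (g\<^sub>0 x * f x)"
        using eq
      proof eventually_elim
        case (elim x)
        have "\<omega> x = cnj (g\<^sub>0 x * \<phi> x)" using elim by simp
        then show ?case by (simp add: mult_ac)
      qed
    qed
    then have "(\<lambda>x. g x * f x) \<in> Hp_minus p" by (simp only: Hp_minus_iff_cnj)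
    then show "f \<in> toeplitz_kernel p g" using f by (simp add: toeplitz_kernel_eq)
  qed
  show "min_kernel p \<phi> = toeplitz_kernel p g\<^sub>0" unfolding min_kernel_def
  proof (rule Least_equality)
    show "T_kernel p (toeplitz_kernel p g\<^sub>0) \<and> \<phi> \<in> toeplitz_kernel p g\<^sub>0" using g0 in0 by (auto simp: T_kernel_def)
    show "toeplitz_kernel p g\<^sub>0 \<le> K" if "T_kernel p K \<and> \<phi> \<in> K" for K using that sub by (auto simp: T_kernel_def)
  qed
qed

lemma cnj_inner_Linf:
  assumes "inner_fun \<theta>"
  shows "(\<lambda>x. cnj (\<theta> x)) \<in> Linf" "\<theta> \<in> borel_measurable borel" "AE x in lborel. cmod (\<theta> x) = 1"
proof -
  show m: "\<theta> \<in> borel_measurable borel" and u: "AE x in lborel. cmod (\<theta> x) = 1"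
    using assms by (auto simp: inner_fun_def Hinf_plus_def Linf_def)
  have "(\<lambda>x. cnj (\<theta> x)) \<in> borel_measurable borel" using m by measurable
  moreover have "AE x in lborel. cmod (cnj (\<theta> x)) \<le> 1" using u by eventually_elim simp
  ultimately show "(\<lambda>x. cnj (\<theta> x)) \<in> Linf" by (auto simp: Linf_def)
qed

lemma model_space_eq_toeplitz_kernel:
  assumes p: "p > 1" and \<theta>: "inner_fun \<theta>"
  shows "model_space p \<theta> = toeplitz_kernel p (\<lambda>x. cnj (\<theta> x))"
proof -
  note th = cnj_inner_Linf[OF \<theta>]
  note [measurable] = th(2)
  have p0: "p > 0" using p by simp
  have "(\<exists>h\<in>Hp_minus p. AE x in lborel. f x = \<theta> x * h x) \<longleftrightarrow> (\<lambda>x. cnj (\<theta> x) * f x) \<in> Hp_minus p" if f: "f \<in> Hp_plus p" for f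
  proof
    have [measurable]: "f \<in> borel_measurable borel" using f by (auto simp: Hp_plus_def Lp_def)
    assume "\<exists>h\<in>Hp_minus p. AE x in lborel. f x = \<theta> x * h x"
    then obtain h where h: "h \<in> Hp_minus p" "AE x in lborel. f x = \<theta> x * h x" by blast
    show "(\<lambda>x. cnj (\<theta> x) * f x) \<in> Hp_minus p"
    proof (rule Hp_minus_cong_AE[OF h(1) p0])
      show "AE x in lborel. cnj (\<theta> x) * f x = h x" using h(2) th(3)
      proof eventually_elim
        case (elim x)
        have "\<theta> x * cnj (\<theta> x) = 1" using elim(2) by (simp add: complex_norm_square[symmetric])
        moreover have "cnj (\<theta> x) * f x = \<theta> x * cnj (\<theta> x) * h x" unfolding elim(1) by (simp only: mult_ac)
        ultimately show ?case by simp
      qed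
    qed measurable
  next
    assume h: "(\<lambda>x. cnj (\<theta> x) * f x) \<in> Hp_minus p"
    have "AE x in lborel. f x = \<theta> x * (cnj (\<theta> x) * f x)" using th(3)
    proof eventually_elim
      case (elim x)
      have "\<theta> x * cnj (\<theta> x) = 1" using elim by (simp add: complex_norm_square[symmetric])
      then show ?case by (simp flip: mult.assoc)
    qed
    with h show "\<exists>h\<in>Hp_minus p. AE x in lborel. f x = \<theta> x * h x"
      by (intro bexI[of _ "\<lambda>x. cnj (\<theta> x) * f x"])
  qed
  then show ?thesis unfolding model_space_def toeplitz_kernel_eq by blast
qed

section \<open>Functions whose minimal kernel is a model space\<close>

text \<open>
  Smirnov's inequality with second factor 1: the boundary modulus of the quotient is 1.
\<close>

lemma outer_factor_ratio_le_one:
  assumes H: "uniformly_integrable_hol H" and b: "radial_modulus H b"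
    and u: "poisson_integrable u" and eu: "AE x in lborel. exp (u x) = b x" and z: "Im z > 0"
  shows "cmod (H z / outer u z) \<le> 1"
proof -
  have "ennreal (cmod (H z * 1 / outer u z)) \<le> nn_poisson (\<lambda>t. b t * 1 * exp (- u t)) z"
    by (rule smirnov_inequality[OF H b _ _ u z])
       (auto intro: uniformly_integrable_hol_bounded[where c = 1] simp: radial_modulus_def)
  also have "\<dots> = (\<integral>\<^sup>+t. ennreal (poisson_kernel z t) \<partial>lborel)"
  proof (rule nn_integral_cong_AE, use eu in eventually_elim)
    case (elim t)
    have "b t * exp (- u t) = 1" unfolding elim[symmetric] by (simp add: exp_minus)
    then show ?case by simp
  qed
  also have "\<dots> = 1" by (rule nn_integral_poisson_kernel[OF z])
  finally show ?thesis by simp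
qed

lemma divisible_by_all_powers_imp_unimodular:
  assumes c: "cmod c \<le> 1" and div: "\<And>n::nat. \<exists>B. cmod B \<le> M \<and> H = c ^ n * B" and H: "H \<noteq> (0::complex)"
  shows "cmod c = 1"
proof (rule ccontr)
  assume "cmod c \<noteq> 1"
  then have c1: "cmod c < 1" using c by simp
  have le: "cmod H \<le> cmod c ^ n * M" for n
  proof -
    obtain B where "cmod B \<le> M" "H = c ^ n * B" using div[of n] by blast
    then show ?thesis by (simp add: norm_mult norm_power mult_left_mono)
  qed
  have "(\<lambda>n. cmod c ^ n * M) \<longlonglongrightarrow> 0 * M"
    using c1 by (intro tendsto_mult tendsto_const LIMSEQ_power_zero) simp
  then have "cmod H \<le> 0 * M" by (rule LIMSEQ_le_const) (use le in auto)
  then show False using H by simp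
qed

text \<open>
  Here \<open>b / \<omega>\<close> is the inner factor of \<open>b\<close>, and the invariance hypothesis says that its product with a
  member of the model space still lies in \<open>H_p\<^sup>-\<close> after multiplication by \<open>cnj \<theta>\<close>. Smirnov's theorem puts the product
  in \<open>H_p\<^sup>+\<close> as well, so the model space is invariant under the inner factor. Starting from \<open>\<theta> * cnj b\<close> and
  iterating, \<open>b\<close> is divisible by all powers of its inner factor within \<open>H^p\<close>, with quotients of the same boundary modulus. An
  inner factor with modulus below 1 at a point would force \<open>b\<close> to vanish there.
\<close>

theorem outer_if_multiplier_invariant:
  assumes p: "p > 1" and \<theta>: "inner_fun \<theta>" and b: "b \<in> Hp_plus p" and nz: "\<not> (AE x in lborel. b x = 0)"
    and \<omega>: "outer_plus p \<omega>" and ou: "outer u \<in> hardy_upper p" "boundary_upper (outer u) \<omega>" and u: "poisson_integrable u"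
    and eq: "AE x in lborel. cmod (\<omega> x) = cmod (b x)" and eu: "AE x in lborel. exp (u x) = cmod (b x)"
    and in_model: "(\<lambda>x. \<theta> x * cnj (b x)) \<in> Hp_plus p"
    and invariant: "\<And>f. f \<in> model_space p \<theta> \<Longrightarrow> (\<lambda>x. cnj (\<theta> x) * (b x / \<omega> x) * f x) \<in> Hp_minus p"
  shows "outer_plus p b"
proof -
  have p0: "p > 0" using p by simp
  note th = cnj_inner_Linf[OF \<theta>]
  note [measurable] = th(2)
  obtain H where H: "H \<in> hardy_upper p" "boundary_upper H b" and bL: "b \<in> Lp p" using b by (auto simp: Hp_plus_def)
  have \<omega>L: "\<omega> \<in> Lp p" using \<omega> by (simp add: outer_plus_def)
  note [measurable] = Lp_measurable[OF bL] Lp_measurable[OF \<omega>L]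
  have outer_u: "outer_formula (outer u)" unfolding outer_formula_iff using u by (intro exI[of _ 1] exI[of _ u]) simp
  define I where "I z = H z / outer u z" for z
  define i where "i x = b x / \<omega> x" for x
  have [measurable]: "i \<in> borel_measurable borel" unfolding i_def by measurable
  have bw: "AE x in lborel. i x * \<omega> x = b x \<and> cmod (i x) = 1"
    using eq eu
  proof eventually_elim
    case (elim x)
    have "cmod (b x) > 0" using elim(2) by (metis exp_gt_zero)
    then have "\<omega> x \<noteq> 0" "b x \<noteq> 0" using elim(1) by auto
    then show ?case using elim(1) by (simp add: i_def norm_divide)
  qed
  have Hu: "uniformly_integrable_hol H" by (rule hardy_upper_uniformly_integrable[OF p H(1)])
  have Hm: "radial_modulus H (\<lambda>x. cmod (b x))" by (rule boundary_upper_cmod[OF H(2)]) measurable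
  have Ile: "cmod (I z) \<le> 1" if "Im z > 0" for z
    unfolding I_def by (rule outer_factor_ratio_le_one[OF Hu Hm u eu that])
  have powers: "\<exists>\<beta> B. \<beta> \<in> borel_measurable borel \<and> \<beta> \<in> Hp_plus p \<and> B \<in> hardy_upper p \<and> boundary_upper B \<beta>
      \<and> (AE x in lborel. cmod (\<beta> x) = cmod (b x)) \<and> (\<lambda>x. \<theta> x * cnj (\<beta> x)) \<in> Hp_plus p
      \<and> (\<forall>z. Im z > 0 \<longrightarrow> H z = I z ^ n * B z)" for n :: nat
  proof (induction n)
    case 0
    show ?case using b H in_model by (intro exI[of _ b] exI[of _ H]) simp
  next
    case (Suc n)
    then obtain \<beta> B where [measurable]: "\<beta> \<in> borel_measurable borel" and \<beta>: "\<beta> \<in> Hp_plus p" and B: "B \<in> hardy_upper p" "boundary_upper B \<beta>"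
      and m\<beta>: "AE x in lborel. cmod (\<beta> x) = cmod (b x)" and f: "(\<lambda>x. \<theta> x * cnj (\<beta> x)) \<in> Hp_plus p"
      and HB: "\<And>z. Im z > 0 \<Longrightarrow> H z = I z ^ n * B z" by blast
    have fL: "(\<lambda>x. \<theta> x * cnj (\<beta> x)) \<in> Lp p" using f by (simp add: Hp_plus_def)
    have \<beta>L: "\<beta> \<in> Lp p" using \<beta> by (simp add: Hp_plus_def)
    \<comment> \<open>On the line the conjugate of the unimodular i is its inverse, so \<gamma> is the next quotient.\<close>
    define \<gamma> where "\<gamma> x = cnj (i x) * \<beta> x" for x
    have [measurable]: "\<gamma> \<in> borel_measurable borel" unfolding \<gamma>_def by measurable
    have "(\<lambda>x. cnj (\<beta> x)) \<in> Hp_minus p" using \<beta> by (simp add: Hp_minus_iff_cnj)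
    then have "(\<lambda>x. \<theta> x * cnj (\<beta> x)) \<in> model_space p \<theta>" using f by (auto simp: model_space_def)
    from invariant[OF this] have "(\<lambda>x. cnj (\<theta> x) * i x * (\<theta> x * cnj (\<beta> x))) \<in> Hp_minus p" by (simp add: i_def)
    then have "(\<lambda>x. cnj (cnj (\<theta> x) * i x * (\<theta> x * cnj (\<beta> x)))) \<in> Hp_plus p" by (simp only: Hp_minus_iff_cnj)
    then have \<gamma>: "\<gamma> \<in> Hp_plus p"
    proof (rule Hp_plus_cong_AE[OF _ p0])
      show "AE x in lborel. \<gamma> x = cnj (cnj (\<theta> x) * i x * (\<theta> x * cnj (\<beta> x)))" using th(3)
      proof eventually_elim
        case (elim x)
        have one: "\<theta> x * cnj (\<theta> x) = 1" using elim by (simp add: complex_norm_square[symmetric])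
        have "cnj (cnj (\<theta> x) * i x * (\<theta> x * cnj (\<beta> x))) = \<theta> x * cnj (\<theta> x) * (cnj (i x) * \<beta> x)" by (simp add: mult_ac)
        then show ?case by (simp add: one \<gamma>_def)
      qed
    qed measurable
    obtain G where G: "G \<in> hardy_upper p" "boundary_upper G \<gamma>" using \<gamma> by (auto simp: Hp_plus_def)
    have m\<gamma>: "AE x in lborel. cmod (\<gamma> x) = cmod (b x)" using m\<beta> bw by eventually_elim (simp add: \<gamma>_def norm_mult)
    have "(\<lambda>x. \<theta> x * cnj (\<gamma> x)) \<in> Hp_plus p"
    proof (rule Hp_plus_smirnov[OF p b f \<omega>])
      show "(\<lambda>x. \<theta> x * cnj (\<gamma> x)) \<in> Lp p"
      proof (rule Lp_cong_AE[OF fL p0])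
        show "AE x in lborel. cmod (\<theta> x * cnj (\<gamma> x)) = cmod (\<theta> x * cnj (\<beta> x))"
          using m\<beta> m\<gamma> by eventually_elim (simp add: norm_mult)
      qed measurable
      show "AE x in lborel. \<theta> x * cnj (\<gamma> x) * \<omega> x = b x * (\<theta> x * cnj (\<beta> x))"
        using bw
      proof eventually_elim
        case (elim x)
        have "\<theta> x * cnj (\<gamma> x) * \<omega> x = (i x * \<omega> x) * (\<theta> x * cnj (\<beta> x))" by (simp add: \<gamma>_def mult_ac)
        then show ?case using elim by simp
      qed
    qed
    \<comment> \<open>The two sides have the same boundary values almost everywhere, and both are in the Hardy class.\<close>
    moreover have BG: "B z = I z * G z" if z: "Im z > 0" for z
    proof -
      have eq\<beta>: "AE x in lborel. \<beta> x * \<omega> x = b x * \<gamma> x"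
        using bw
      proof eventually_elim
        case (elim x)
        have one: "i x * cnj (i x) = 1" using elim by (simp add: complex_norm_square[symmetric])
        have "b x * \<gamma> x = i x * cnj (i x) * (\<beta> x * \<omega> x)" using elim by (simp add: \<gamma>_def mult_ac flip: elim)
        then show ?case by (simp add: one)
      qed
      have "(\<lambda>z. H z * G z / outer u z) \<in> hardy_upper p" "boundary_upper (\<lambda>z. H z * G z / outer u z) \<beta>"
        by (rule smirnov_hardy[OF p H _ G _ outer_u ou(2) \<beta>L eq\<beta>]; measurable)+
      from hardy_upper_unique[OF p B this z] show ?thesis by (simp add: I_def)
    qed
    ultimately show ?case using \<gamma> G m\<gamma> HB BG
      by (intro exI[of _ \<gamma>] exI[of _ G]) (auto simp: mult_ac)
  qed
  have unimodular: "cmod (I z) = 1" if z: "Im z > 0" and Hz: "H z \<noteq> 0" for z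
  proof -
    have wi: "poisson_integrable (\<lambda>x. cmod (b x))" by (rule poisson_integrable_radial_modulus[OF Hu Hm])
    show ?thesis
    proof (rule divisible_by_all_powers_imp_unimodular[OF Ile[OF z] _ Hz])
      fix n :: nat
      obtain \<beta> B where m: "\<beta> \<in> borel_measurable borel" and B: "B \<in> hardy_upper p" "boundary_upper B \<beta>"
        and m\<beta>: "AE x in lborel. cmod (\<beta> x) = cmod (b x)" and HB: "H z = I z ^ n * B z" using powers[of n] z by blast
      have "ennreal (cmod (B z)) \<le> nn_poisson (\<lambda>t. cmod (\<beta> t)) z"
        by (rule modulus_le_poisson_boundary[OF hardy_upper_uniformly_integrable[OF p B(1)] boundary_upper_cmod[OF B(2) m] z])
      also have "\<dots> = (\<integral>\<^sup>+t. ennreal (poisson_kernel z t * cmod (b t)) \<partial>lborel)"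
        by (intro nn_integral_cong_AE, use m\<beta> in eventually_elim) (simp add: ennreal_mult poisson_kernel_nonneg[OF z])
      also have "\<dots> = ennreal (poisson (\<lambda>x. cmod (b x)) z)" unfolding poisson_def
        using wi poisson_kernel_nonneg[OF z] by (intro nn_integral_eq_integral) (auto simp: poisson_integrable_iff[OF z])
      finally have "cmod (B z) \<le> poisson (\<lambda>x. cmod (b x)) z"
        using poisson_mono[OF poisson_integrable_const wi z, of 0] by (simp add: poisson_const[OF z])
      then show "\<exists>B. cmod B \<le> poisson (\<lambda>x. cmod (b x)) z \<and> H z = I z ^ n * B" using HB by blast
    qed
  qed
  obtain z0 where z0: "Im z0 > 0" "H z0 \<noteq> 0" using boundary_nonzero_imp_extension_nonzero[OF H(2) nz] by blast
  have Ih: "I holomorphic_on {z. Im z > 0}" unfolding I_def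
    using H by (intro holomorphic_intros holomorphic_outer[OF u]) (auto simp: hardy_upper_def)
  have "I constant_on {z. Im z > 0}"
  proof (rule maximum_modulus_principle[OF Ih])
    show "connected {z. Im z > 0}" by (intro convex_connected convex_halfspace_Im_gt)
    show "z0 \<in> {z. Im z > 0}" using z0 by simp
    show "norm (I z) \<le> norm (I z0)" if "z \<in> {z. Im z > 0}" for z using Ile[of z] unimodular[OF z0] that by simp
  qed (auto simp: open_halfspace_Im_gt)
  then obtain c where c: "\<And>z. Im z > 0 \<Longrightarrow> I z = c" by (auto simp: constant_on_def)
  have "cmod c = 1" using unimodular[OF z0] c[OF z0(1)] by simp
  moreover have "H z = c * outer u z" if "Im z > 0" for z using c[OF that] by (simp add: I_def field_simps)
  ultimately have "outer_formula H" unfolding outer_formula_iff using u by blast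
  then show ?thesis using bL H by (auto simp: outer_plus_def)
qed

lemma unimodular_quotient_Linf:
  assumes [measurable]: "f \<in> borel_measurable borel" "g \<in> borel_measurable borel"
    and "AE x in lborel. cmod (f x) = cmod (g x)"
  shows "(\<lambda>x. f x / g x) \<in> Linf"
proof -
  have "AE x in lborel. cmod (f x / g x) \<le> 1" using assms(3) by eventually_elim (simp add: norm_divide)
  then show ?thesis by (auto simp: Linf_def)
qed

theorem theorem5p2:
  fixes p :: real and \<theta> \<phi> :: "real \<Rightarrow> complex"
  assumes "1 < p" and "inner_fun \<theta>"
  shows "(\<phi> \<in> Hp_plus p \<and> \<not> (AE x in lborel. \<phi> x = 0) \<and> model_space p \<theta> = min_kernel p \<phi>)
     \<longleftrightarrow> (\<phi> \<in> Hp_plus p \<and>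
          (\<exists>\<phi>\<^sub>m. outer_minus p \<phi>\<^sub>m \<and> (AE x in lborel. \<phi> x = \<theta> x * \<phi>\<^sub>m x)))"
proof
  note th = cnj_inner_Linf[OF assms(2)]
  note [measurable] = th(2)
  assume "\<phi> \<in> Hp_plus p \<and> (\<exists>\<phi>\<^sub>m. outer_minus p \<phi>\<^sub>m \<and> (AE x in lborel. \<phi> x = \<theta> x * \<phi>\<^sub>m x))"
  then obtain \<psi> where \<phi>: "\<phi> \<in> Hp_plus p" and \<psi>: "outer_minus p \<psi>" and eq: "AE x in lborel. \<phi> x = \<theta> x * \<psi> x" by blast
  have \<omega>: "outer_plus p (\<lambda>x. cnj (\<psi> x))" using \<psi> by (simp add: outer_minus_def)
  then obtain F where F: "outer_formula F" "boundary_upper F (\<lambda>x. cnj (\<psi> x))" by (auto simp: outer_plus_def)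
  obtain u where "AE x in lborel. cmod (cnj (\<psi> x)) = exp (u x)" using outer_boundary_modulus[OF F] by metis
  then have nonzero: "AE x in lborel. \<phi> x \<noteq> 0" using eq th(3)
  proof eventually_elim
    case (elim x)
    have "cmod (\<phi> x) = exp (u x)" using elim by (simp add: norm_mult)
    then show ?case by auto
  qed
  have "\<not> (AE x in lborel. \<phi> x = 0)"
  proof
    assume zero: "AE x in lborel. \<phi> x = 0"
    have "AE x in (lborel :: real measure). False" by (rule eventually_mono[OF eventually_conj[OF zero nonzero]]) simp
    then show False by (auto simp: eventually_ae_filter null_sets_def top.extremum_unique)
  qed
  moreover have "min_kernel p \<phi> = toeplitz_kernel p (\<lambda>x. cnj (\<theta> x))"
  proof (rule min_kernel_eq_toeplitz_kernel(2)[OF assms(1) \<phi> \<omega> th(1)])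
    show "AE x in lborel. cnj (\<theta> x) * \<phi> x = cnj (cnj (\<psi> x))" using eq th(3)
    proof eventually_elim
      case (elim x)
      have one: "\<theta> x * cnj (\<theta> x) = 1" using elim(2) by (simp add: complex_norm_square[symmetric])
      have "cnj (\<theta> x) * \<phi> x = \<theta> x * cnj (\<theta> x) * \<psi> x" unfolding elim(1) by (simp only: mult_ac)
      then show ?case by (simp add: one)
    qed
  qed
  ultimately show "\<phi> \<in> Hp_plus p \<and> \<not> (AE x in lborel. \<phi> x = 0) \<and> model_space p \<theta> = min_kernel p \<phi>"
    using \<phi> model_space_eq_toeplitz_kernel[OF assms] by simp
next
  note p = assms(1) and th = cnj_inner_Linf[OF assms(2)]
  note [measurable] = th(2)
  have p0: "p > 0" using p by simp
  assume "\<phi> \<in> Hp_plus p \<and> \<not> (AE x in lborel. \<phi> x = 0) \<and> model_space p \<theta> = min_kernel p \<phi>"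
  then have \<phi>: "\<phi> \<in> Hp_plus p" and nz: "\<not> (AE x in lborel. \<phi> x = 0)" and min: "model_space p \<theta> = min_kernel p \<phi>" by auto
  have \<phi>m[measurable]: "\<phi> \<in> borel_measurable borel" using \<phi> by (auto simp: Hp_plus_def Lp_def)
  obtain \<omega> u where \<omega>: "outer_plus p \<omega>" "AE x in lborel. cmod (\<omega> x) = cmod (\<phi> x)" "AE x in lborel. exp (u x) = cmod (\<phi> x)"
    and \<omega>m[measurable]: "\<omega> \<in> borel_measurable borel"
    using outer_factor_exists[OF p \<phi> nz] by metis
  define g where "g x = cnj (\<phi> x) / \<omega> x" for x
  have g: "g \<in> Linf" unfolding g_def
    by (rule unimodular_quotient_Linf) (use \<omega>(2) in \<open>measurable, auto\<close>)
  have g\<phi>: "AE x in lborel. g x * \<phi> x = cnj (\<omega> x)" using \<omega>(2,3)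
  proof eventually_elim
    case (elim x)
    have nz: "\<omega> x \<noteq> 0" using elim by (metis exp_not_eq_zero norm_zero)
    have "\<phi> x * cnj (\<phi> x) = \<omega> x * cnj (\<omega> x)" using elim by (simp add: complex_norm_square[symmetric])
    then show ?case using nz by (simp add: g_def field_simps)
  qed
  note least = min_kernel_eq_toeplitz_kernel[OF p \<phi> \<omega>(1) g g\<phi>]
  have "\<phi> \<in> model_space p \<theta>" using least(1,2) min by simp
  then obtain h where h: "h \<in> Hp_minus p" and \<phi>h: "AE x in lborel. \<phi> x = \<theta> x * h x" by (auto simp: model_space_def)
  define b where "b x = cnj (h x)" for x
  have b: "b \<in> Hp_plus p" using h by (simp add: b_def[abs_def] Hp_minus_iff_cnj)
  have bm[measurable]: "b \<in> borel_measurable borel" using b by (auto simp: Hp_plus_def Lp_def)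
  have bnz: "\<not> (AE x in lborel. b x = 0)"
  proof
    assume "AE x in lborel. b x = 0"
    then have "AE x in lborel. \<phi> x = 0" using \<phi>h by eventually_elim (simp add: b_def)
    with nz show False ..
  qed
  obtain \<xi> v where \<xi>: "outer_plus p \<xi>" and v: "poisson_integrable v" and ov: "outer v \<in> hardy_upper p" "boundary_upper (outer v) \<xi>"
    and m\<xi>: "AE x in lborel. cmod (\<xi> x) = cmod (b x)" and ev: "AE x in lborel. exp (v x) = cmod (b x)" and \<xi>m[measurable]: "\<xi> \<in> borel_measurable borel"
    using outer_factor_exists[OF p b bnz] by metis
  let ?k = "\<lambda>x. cnj (\<theta> x) * (b x / \<xi> x)"
  have k: "?k \<in> Linf"
  proof -
    have "AE x in lborel. cmod (?k x) \<le> 1" using th(3) m\<xi> by eventually_elim (simp add: norm_mult norm_divide)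
    then show ?thesis by (auto simp: Linf_def)
  qed
  have "(\<lambda>x. ?k x * \<phi> x) \<in> Hp_minus p"
  proof (rule Hp_minus_cong_AE[OF _ p0])
    show "(\<lambda>x. cnj (\<xi> x)) \<in> Hp_minus p" using outer_plus_imp_Hp_plus[OF \<xi>] by (simp add: Hp_minus_iff_cnj)
    show "AE x in lborel. ?k x * \<phi> x = cnj (\<xi> x)" using \<phi>h th(3) m\<xi> ev
    proof eventually_elim
      case (elim x)
      have nz: "\<xi> x \<noteq> 0" using elim(3,4) by (metis exp_not_eq_zero norm_zero)
      have one: "\<theta> x * cnj (\<theta> x) = 1" using elim(2) by (simp add: complex_norm_square[symmetric])
      have "b x * cnj (b x) = \<xi> x * cnj (\<xi> x)" using elim(3) by (simp add: complex_norm_square[symmetric])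
      then have bb: "b x / \<xi> x * cnj (b x) = cnj (\<xi> x)" using nz by (simp add: field_simps)
      have "?k x * \<phi> x = \<theta> x * cnj (\<theta> x) * (b x / \<xi> x * cnj (b x))" unfolding elim(1) by (simp add: b_def mult_ac)
      then show ?case by (simp only: one bb mult_1_left)
    qed
  qed measurable
  then have "\<phi> \<in> toeplitz_kernel p ?k" using \<phi> by (simp add: toeplitz_kernel_eq)
  from least(3)[OF k this] have sub: "model_space p \<theta> \<subseteq> toeplitz_kernel p ?k" using min least(2) by simp
  have "outer_plus p b"
  proof (rule outer_if_multiplier_invariant[OF p assms(2) b bnz \<xi> ov v m\<xi> ev])
    show "(\<lambda>x. \<theta> x * cnj (b x)) \<in> Hp_plus p"
      by (rule Hp_plus_cong_AE[OF \<phi> p0]) (use \<phi>h in \<open>measurable, auto simp: b_def\<close>)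
    show "(\<lambda>x. cnj (\<theta> x) * (b x / \<xi> x) * f x) \<in> Hp_minus p" if "f \<in> model_space p \<theta>" for f
      using subsetD[OF sub that] by (simp add: toeplitz_kernel_eq)
  qed
  then have "outer_minus p h" using h by (simp add: outer_minus_def b_def[abs_def])
  then show "\<phi> \<in> Hp_plus p \<and> (\<exists>\<phi>\<^sub>m. outer_minus p \<phi>\<^sub>m \<and> (AE x in lborel. \<phi> x = \<theta> x * \<phi>\<^sub>m x))" using \<phi> \<phi>h by blast
qed

end
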